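(* Let $(D',\phi')$ and $(D'',\phi'')$ be basic pairs for $U$. Then $$\sum_{D,\phi}\frac{1}{\langle\xi_{D,\phi},\xi_{D,\phi}\rangle}\,\xi_{D,\phi}(z_{D',\phi'})\,\overline{\xi_{D,\phi}(z_{D'',\phi''})}=\delta_{D',D''}\,\delta_{\phi',\phi''}\,\frac{|U|}{|K_{D',\phi'}|},$$ where the sum is over all basic pairs $(D,\phi)$ for $U$.
   Context: Let $p$ be an odd prime, $q=p^{e}$ ($e\ge 1$), $\mathbb{F}_q$ the field with $q$ elements, $\mathbb{F}_q^{\times}=\mathbb{F}_q\setminus\{0\}$, and $n\ge 1$. Let $G$ be one of $Sp_{2n}(q)$, $O_{2n}(q)$, $O_{2n+1}(q)$; put $m=2n$ in the first two cases and $m=2n+1$ in the third. $U_m(q)$ is the group of unipotent upper-triangular $m\times m$ matrices over $\mathbb{F}_q$, and $U=G\cap U_m(q)$. Explicitly, with $J$ the $n\times n$ matrix with $1$'s on the anti-diagonal and $0$'s elsewhere, $U$ consists of all block matrices $\begin{pmatrix} x & xv & xw\\ 0 & I_r & -v^{T}J\\ 0&0&Jx^{-T}J\end{pmatrix}$ with $x\in U_n(q)$, $v$ an $n\times r$ matrix, $w$ an $n\times n$ matrix over $\mathbb{F}_q$, where: $r=0$ and $Jw^T-wJ=0$ if $G=Sp_{2n}(q)$; $r=0$ and $Jw^T+wJ=0$ if $G=O_{2n}(q)$; $r=1$ and $Jw^T+wJ=-vv^T$ if $G=O_{2n+1}(q)$. Characters are complex characters, and $\langle\cdot,\cdot\rangle$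 is the Frobenius scalar product of class functions on $U$. Indexing. Rows and columns of $m\times m$ matrices are indexed by $1\prec 2\prec\cdots\prec n\prec 0\prec -n\prec\cdots\prec -2\prec -1$ (index $0$ present only if $G=O_{2n+1}(q)$); $e_{i,j}$ denotes a matrix unit. Roots. $\varepsilon_1,\dots,\varepsilon_n$ are formal independent symbols; $\Phi=\{\varepsilon_i\pm\varepsilon_j:1\le i<j\le n\}\cup\Phi'$ with $\Phi'=\{2\varepsilon_i:1\le i\le n\}$ if $G=Sp_{2n}(q)$, $\Phi'=\emptyset$ if $G=O_{2n}(q)$, $\Phi'=\{\varepsilon_i:1\le i\le n\}$ if $G=O_{2n+1}(q)$. For $\alpha\in\Phi$ let $\mathcal{E}(\alpha)$ be: $\{(i,j),(-j,-i)\}$ if $\alpha=\varepsilon_i-\varepsilon_j$; $\{(i,-j),(j,-i)\}$ if $\alpha=\varepsilon_i+\varepsilon_j$ ($i<j$); $\{(i,-i)\}$ if $\alpha=2\varepsilon_i$; $\{(i,0),(0,-i)\}$ if $\alpha=\varepsilon_i$. For $\Psi\subseteq\Phi$, $\mathcal{E}(\Psi)=\bigcup_{\alpha\in\Psi}\mathcal{E}(\alpha)$. Each $\mathcal{E}(\alpha)$ contains exactly one entry $(i,j)$ with $1\le i\le n$ and $i\prec j\preceq -i$; it is called the positive entry of $\alpha$. Basic pairs. $D\subseteq\Phi$ is basic if $\mathcal{E}(D)$ contains at most one entry from each row and at most one from each column. A basic pair for $U$ is $(D,\phi)$ with $D\subseteq\Phi$ basic (possibly empty) and $\phi:D\to\mathbb{F}_q^\times$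 a map. The product $\delta_{D',D''}\delta_{\phi',\phi''}$ is $1$ if $(D',\phi')=(D'',\phi'')$ and $0$ otherwise. Superclasses and representatives. Let $e_\alpha$ be: $e_{i,j}-e_{-j,-i}$ if $\alpha=\varepsilon_i-\varepsilon_j$; $e_{i,-j}+e_{j,-i}$ if $\alpha=\varepsilon_i+\varepsilon_j$ and $G=Sp_{2n}(q)$; $e_{i,-j}-e_{j,-i}$ if $\alpha=\varepsilon_i+\varepsilon_j$ and $G$ is orthogonal; $e_{i,-i}$ if $\alpha=2\varepsilon_i$; $e_{i,0}-e_{0,-i}$ if $\alpha=\varepsilon_i$. Put $e_{D,\phi}=\sum_{\alpha\in D}\phi(\alpha)e_\alpha$ and $K_{D,\phi}=\{x\in U:x-1\in U_m(q)e_{D,\phi}U_m(q)\}$ (the superclasses of $U$). For $z=\begin{pmatrix} x & xv & xw\\ 0 & I_r & -v^{T}J\\ 0&0&Jx^{-T}J\end{pmatrix}\in U$, with $x\in U_n(q)$, $v$ an $n\times r$ matrix and $w$ an $n\times n$ matrix over $\mathbb{F}_q$, let $a_z=\begin{pmatrix} x-1 & v & w'\\ 0&0_r&-v^TJ\\ 0&0&-J(x-1)^TJ\end{pmatrix}$ with $w'=w$ if $r=0$ and $w'=w+\frac12 vv^TJ$ if $r=1$; $z\mapsto a_z$ is a bijection from $U$ onto the $\mathbb{F}_q$-span of $\{e_\alpha:\alpha\in\Phi\}$. $z_{D,\phi}$ is the unique $z\in U$ with $a_z=e_{D,\phi}$; it lies in $K_{D,\phi}$. Supercharacters. Fix a nontrivial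 linear character $\vartheta:\mathbb{F}_q\to\mathbb{C}^\times$ of the additive group of $\mathbb{F}_q$. Define subgroups $U_\alpha\le U$: if $\alpha=\varepsilon_i-\varepsilon_j$, $U_\alpha=\{x\in U:x_{i,k}=0,\ i<k<j\}$; if $\alpha=\varepsilon_i+\varepsilon_j$ ($i<j$), $U_\alpha=\{x\in U:x_{i,k}=x_{j,l}=0,\ i<k\le n,\ j\prec l\preceq 0\}$ (when the index $0$ is absent, $l$ runs over $j<l\le n$); if $\alpha=2\varepsilon_i$ or $\alpha=\varepsilon_i$, $U_\alpha=\{x\in U:x_{i,k}=0,\ i<k\le n\}$. For $r\in\mathbb{F}_q^\times$, $\lambda_{\alpha,r}(x)=\vartheta(r x_{i,j})$, with $(i,j)$ the positive entry of $\alpha$, is a linear character of $U_\alpha$; the elementary character is the induced character $\xi_{\alpha,r}=(\lambda_{\alpha,r})^U$. The supercharacter of a basic pair is $\xi_{D,\phi}=\prod_{\alpha\in D}\xi_{\alpha,\phi(\alpha)}$ (the trivial character $1_U$ if $D=\emptyset$). *)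

theory Defs
  imports "Jordan_Normal_Form.Matrix" "HOL-Algebra.Coset" Complex_Main
begin

section \<open>The unipotent groups\<close>

text \<open>\<open>Symplectic\<close>, \<open>EvenOrth\<close> and \<open>OddOrth\<close> stand for $Sp_{2n}(q)$, $O_{2n}(q)$ and
  $O_{2n+1}(q)$; \<open>mid\<close> is the size $r$ of the middle block.\<close>

datatype gtype = Symplectic | EvenOrth | OddOrth

definition mid :: "gtype \<Rightarrow> nat" where
  "mid ty = (if ty = OddOrth then 1 else 0)"

definition msize :: "gtype \<Rightarrow> nat \<Rightarrow> nat" where
  "msize ty n = 2 * n + mid ty"

definition unitri :: "nat \<Rightarrow> 'a::field mat set" where
  "unitri k = {A \<in> carrier_mat k k. upper_triangular A \<and> (\<forall>i<k. A $$ (i, i) = 1)}"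

definition unitri_group :: "nat \<Rightarrow> 'a::field mat monoid" where
  "unitri_group k = \<lparr>carrier = unitri k, mult = (*), one = 1\<^sub>m k\<rparr>"

definition antidiag :: "nat \<Rightarrow> 'a::field mat" where
  "antidiag n = mat n n (\<lambda>(i, j). if i + j + 1 = n then 1 else 0)"

definition block3 :: "'a::field mat \<Rightarrow> 'a mat \<Rightarrow> 'a mat \<Rightarrow> 'a mat \<Rightarrow> 'a mat \<Rightarrow> 'a mat \<Rightarrow> 'a mat" where
  \<comment> \<open>rows \<open>(A, B, C)\<close>, \<open>(0, D, E)\<close>, \<open>(0, 0, F)\<close>, with square diagonal blocks\<close>
  "block3 A B C D E F =
     four_block_mat
       (four_block_mat A B (0\<^sub>m (dim_row D) (dim_col A)) D)
       (C @\<^sub>r E)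
       (0\<^sub>m (dim_row F) (dim_col A + dim_col D))
       F"

text \<open>$U = G \cap U_m(q)$ in its explicit block form: \<open>U_data\<close> is the set of parameters
  $(x, v, w)$, and \<open>U_mat\<close> the (injective) map to block matrices.\<close>

definition U_data :: "gtype \<Rightarrow> nat \<Rightarrow> ('a::field mat \<times> 'a mat \<times> 'a mat) set" where
  "U_data ty n = {(x, v, w).
     x \<in> unitri n \<and> v \<in> carrier_mat n (mid ty) \<and> w \<in> carrier_mat n n \<and>
     (case ty of
        Symplectic \<Rightarrow> antidiag n * w\<^sup>T - w * antidiag n = 0\<^sub>m n n
      | EvenOrth \<Rightarrow> antidiag n * w\<^sup>T + w * antidiag n = 0\<^sub>m n n
      | OddOrth \<Rightarrow> antidiag n * w\<^sup>T + w * antidiag n = - (v * v\<^sup>T))}"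

definition U_mat :: "gtype \<Rightarrow> nat \<Rightarrow> 'a::field mat \<times> 'a mat \<times> 'a mat \<Rightarrow> 'a mat" where
  "U_mat ty n = (\<lambda>(x, v, w).
     block3 x (x * v) (x * w)
            (1\<^sub>m (mid ty)) (- (v\<^sup>T * antidiag n))
            (antidiag n * (inv\<^bsub>unitri_group n\<^esub> x)\<^sup>T * antidiag n))"

definition U_set :: "gtype \<Rightarrow> nat \<Rightarrow> 'a::field mat set" where
  "U_set ty n = U_mat ty n ` U_data ty n"

definition U_group :: "gtype \<Rightarrow> nat \<Rightarrow> 'a::field mat monoid" where
  "U_group ty n = \<lparr>carrier = U_set ty n, mult = (*), one = 1\<^sub>m (msize ty n)\<rparr>"

section \<open>Signed indices, roots and basic pairs\<close>

text \<open>Rows and columns are labelled by integers in the order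
  $1 \prec \cdots \prec n \prec 0 \prec -n \prec \cdots \prec -1$;
  \<open>pos\<close> translates a label into the 0-based index of the matrix library.
  The label 0 is only meaningful for \<open>OddOrth\<close>.\<close>

definition prec :: "int \<Rightarrow> int \<Rightarrow> bool" where
  "prec i j \<longleftrightarrow>
     (if 0 < i then j \<le> 0 \<or> i < j
      else if i = 0 then j < 0
      else i < j \<and> j < 0)"

definition pos :: "gtype \<Rightarrow> nat \<Rightarrow> int \<Rightarrow> nat" where
  "pos ty n i =
     (if 0 < i then nat (i - 1)
      else if i = 0 then n
      else nat (int (msize ty n) + i))"

definition entry :: "gtype \<Rightarrow> nat \<Rightarrow> 'a mat \<Rightarrow> int \<Rightarrow> int \<Rightarrow> 'a" where
  "entry ty n A i j = A $$ (pos ty n i, pos ty n j)"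

definition unit_mat :: "gtype \<Rightarrow> nat \<Rightarrow> int \<Rightarrow> int \<Rightarrow> 'a::field mat" where
  "unit_mat ty n i j =
     mat (msize ty n) (msize ty n) (\<lambda>(a, b). if a = pos ty n i \<and> b = pos ty n j then 1 else 0)"

text \<open>\<open>Diff i j\<close>, \<open>Plus i j\<close>, \<open>Double i\<close>, \<open>Single i\<close> are the formal symbols
  $\varepsilon_i-\varepsilon_j$, $\varepsilon_i+\varepsilon_j$ (both only used with $i<j$),
  $2\varepsilon_i$ and $\varepsilon_i$.\<close>

datatype root = Diff int int | Plus int int | Double int | Single int

definition roots :: "gtype \<Rightarrow> nat \<Rightarrow> root set" where
  "roots ty n =
     {Diff i j | i j. 1 \<le> i \<and> i < j \<and> j \<le> int n} \<union>
     {Plus i j | i j. 1 \<le> i \<and> i < j \<and> j \<le> int n} \<union>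
     (case ty of
        Symplectic \<Rightarrow> {Double i | i. 1 \<le> i \<and> i \<le> int n}
      | EvenOrth \<Rightarrow> {}
      | OddOrth \<Rightarrow> {Single i | i. 1 \<le> i \<and> i \<le> int n})"

fun entries :: "root \<Rightarrow> (int \<times> int) set" where
  "entries (Diff i j) = {(i, j), (- j, - i)}"
| "entries (Plus i j) = {(i, - j), (j, - i)}"
| "entries (Double i) = {(i, - i)}"
| "entries (Single i) = {(i, 0), (0, - i)}"

definition pos_entry :: "nat \<Rightarrow> root \<Rightarrow> int \<times> int" where
  "pos_entry n \<alpha> =
     (THE (i, j). (i, j) \<in> entries \<alpha> \<and> 1 \<le> i \<and> i \<le> int n \<and> prec i j \<and> (prec j (- i) \<or> j = - i))"

definition basic :: "gtype \<Rightarrow> nat \<Rightarrow> root set \<Rightarrow> bool" where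
  "basic ty n D \<longleftrightarrow> D \<subseteq> roots ty n \<and>
     (\<forall>i j k. (i, j) \<in> \<Union>(entries ` D) \<longrightarrow> (i, k) \<in> \<Union>(entries ` D) \<longrightarrow> j = k) \<and>
     (\<forall>i j k. (i, k) \<in> \<Union>(entries ` D) \<longrightarrow> (j, k) \<in> \<Union>(entries ` D) \<longrightarrow> i = j)"

text \<open>The maps are extensional (\<open>undefined\<close> outside \<open>D\<close>), so that equality of
  pairs in HOL is equality of basic pairs and each pair is counted once.\<close>

definition basic_pairs :: "gtype \<Rightarrow> nat \<Rightarrow> (root set \<times> (root \<Rightarrow> 'a::field)) set" where
  "basic_pairs ty n = (SIGMA D:{D. basic ty n D}. D \<rightarrow>\<^sub>E (UNIV - {0}))"

section \<open>Superclasses and their representatives\<close>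

fun e_root :: "gtype \<Rightarrow> nat \<Rightarrow> root \<Rightarrow> 'a::field mat" where
  "e_root ty n (Diff i j) = unit_mat ty n i j - unit_mat ty n (- j) (- i)"
| "e_root ty n (Plus i j) =
     (if ty = Symplectic then unit_mat ty n i (- j) + unit_mat ty n j (- i)
      else unit_mat ty n i (- j) - unit_mat ty n j (- i))"
| "e_root ty n (Double i) = unit_mat ty n i (- i)"
| "e_root ty n (Single i) = unit_mat ty n i 0 - unit_mat ty n 0 (- i)"

definition e_pair :: "gtype \<Rightarrow> nat \<Rightarrow> root set \<Rightarrow> (root \<Rightarrow> 'a) \<Rightarrow> 'a::field mat" where
  "e_pair ty n D \<phi> =
     mat (msize ty n) (msize ty n) (\<lambda>ab. \<Sum>\<alpha>\<in>D. \<phi> \<alpha> * e_root ty n \<alpha> $$ ab)"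

definition superclass :: "gtype \<Rightarrow> nat \<Rightarrow> root set \<Rightarrow> (root \<Rightarrow> 'a) \<Rightarrow> 'a::field mat set" where
  "superclass ty n D \<phi> =
     {x \<in> U_set ty n. x - 1\<^sub>m (msize ty n) \<in>
        {A * e_pair ty n D \<phi> * B | A B. A \<in> unitri (msize ty n) \<and> B \<in> unitri (msize ty n)}}"

definition a_mat :: "gtype \<Rightarrow> nat \<Rightarrow> 'a::field mat \<Rightarrow> 'a mat" where
  "a_mat ty n z =
     (let (x, v, w) = the_inv_into (U_data ty n) (U_mat ty n) z;
          w' = (if ty = OddOrth then w + (1 / 2) \<cdot>\<^sub>m (v * v\<^sup>T * antidiag n) else w)
      in block3 (x - 1\<^sub>m n) v w'
                (0\<^sub>m (mid ty) (mid ty)) (- (v\<^sup>T * antidiag n))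
                (- (antidiag n * (x - 1\<^sub>m n)\<^sup>T * antidiag n)))"

definition z_rep :: "gtype \<Rightarrow> nat \<Rightarrow> root set \<Rightarrow> (root \<Rightarrow> 'a) \<Rightarrow> 'a::field mat" where
  "z_rep ty n D \<phi> = (THE z. z \<in> U_set ty n \<and> a_mat ty n z = e_pair ty n D \<phi>)"

section \<open>Characters\<close>

definition nontrivial_additive_character :: "('a::field \<Rightarrow> complex) \<Rightarrow> bool" where
  "nontrivial_additive_character \<theta> \<longleftrightarrow>
     (\<forall>a b. \<theta> (a + b) = \<theta> a * \<theta> b) \<and> (\<forall>a. \<theta> a \<noteq> 0) \<and> (\<exists>a. \<theta> a \<noteq> 1)"

text \<open>Character induced from a subgroup \<open>H\<close> of a finite group \<open>G\<close>; values of \<open>\<chi>\<close> outside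
  \<open>H\<close> are irrelevant.\<close>

definition induced :: "('g, 'b) monoid_scheme \<Rightarrow> 'g set \<Rightarrow> ('g \<Rightarrow> complex) \<Rightarrow> 'g \<Rightarrow> complex" where
  "induced G H \<chi> g =
     (\<Sum>y\<in>{y \<in> carrier G. y \<otimes>\<^bsub>G\<^esub> g \<otimes>\<^bsub>G\<^esub> inv\<^bsub>G\<^esub> y \<in> H}. \<chi> (y \<otimes>\<^bsub>G\<^esub> g \<otimes>\<^bsub>G\<^esub> inv\<^bsub>G\<^esub> y))
       / of_nat (card H)"

definition frobenius_product ::
    "('g, 'b) monoid_scheme \<Rightarrow> ('g \<Rightarrow> complex) \<Rightarrow> ('g \<Rightarrow> complex) \<Rightarrow> complex" where
  "frobenius_product G \<chi> \<psi> = (\<Sum>g\<in>carrier G. \<chi> g * cnj (\<psi> g)) / of_nat (order G)"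

fun U_root :: "gtype \<Rightarrow> nat \<Rightarrow> root \<Rightarrow> 'a::field mat set" where
  "U_root ty n (Diff i j) =
     {x \<in> U_set ty n. \<forall>k. i < k \<and> k < j \<longrightarrow> entry ty n x i k = 0}"
| "U_root ty n (Plus i j) =
     {x \<in> U_set ty n. (\<forall>k. i < k \<and> k \<le> int n \<longrightarrow> entry ty n x i k = 0) \<and>
        (\<forall>l. j < l \<and> l \<le> int n \<or> l = 0 \<and> ty = OddOrth \<longrightarrow> entry ty n x j l = 0)}"
| "U_root ty n (Double i) =
     {x \<in> U_set ty n. \<forall>k. i < k \<and> k \<le> int n \<longrightarrow> entry ty n x i k = 0}"
| "U_root ty n (Single i) =
     {x \<in> U_set ty n. \<forall>k. i < k \<and> k \<le> int n \<longrightarrow> entry ty n x i k = 0}"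

definition elem_linear ::
    "gtype \<Rightarrow> nat \<Rightarrow> ('a \<Rightarrow> complex) \<Rightarrow> root \<Rightarrow> 'a \<Rightarrow> 'a::field mat \<Rightarrow> complex" where
  "elem_linear ty n \<theta> \<alpha> r x = (case pos_entry n \<alpha> of (i, j) \<Rightarrow> \<theta> (r * entry ty n x i j))"

definition elementary_character ::
    "gtype \<Rightarrow> nat \<Rightarrow> ('a \<Rightarrow> complex) \<Rightarrow> root \<Rightarrow> 'a \<Rightarrow> 'a::field mat \<Rightarrow> complex" where
  "elementary_character ty n \<theta> \<alpha> r =
     induced (U_group ty n) (U_root ty n \<alpha>) (elem_linear ty n \<theta> \<alpha> r)"

definition supercharacter ::
    "gtype \<Rightarrow> nat \<Rightarrow> ('a \<Rightarrow> complex) \<Rightarrow> root set \<Rightarrow> (root \<Rightarrow> 'a) \<Rightarrow> 'a::field mat \<Rightarrow> complex" where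
  "supercharacter ty n \<theta> D \<phi> z = (\<Prod>\<alpha>\<in>D. elementary_character ty n \<theta> \<alpha> (\<phi> \<alpha>) z)"

end

theory Submission
  imports Defs "Jordan_Normal_Form.Determinant"
begin

text \<open>Let \<open>\<Omega>\<close> be the antidiagonal Gram matrix of the form preserved by \<open>G\<close>. The Cayley transform
  \<open>z \<mapsto> (z - 1) ((z + 1) / 2)\<^sup>-\<^sup>1 \<Omega>\<close> identifies \<open>U\<close> with the space of all \<open>m \<times> m\<close> matrices that are
  symmetric (symplectic case) or antisymmetric (orthogonal case) and vanish on and below the
  antidiagonal. On this space the group of all unitriangular matrices acts by congruence
  \<open>S \<mapsto> g S g\<^sup>T\<close>. Since \<open>p\<close> is odd, symmetric Gaussian elimination shows that every orbit contains a
  monomial matrix, and the monomial matrices correspond to the basic pairs; so superclasses become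
  orbits. Since the roots of a basic set occupy pairwise disjoint rows, the product of elementary
  characters becomes, up to a nonzero scalar, the orbit sum
  \<open>S \<mapsto> \<Sum>\<^sub>g \<theta> (f (g S g\<^sup>T))\<close> of a linear functional \<open>f\<close> given by a monomial matrix. Functionals
  belonging to different basic pairs have disjoint orbits, so that orbit sums are orthogonal, and
  inverting the resulting square matrix turns row orthogonality into column orthogonality.\<close>

(* keeps \<open>order\<close> bound to the group order of HOL-Algebra *)
hide_const (open) Polynomial.order

subsection \<open>Unitriangular matrices\<close>

text \<open>The Cayley transform is used because z - 1 in general lies outside the Lie algebra of
  the form and a logarithm would need p large against the matrix size, whereas this transform
  divides by 2 only. Conjugation by y in U becomes S to y S y^T because y^{-1} \<Omega> = \<Omega>
  y^T. The obstacle is that an induced character averages over U alone, which is much smaller than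
  the group of all unitriangular matrices. The latter is therefore factorised as P U, with a
  subgroup P adapted to the root: averaging the character of the linear functional over P yields the
  indicator of U_\<alpha> times its linear character, so both averages together run over the full
  group. Superclasses pose the converse problem, since their definition allows two independent
  factors; there the uniqueness of the monomial matrix in a two-sided orbit leads back to
  congruence. The same monomial matrices label orbits and functionals, which makes the array of
  values square. The scalars between supercharacters and orbit sums cancel because each summand is
  divided by the norm of its supercharacter.\<close>

lemma finite_carrier_mat [simp]: "finite (carrier_mat r c :: 'a::finite mat set)"
proof -
  have "carrier_mat r c \<subseteq> (\<lambda>f. mat r c f) ` (({..<r} \<times> {..<c}) \<rightarrow>\<^sub>E (UNIV :: 'a set))"
  proof
    fix A :: "'a mat" assume A: "A \<in> carrier_mat r c"
    have "A = mat r c (restrict (\<lambda>ij. A $$ ij) ({..<r} \<times> {..<c}))"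
      using A by (intro eq_matI) auto
    then show "A \<in> (\<lambda>f. mat r c f) ` (({..<r} \<times> {..<c}) \<rightarrow>\<^sub>E UNIV)"
      by (intro image_eqI[where x = "restrict (\<lambda>ij. A $$ ij) ({..<r} \<times> {..<c})"]) auto
  qed
  then show ?thesis
    by (rule finite_subset) (intro finite_imageI finite_PiE, auto)
qed

lemma index_mult_mat_sum:
  assumes "A \<in> carrier_mat r m" "B \<in> carrier_mat m c" "i < r" "j < c"
  shows "(A * B) $$ (i, j) = (\<Sum>k<m. A $$ (i, k) * B $$ (k, j))"
  using assms by (auto simp: scalar_prod_def atLeast0LessThan intro!: sum.cong)

lemma unitri_carrier: "A \<in> unitri m \<Longrightarrow> A \<in> carrier_mat m m"
  by (simp add: unitri_def)

lemma unitri_iff: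
  "A \<in> unitri m \<longleftrightarrow> A \<in> carrier_mat m m \<and>
     (\<forall>i<m. \<forall>j<m. j < i \<longrightarrow> A $$ (i, j) = 0) \<and> (\<forall>i<m. A $$ (i, i) = 1)"
  by (auto simp: unitri_def upper_triangular_def)

lemma unitri_diag: "A \<in> unitri m \<Longrightarrow> i < m \<Longrightarrow> A $$ (i, i) = 1"
  by (simp add: unitri_def)

lemma unitri_lower: "A \<in> unitri m \<Longrightarrow> j < i \<Longrightarrow> i < m \<Longrightarrow> A $$ (i, j) = 0"
  by (simp add: unitri_iff)

lemma finite_unitri [simp]: "finite (unitri m :: 'a::{field,finite} mat set)"
  by (rule finite_subset[OF _ finite_carrier_mat[of m m]]) (auto simp: unitri_def)

lemma one_unitri [simp]: "1\<^sub>m m \<in> unitri m"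
  by (auto simp: unitri_iff)

lemma mult_unitri:
  assumes A: "A \<in> unitri m" and B: "B \<in> unitri m"
  shows "A * B \<in> unitri m"
proof -
  note c = unitri_carrier[OF A] unitri_carrier[OF B]
  have low: "(A * B) $$ (i, j) = 0" if "i < m" "j < m" "j < i" for i j
  proof -
    have "A $$ (i, k) * B $$ (k, j) = 0" if "k < m" for k
      using A B \<open>i < m\<close> \<open>j < m\<close> \<open>j < i\<close> that
      by (cases "k < i") (auto simp: unitri_lower)
    then show ?thesis using that by (simp add: index_mult_mat_sum[OF c] sum.neutral del: mult_eq_0_iff)
  qed
  have diag: "(A * B) $$ (i, i) = 1" if "i < m" for i
  proof -
    have "A $$ (i, k) * B $$ (k, i) = (if k = i then 1 else 0)" if "k < m" for k
      using A B \<open>i < m\<close> that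
      by (cases k i rule: linorder_cases) (auto simp: unitri_lower unitri_diag)
    then show ?thesis using that by (simp add: index_mult_mat_sum[OF c])
  qed
  show ?thesis using c low diag by (auto simp: unitri_iff)
qed

lemma det_unitri: "A \<in> unitri m \<Longrightarrow> det A = 1"
  by (subst det_upper_triangular[of A m])
     (auto simp: unitri_def prod_list_diag_prod)

lemma unitri_left_cancel:
  assumes "A \<in> unitri m" "B \<in> carrier_mat m k" "C \<in> carrier_mat m k" "A * B = A * C"
  shows "B = C"
proof -
  have A: "A \<in> carrier_mat m m" using assms by (simp add: unitri_carrier)
  have "det A \<noteq> 0" using assms(1) by (simp add: det_unitri)
  then obtain A' where A': "A' \<in> carrier_mat m m" "A' * A = 1\<^sub>m m"
    using A det_non_zero_imp_unit[OF A] by (auto simp: Units_def ring_mat_simps ring_mat_def)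
  have "A' * A * B = A' * A * C"
    using assms(2-4) A A'(1) assoc_mult_mat[OF A'(1) A assms(2)] assoc_mult_mat[OF A'(1) A assms(3)] by simp
  then show ?thesis using assms(2,3) A' by simp
qed

text \<open>Left multiplication by \<open>A\<close> is injective on the finite set
  \<open>unitri m\<close>, hence onto, so the identity is reached: the inverse is seen to be
  unitriangular without being computed.\<close>

lemma unitri_inverse_ex:
  assumes A: "A \<in> (unitri m :: 'a::{field,finite} mat set)"
  shows "\<exists>B\<in>unitri m. A * B = 1\<^sub>m m \<and> B * A = 1\<^sub>m m"
proof -
  have "inj_on ((*) A) (unitri m)"
    by (rule inj_onI) (metis A unitri_left_cancel unitri_carrier)
  moreover have "(*) A ` unitri m \<subseteq> unitri m" using A by (auto intro: mult_unitri)
  ultimately have "(*) A ` unitri m = unitri m" by (intro endo_inj_surj) auto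
  then obtain B where "B \<in> unitri m" "A * B = 1\<^sub>m m"
    by (metis image_iff one_unitri)
  with A show ?thesis
    using mat_mult_left_right_inverse[of A m B] by (auto simp: unitri_carrier)
qed

text \<open>A choice of inverse that works in plain matrix algebra; \<open>inv_unitri_group\<close>
  and \<open>inv_U_group\<close> identify it with the inverses of the two group structures.\<close>

definition uinv :: "nat \<Rightarrow> 'a::{field,finite} mat \<Rightarrow> 'a mat" where
  "uinv m A = (SOME B. B \<in> unitri m \<and> A * B = 1\<^sub>m m \<and> B * A = 1\<^sub>m m)"

lemma uinv:
  assumes "A \<in> unitri m"
  shows "uinv m A \<in> unitri m" "A * uinv m A = 1\<^sub>m m" "uinv m A * A = 1\<^sub>m m"
proof -
  have "uinv m A \<in> unitri m \<and> A * uinv m A = 1\<^sub>m m \<and> uinv m A * A = 1\<^sub>m m"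
    unfolding uinv_def by (rule someI_ex) (use unitri_inverse_ex[OF assms] in blast)
  then show "uinv m A \<in> unitri m" "A * uinv m A = 1\<^sub>m m" "uinv m A * A = 1\<^sub>m m" by auto
qed

lemma unitri_group_simps [simp]:
  "carrier (unitri_group m) = unitri m" "x \<otimes>\<^bsub>unitri_group m\<^esub> y = x * y"
  "\<one>\<^bsub>unitri_group m\<^esub> = 1\<^sub>m m"
  by (simp_all add: unitri_group_def)

lemma unitri_group_group: "group (unitri_group m :: 'a::{field,finite} mat monoid)"
proof (rule groupI, unfold unitri_group_simps)
  fix x y z :: "'a mat" assume "x \<in> unitri m" "y \<in> unitri m" "z \<in> unitri m"
  then show "x * y * z = x * (y * z)"
    by (intro assoc_mult_mat[of _ m m _ m _ m] unitri_carrier)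
next
  fix x :: "'a mat" assume x: "x \<in> unitri m"
  then show "1\<^sub>m m * x = x" by (intro left_mult_one_mat[of _ m m] unitri_carrier)
  show "\<exists>y\<in>unitri m. y * x = 1\<^sub>m m" using uinv[OF x] by blast
qed (auto intro: mult_unitri)

lemma inv_unitri_group:
  assumes "A \<in> (unitri m :: 'a::{field,finite} mat set)"
  shows "inv\<^bsub>unitri_group m\<^esub> A = uinv m A"
proof -
  interpret group "unitri_group m :: 'a mat monoid" by (rule unitri_group_group)
  show ?thesis
    by (rule inv_equality) (use assms uinv[OF assms] in \<open>auto simp: unitri_group_def\<close>)
qed

subsection \<open>Uniqueness of monomial normal forms\<close>

text \<open>Induction on \<open>\<rho> i + \<kappa> j\<close>. At a nonzero entry of
  \<open>M\<close> the left side of \<open>eq\<close> is \<open>M i j\<close>, because column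
  \<open>j\<close> of \<open>M\<close> has no other entry; so some \<open>M' i k * H k j\<close> is
  nonzero. If \<open>k\<close> differs from \<open>j\<close>, then \<open>(i, k)\<close> comes
  earlier, the induction hypothesis makes \<open>M i k\<close> nonzero, and row \<open>i\<close> of
  \<open>M\<close> has two entries, which is impossible. For \<open>M'\<close> rows and columns
  exchange roles. The region \<open>R\<close> covers the situation in which the equation is known
  only above the antidiagonal.\<close>

lemma monomial_uniqueness:
  fixes M M' :: "'r \<Rightarrow> 'c \<Rightarrow> 'a::field" and \<rho> :: "'r \<Rightarrow> nat" and \<kappa> :: "'c \<Rightarrow> nat"
  assumes fin: "finite I" "finite J"
    and supp: "\<And>i j. M i j \<noteq> 0 \<Longrightarrow> i \<in> I \<and> j \<in> J \<and> (i, j) \<in> R"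
      "\<And>i j. M' i j \<noteq> 0 \<Longrightarrow> i \<in> I \<and> j \<in> J \<and> (i, j) \<in> R"
    and mono: "\<And>i j k. M i j \<noteq> 0 \<Longrightarrow> M i k \<noteq> 0 \<Longrightarrow> j = k"
      "\<And>i j k. M i k \<noteq> 0 \<Longrightarrow> M j k \<noteq> 0 \<Longrightarrow> i = j"
      "\<And>i j k. M' i j \<noteq> 0 \<Longrightarrow> M' i k \<noteq> 0 \<Longrightarrow> j = k"
      "\<And>i j k. M' i k \<noteq> 0 \<Longrightarrow> M' j k \<noteq> 0 \<Longrightarrow> i = j"
    and G: "\<And>i. i \<in> I \<Longrightarrow> G i i = 1"
      "\<And>i k. i \<in> I \<Longrightarrow> k \<in> I \<Longrightarrow> G i k \<noteq> 0 \<Longrightarrow> k \<noteq> i \<Longrightarrow> \<rho> k < \<rho> i"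
    and H: "\<And>j. j \<in> J \<Longrightarrow> H j j = 1"
      "\<And>k j. k \<in> J \<Longrightarrow> j \<in> J \<Longrightarrow> H k j \<noteq> 0 \<Longrightarrow> k \<noteq> j \<Longrightarrow> \<kappa> k < \<kappa> j"
    and eq: "\<And>i j. i \<in> I \<Longrightarrow> j \<in> J \<Longrightarrow> (i, j) \<in> R \<Longrightarrow>
      (\<Sum>k\<in>I. G i k * M k j) = (\<Sum>k\<in>J. M' i k * H k j)"
  shows "M = M'"
proof -
  have key: "(M i j \<noteq> 0 \<longrightarrow> M' i j = M i j) \<and> (M' i j \<noteq> 0 \<longrightarrow> M i j = M' i j)" for i j
  proof (induction "\<rho> i + \<kappa> j" arbitrary: i j rule: less_induct)
    case less
    show ?case
    proof (intro conjI impI)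
      assume nz: "M i j \<noteq> 0"
      then have ij: "i \<in> I" "j \<in> J" "(i, j) \<in> R" using supp by auto
      have "(\<Sum>k\<in>I. G i k * M k j) = (\<Sum>k\<in>I. if k = i then M i j else 0)"
        using mono(2)[OF nz] G(1)[OF ij(1)] by (intro sum.cong) auto
      then have L: "(\<Sum>k\<in>J. M' i k * H k j) = M i j"
        using eq[OF ij] ij fin by (simp add: sum.delta)
      then obtain k where k: "k \<in> J" "M' i k * H k j \<noteq> 0"
        using nz by (elim sum.not_neutral_contains_not_neutral[of "\<lambda>k. M' i k * H k j" J, rotated]) auto
      then have k0: "M' i k \<noteq> 0" "H k j \<noteq> 0" by auto
      show "M' i j = M i j"
      proof (cases "k = j")
        case True
        have "(\<Sum>l\<in>J. M' i l * H l j) = (\<Sum>l\<in>J. if l = j then M' i j else 0)"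
          using mono(3)[OF k0(1)] True H(1)[OF ij(2)] by (intro sum.cong) auto
        then show ?thesis using L ij fin by (simp add: sum.delta)
      next
        case False
        then have "\<kappa> k < \<kappa> j" using H(2) k(1) ij k0 by blast
        then have "\<rho> i + \<kappa> k < \<rho> i + \<kappa> j" by simp
        from less[OF this] have "M i k = M' i k" using k0 by blast
        then have "M i k \<noteq> 0" using k0 by simp
        then show ?thesis using mono(1)[OF nz] False by metis
      qed
    next
      assume nz: "M' i j \<noteq> 0"
      then have ij: "i \<in> I" "j \<in> J" "(i, j) \<in> R" using supp by auto
      have "(\<Sum>k\<in>J. M' i k * H k j) = (\<Sum>k\<in>J. if k = j then M' i j else 0)"
        using mono(3)[OF nz] H(1)[OF ij(2)] by (intro sum.cong) auto
      then have L: "(\<Sum>k\<in>I. G i k * M k j) = M' i j"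
        using eq[OF ij] ij fin by (simp add: sum.delta)
      then obtain k where k: "k \<in> I" "G i k * M k j \<noteq> 0"
        using nz by (elim sum.not_neutral_contains_not_neutral[of "\<lambda>k. G i k * M k j" I, rotated]) auto
      then have k0: "M k j \<noteq> 0" "G i k \<noteq> 0" by auto
      show "M i j = M' i j"
      proof (cases "k = i")
        case True
        have "(\<Sum>l\<in>I. G i l * M l j) = (\<Sum>l\<in>I. if l = i then M i j else 0)"
          using mono(2)[OF k0(1)] True G(1)[OF ij(1)] by (intro sum.cong) auto
        then show ?thesis using L ij fin by (simp add: sum.delta)
      next
        case False
        then have "\<rho> k < \<rho> i" using G(2) k(1) ij k0 by blast
        then have "\<rho> k + \<kappa> j < \<rho> i + \<kappa> j" by simp
        from less[OF this] have "M' k j = M k j" using k0 by blast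
        then have "M' k j \<noteq> 0" using k0 by simp
        then show ?thesis using mono(4)[OF nz] False by metis
      qed
    qed
  qed
  show ?thesis
  proof (intro ext)
    fix i j show "M i j = M' i j" using key[of i j] by metis
  qed
qed

subsection \<open>Additive characters and square arrays\<close>

lemma additive_character_zero:
  "nontrivial_additive_character \<theta> \<Longrightarrow> \<theta> 0 = 1"
  unfolding nontrivial_additive_character_def by (metis add_0 mult_cancel_right1)

lemma additive_character_add:
  "nontrivial_additive_character \<theta> \<Longrightarrow> \<theta> (a + b) = \<theta> a * \<theta> b"
  unfolding nontrivial_additive_character_def by blast

lemma additive_character_sum:
  "nontrivial_additive_character \<theta> \<Longrightarrow> \<theta> (\<Sum>i\<in>A. f i) = (\<Prod>i\<in>A. \<theta> (f i))"
  by (induction A rule: infinite_finite_induct)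
     (auto simp: additive_character_zero additive_character_add)

text \<open>Translation by 1 permutes the field, so the sum of all x + 1 equals the sum of all
  x.\<close>

lemma of_nat_card_UNIV_eq_0: "of_nat (card (UNIV :: 'a set)) = (0 :: 'a::{field,finite})"
proof -
  have "(\<Sum>x\<in>UNIV. x + 1) = (\<Sum>x\<in>UNIV. x :: 'a)"
    by (rule sum.reindex_bij_witness[of _ "\<lambda>x. x - 1" "\<lambda>x. x + 1"]) auto
  then show ?thesis by (simp add: sum.distrib)
qed

lemma two_neq_zero_if_odd_card:
  assumes "odd (card (UNIV :: 'a::{field,finite} set))"
  shows "(2 :: 'a) \<noteq> 0"
proof
  assume two: "(2 :: 'a) = 0"
  obtain k where k: "card (UNIV :: 'a set) = 2 * k + 1" using assms oddE by blast
  have "of_nat (card (UNIV :: 'a set)) = (2 * of_nat k + 1 :: 'a)" by (simp add: k)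
  with of_nat_card_UNIV_eq_0[where 'a = 'a] two show False by simp
qed

text \<open>The definition only asks for nonzero values. Unit modulus follows from
  \<open>\<theta> a ^ N = \<theta> (N a) = 1\<close>, where \<open>N\<close> is the size of the
  field, which is zero in the field.\<close>

lemma additive_character_minus:
  fixes \<theta> :: "'a::{field,finite} \<Rightarrow> complex"
  assumes \<theta>: "nontrivial_additive_character \<theta>"
  shows "\<theta> (- a) = cnj (\<theta> a)"
proof -
  let ?N = "card (UNIV :: 'a set)"
  have pow: "\<theta> (of_nat k * a) = \<theta> a ^ k" for k
    by (induction k) (auto simp: additive_character_zero[OF \<theta>] additive_character_add[OF \<theta>] algebra_simps)
  have "\<theta> a ^ ?N = 1"
    using pow[of ?N] by (simp add: of_nat_card_UNIV_eq_0 additive_character_zero[OF \<theta>])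
  moreover have "?N > 0" by (simp add: finite_UNIV_card_ge_0)
  ultimately have "norm (\<theta> a) = 1"
    by (metis norm_one norm_power power_eq_1_iff norm_ge_zero less_numeral_extra(3))
  then have "\<theta> a * cnj (\<theta> a) = 1" by (simp add: complex_norm_square[symmetric])
  moreover have "\<theta> a * \<theta> (- a) = 1"
    using additive_character_add[OF \<theta>, of a "- a"] by (simp add: additive_character_zero[OF \<theta>])
  ultimately have "\<theta> a * \<theta> (- a) = \<theta> a * cnj (\<theta> a)" "\<theta> a \<noteq> 0" by auto
  then show ?thesis by simp
qed

text \<open>The passage from row to column orthogonality rests on both indices running through the
  same finite set; an enumeration of \<open>I\<close> reduces it to square matrices.\<close>

lemma right_inverse_imp_left_inverse:
  fixes A B :: "'i \<Rightarrow> 'i \<Rightarrow> 'b::field"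
  assumes fin: "finite I"
    and AB: "\<And>i j. i \<in> I \<Longrightarrow> j \<in> I \<Longrightarrow> (\<Sum>k\<in>I. A i k * B k j) = of_bool (i = j)"
    and "i \<in> I" "j \<in> I"
  shows "(\<Sum>k\<in>I. B i k * A k j) = of_bool (i = j)"
proof -
  define N where "N = card I"
  obtain f where f: "bij_betw f {..<N} I"
    using fin by (metis N_def ex_bij_betw_nat_finite lessThan_atLeast0)
  have inj: "f a = f b \<longleftrightarrow> a = b" if "a < N" "b < N" for a b
    using f that by (auto simp: bij_betw_def inj_on_def)
  have mem: "f a \<in> I" if "a < N" for a using f that by (auto simp: bij_betw_def)
  define X where "X = mat N N (\<lambda>(a, b). A (f a) (f b))"
  define Y where "Y = mat N N (\<lambda>(a, b). B (f a) (f b))"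
  have c: "X \<in> carrier_mat N N" "Y \<in> carrier_mat N N" by (auto simp: X_def Y_def)
  have "X * Y = 1\<^sub>m N"
  proof (rule eq_matI)
    fix a b assume "a < dim_row (1\<^sub>m N :: 'b mat)" "b < dim_col (1\<^sub>m N :: 'b mat)"
    then have ab: "a < N" "b < N" by auto
    have "(X * Y) $$ (a, b) = (\<Sum>k<N. A (f a) (f k) * B (f k) (f b))"
      using ab by (simp add: index_mult_mat_sum[OF c]) (simp add: X_def Y_def)
    also have "\<dots> = (\<Sum>k\<in>I. A (f a) k * B k (f b))"
      by (rule sum.reindex_bij_betw[OF f])
    finally show "(X * Y) $$ (a, b) = 1\<^sub>m N $$ (a, b)"
      using ab by (simp add: AB mem inj)
  qed (auto simp: X_def Y_def)
  then have YX: "Y * X = 1\<^sub>m N" using mat_mult_left_right_inverse[OF c] by simp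
  obtain a b where ab: "a < N" "b < N" "i = f a" "j = f b"
    using f assms(3,4) by (auto simp: bij_betw_def)
  have "(\<Sum>k\<in>I. B i k * A k j) = (\<Sum>k<N. B (f a) (f k) * A (f k) (f b))"
    unfolding ab by (rule sum.reindex_bij_betw[OF f, symmetric])
  also have "\<dots> = (Y * X) $$ (a, b)"
    using ab by (simp add: index_mult_mat_sum[OF c(2,1)]) (simp add: X_def Y_def)
  finally show ?thesis using ab by (simp add: YX inj)
qed

subsection \<open>Congruence of symmetric and antisymmetric matrices\<close>

definition eps_symmetric :: "'a::field \<Rightarrow> nat \<Rightarrow> 'a mat set" where
  "eps_symmetric \<epsilon> m = {S \<in> carrier_mat m m. \<forall>a<m. \<forall>b<m. S $$ (b, a) = \<epsilon> * S $$ (a, b)}"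

lemma eps_symmetricD:
  "S \<in> eps_symmetric \<epsilon> m \<Longrightarrow> a < m \<Longrightarrow> b < m \<Longrightarrow> S $$ (b, a) = \<epsilon> * S $$ (a, b)"
  unfolding eps_symmetric_def by blast

lemma eps_symmetric_carrier: "S \<in> eps_symmetric \<epsilon> m \<Longrightarrow> S \<in> carrier_mat m m"
  unfolding eps_symmetric_def by blast

lemma eps_symmetricI:
  "S \<in> carrier_mat m m \<Longrightarrow> (\<And>a b. a < m \<Longrightarrow> b < m \<Longrightarrow> S $$ (b, a) = \<epsilon> * S $$ (a, b)) \<Longrightarrow>
    S \<in> eps_symmetric \<epsilon> m"
  unfolding eps_symmetric_def by blast

text \<open>For \<epsilon>-symmetric matrices the corresponding condition on columns follows by
  symmetry, see \<open>monomial_cols\<close>.\<close>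

definition monomial_rows :: "nat \<Rightarrow> 'a::zero mat \<Rightarrow> bool" where
  "monomial_rows m S \<longleftrightarrow>
     (\<forall>a<m. \<forall>b<m. \<forall>c<m. S $$ (a, b) \<noteq> 0 \<longrightarrow> S $$ (a, c) \<noteq> 0 \<longrightarrow> b = c)"

lemma congruence_index:
  assumes "g \<in> carrier_mat m m" "S \<in> carrier_mat m m" "i < m" "j < m"
  shows "(g * S * g\<^sup>T) $$ (i, j) = (\<Sum>a<m. \<Sum>b<m. g $$ (i, a) * S $$ (a, b) * g $$ (j, b))"
proof -
  have "(g * S * g\<^sup>T) $$ (i, j) = (\<Sum>b<m. (\<Sum>a<m. g $$ (i, a) * S $$ (a, b)) * g $$ (j, b))"
    using assms by (subst index_mult_mat_sum[of _ m m _ m]) (auto simp: index_mult_mat_sum[of _ m m _ m] simp del: index_mult_mat(1))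
  also have "\<dots> = (\<Sum>b<m. \<Sum>a<m. g $$ (i, a) * S $$ (a, b) * g $$ (j, b))"
    by (simp add: sum_distrib_right)
  finally show ?thesis by (subst sum.swap)
qed

lemma congruence_mult:
  fixes g h S :: "'a::field mat"
  assumes "g \<in> carrier_mat m m" "h \<in> carrier_mat m m" "S \<in> carrier_mat m m"
  shows "(g * h) * S * (g * h)\<^sup>T = g * (h * S * h\<^sup>T) * g\<^sup>T"
proof -
  have "(g * h) * S * (g * h)\<^sup>T = (g * h) * S * (h\<^sup>T * g\<^sup>T)"
    by (simp only: transpose_mult[OF assms(1,2)])
  also have "\<dots> = g * (h * S * h\<^sup>T) * g\<^sup>T"
    using assms by (simp add: assoc_mult_mat[of _ m m _ m _ m])
  finally show ?thesis .
qed

lemma congruence_eps_symmetric: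
  assumes "g \<in> carrier_mat m m" "S \<in> eps_symmetric \<epsilon> m"
  shows "g * S * g\<^sup>T \<in> eps_symmetric \<epsilon> m"
proof -
  have S: "S \<in> carrier_mat m m" using assms(2) by (rule eps_symmetric_carrier)
  have "(g * S * g\<^sup>T) $$ (b, a) = \<epsilon> * (g * S * g\<^sup>T) $$ (a, b)" if "a < m" "b < m" for a b
  proof -
    have "(g * S * g\<^sup>T) $$ (b, a) = (\<Sum>c<m. \<Sum>d<m. g $$ (b, d) * S $$ (d, c) * g $$ (a, c))"
      using that assms(1) S by (subst sum.swap) (rule congruence_index)
    also have "\<dots> = (\<Sum>c<m. \<Sum>d<m. \<epsilon> * (g $$ (a, c) * S $$ (c, d) * g $$ (b, d)))"
    proof (intro sum.cong refl)
      fix c d assume "c \<in> {..<m}" "d \<in> {..<m}"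
      then have eq: "S $$ (d, c) = \<epsilon> * S $$ (c, d)" by (intro eps_symmetricD[OF assms(2)]) auto
      show "g $$ (b, d) * S $$ (d, c) * g $$ (a, c) = \<epsilon> * (g $$ (a, c) * S $$ (c, d) * g $$ (b, d))"
        by (subst eq) (simp only: mult_ac)
    qed
    also have "\<dots> = \<epsilon> * (g * S * g\<^sup>T) $$ (a, b)"
      using that assms(1) S by (simp only: congruence_index sum_distrib_left)
    finally show ?thesis .
  qed
  moreover have "g * S * g\<^sup>T \<in> carrier_mat m m" using assms(1) S by simp
  ultimately show ?thesis by (intro eps_symmetricI)
qed

text \<open>A simultaneous row and column operation: \<open>c k\<close> times row \<open>t\<close>
  is subtracted from row \<open>k\<close>, and the same is done with columns. That \<open>c\<close>
  vanishes from \<open>t\<close> on keeps \<open>g\<close> upper unitriangular.\<close>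

lemma pivot_congruence:
  fixes S :: "'a::field mat"
  assumes S: "S \<in> carrier_mat m m" and t: "t < m" and c: "\<And>k. t \<le> k \<Longrightarrow> c k = 0"
  obtains g where "g \<in> unitri m"
    "\<And>k l. k < m \<Longrightarrow> l < m \<Longrightarrow> (g * S * g\<^sup>T) $$ (k, l) =
       S $$ (k, l) - c k * S $$ (t, l) - c l * S $$ (k, t) + c k * c l * S $$ (t, t)"
proof
  define g where "g = mat m m (\<lambda>(i, j). (if j = i then 1 else 0) - (if j = t then c i else 0))"
  have gc: "g \<in> carrier_mat m m" by (simp add: g_def)
  show "g \<in> unitri m" using c t by (auto simp: unitri_iff g_def)
  have row: "(\<Sum>a<m. g $$ (k, a) * F a) = F k - c k * F t" if "k < m" for k and F :: "nat \<Rightarrow> 'a"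
  proof -
    have "(\<Sum>a<m. g $$ (k, a) * F a) =
        (\<Sum>a<m. (if a = k then F a else 0) - (if a = t then c k * F a else 0))"
      using that by (intro sum.cong) (auto simp: g_def algebra_simps)
    then show ?thesis using that t by (simp add: sum_subtractf)
  qed
  fix k l assume kl: "k < m" "l < m"
  have "(g * S * g\<^sup>T) $$ (k, l) = (\<Sum>a<m. g $$ (k, a) * (\<Sum>b<m. g $$ (l, b) * S $$ (a, b)))"
    using kl by (simp only: congruence_index[OF gc S] sum_distrib_left) (simp add: mult_ac)
  also have "\<dots> = S $$ (k, l) - c k * S $$ (t, l) - c l * S $$ (k, t) + c k * c l * S $$ (t, t)"
    by (simp only: row[OF kl(1)] row[OF kl(2)]) (simp add: algebra_simps)
  finally show "(g * S * g\<^sup>T) $$ (k, l) =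
      S $$ (k, l) - c k * S $$ (t, l) - c l * S $$ (k, t) + c k * c l * S $$ (t, t)" .
qed

text \<open>Symmetric Gaussian elimination: \<open>X\<close> is the set of rows that are already monomial, and the
  pivot row is the largest row outside \<open>X\<close>, so that only upper unitriangular operations occur.\<close>

lemma congruent_to_monomial_aux:
  fixes S :: "'a::field mat"
  assumes two: "(2 :: 'a) \<noteq> 0" and eps: "\<epsilon> = 1 \<or> \<epsilon> = -1"
    and S: "S \<in> eps_symmetric \<epsilon> m" and X: "X \<subseteq> {..<m}"
    and done1: "\<And>a c. a \<in> X \<Longrightarrow> c < m \<Longrightarrow> S $$ (a, c) \<noteq> 0 \<Longrightarrow> c \<in> X"
    and done2: "\<And>a b c. a \<in> X \<Longrightarrow> b < m \<Longrightarrow> c < m \<Longrightarrow> S $$ (a, b) \<noteq> 0 \<Longrightarrow> S $$ (a, c) \<noteq> 0 \<Longrightarrow> b = c"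
  shows "\<exists>g\<in>unitri m. monomial_rows m (g * S * g\<^sup>T)"
  using S X done1 done2
proof (induction "m - card X" arbitrary: S X rule: less_induct)
  case (less X S)
  note S = less.prems(1) and X = less.prems(2) and done1 = less.prems(3) and done2 = less.prems(4)
  have Sc: "S \<in> carrier_mat m m" using S by (rule eps_symmetric_carrier)
  have sym: "S $$ (b, a) = \<epsilon> * S $$ (a, b)" if "a < m" "b < m" for a b
    by (rule eps_symmetricD[OF S that])
  have eps2: "\<epsilon> * \<epsilon> = 1" "\<epsilon> \<noteq> 0" using eps by auto
  show ?case
  proof (cases "X = {..<m}")
    case True
    then have "monomial_rows m S" using done2 by (auto simp: monomial_rows_def)
    then show ?thesis using Sc by (intro bexI[of _ "1\<^sub>m m"]) auto
  next
    case False
    define t where "t = Max ({..<m} - X)"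
    have "t \<in> {..<m} - X" unfolding t_def using False X by (intro Max_in) auto
    then have t: "t < m" "t \<notin> X" by auto
    have above: "k \<in> X" if "k < m" "t < k" for k
    proof (rule ccontr)
      assume "k \<notin> X"
      then have "k \<le> t" unfolding t_def using that by (intro Max_ge) auto
      with that show False by simp
    qed
    have finX: "finite X" using X finite_subset by blast
    have zX: "S $$ (k, c) = 0" "S $$ (c, k) = 0" if "k \<in> X" "c < m" "c \<notin> X" for k c
    proof -
      show "S $$ (k, c) = 0" using done1 that by blast
      then show "S $$ (c, k) = 0" using sym[of k c] that X by auto
    qed
    have card_less: "m - card Y < m - card X" if "Y \<subseteq> {..<m}" "X \<subset> Y" for Y
    proof -
      have "card X < card Y" using that by (meson finite_lessThan finite_subset psubset_card_mono)
      moreover have "card Y \<le> m" using that card_mono[of "{..<m}" Y] by simp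
      ultimately show ?thesis by linarith
    qed
    \<comment> \<open>It suffices to enlarge the set of finished rows once; the remaining
      elimination \<open>h\<close> and the present one compose to the congruence by
      \<open>h * g\<close>.\<close>
    have step: ?thesis
      if g: "g \<in> unitri m" and Y: "Y \<subseteq> {..<m}" "X \<subset> Y"
        and d1: "\<And>a c. a \<in> Y \<Longrightarrow> c < m \<Longrightarrow> (g * S * g\<^sup>T) $$ (a, c) \<noteq> 0 \<Longrightarrow> c \<in> Y"
        and d2: "\<And>a b c. a \<in> Y \<Longrightarrow> b < m \<Longrightarrow> c < m \<Longrightarrow> (g * S * g\<^sup>T) $$ (a, b) \<noteq> 0 \<Longrightarrow>
          (g * S * g\<^sup>T) $$ (a, c) \<noteq> 0 \<Longrightarrow> b = c" for g Y
    proof -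
      have "\<exists>h\<in>unitri m. monomial_rows m (h * (g * S * g\<^sup>T) * h\<^sup>T)"
        using less.hyps[OF card_less[OF Y] congruence_eps_symmetric[OF unitri_carrier[OF g] S] Y(1)]
          d1 d2 by blast
      then obtain h where h: "h \<in> unitri m" "monomial_rows m (h * (g * S * g\<^sup>T) * h\<^sup>T)" by blast
      then show ?thesis
        using g by (intro bexI[of _ "h * g"])
          (auto simp: congruence_mult[OF unitri_carrier[OF h(1)] unitri_carrier[OF g] Sc] mult_unitri)
    qed
    \<comment> \<open>The pivot row is zero, or has a nonzero diagonal entry (possible only in the
      symmetric case), or has an off-diagonal pivot; in the last case rows \<open>t\<close> and
      \<open>j\<close> are finished together.\<close>
    consider "\<And>c. c < m \<Longrightarrow> S $$ (t, c) = 0" | "S $$ (t, t) \<noteq> 0"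
      | "S $$ (t, t) = 0" "\<exists>c<m. S $$ (t, c) \<noteq> 0" by blast
    then show ?thesis
    proof cases
      case 1
      show ?thesis
      proof (rule step[of "1\<^sub>m m" "insert t X"])
        show "c \<in> insert t X" if "a \<in> insert t X" "c < m" "(1\<^sub>m m * S * (1\<^sub>m m)\<^sup>T) $$ (a, c) \<noteq> 0" for a c
          using that 1 done1 Sc by auto
        show "b = c" if "a \<in> insert t X" "b < m" "c < m" "(1\<^sub>m m * S * (1\<^sub>m m)\<^sup>T) $$ (a, b) \<noteq> 0"
          "(1\<^sub>m m * S * (1\<^sub>m m)\<^sup>T) $$ (a, c) \<noteq> 0" for a b c
          using that 1 done2[of a b c] Sc by auto
      qed (use t X in auto)
    next
      case 2
      have eps1: "\<epsilon> = 1"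
      proof (rule ccontr)
        assume "\<epsilon> \<noteq> 1"
        then have "S $$ (t, t) = - S $$ (t, t)" using sym[of t t] t eps by auto
        then have "2 * S $$ (t, t) = 0" by (metis add_eq_0_iff mult_2)
        then show False using two 2 by simp
      qed
      \<comment> \<open>Clears column \<open>t\<close> above the pivot. Rows below \<open>t\<close>
        already belong to \<open>X\<close>, so their entries in column \<open>t\<close> are
        zero.\<close>
      define c where "c k = (if k < t then S $$ (k, t) / S $$ (t, t) else 0)" for k
      obtain g where g: "g \<in> unitri m"
        "\<And>k l. k < m \<Longrightarrow> l < m \<Longrightarrow> (g * S * g\<^sup>T) $$ (k, l) =
           S $$ (k, l) - c k * S $$ (t, l) - c l * S $$ (k, t) + c k * c l * S $$ (t, t)"
        using pivot_congruence[OF Sc t(1), of c] by (auto simp: c_def)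
      let ?S = "g * S * g\<^sup>T"
      have rowt: "?S $$ (t, l) = (if l = t then S $$ (t, t) else 0)" if "l < m" for l
        using that t g(2)[of t l] 2 sym[of t l] eps1 zX(2)[of l t] above[of l]
        by (cases l t rule: linorder_cases) (auto simp: c_def)
      have rowX: "?S $$ (k, l) = S $$ (k, l)" if "k \<in> X" "l < m" for k l
      proof -
        have "k < m" using that X by auto
        moreover have "S $$ (k, t) = 0" using zX that t by auto
        moreover from this have "c k = 0" by (simp add: c_def)
        ultimately show ?thesis using that g(2)[of k l] by simp
      qed
      show ?thesis
      proof (rule step[OF g(1), of "insert t X"])
        show "c \<in> insert t X" if "a \<in> insert t X" "c < m" "?S $$ (a, c) \<noteq> 0" for a c
          using that done1 by (cases "a = t") (auto simp: rowt rowX split: if_splits)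
        show "b = c" if "a \<in> insert t X" "b < m" "c < m" "?S $$ (a, b) \<noteq> 0" "?S $$ (a, c) \<noteq> 0" for a b c
          using that done2[of a b c] by (cases "a = t") (auto simp: rowt rowX split: if_splits)
      qed (use t X in auto)
    next
      case 3
      \<comment> \<open>With the last nonzero column as pivot, the entries of column
        \<open>t\<close> below row \<open>j\<close> vanish, so only rows above \<open>j\<close> have
        to be cleared and the operation stays upper unitriangular.\<close>
      define j where "j = Max {c. c < m \<and> S $$ (t, c) \<noteq> 0}"
      have fin: "finite {c. c < m \<and> S $$ (t, c) \<noteq> 0}" by simp
      have "j \<in> {c. c < m \<and> S $$ (t, c) \<noteq> 0}"
        unfolding j_def by (rule Max_in[OF fin]) (use 3 in auto)
      then have j: "j < m" "S $$ (t, j) \<noteq> 0" by auto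
      have jX: "j \<notin> X" using zX(2)[of j t] j t by blast
      have jt: "j < t" using above[of j] jX j 3 by (metis linorder_neqE_nat)
      have jmax: "S $$ (t, k) = 0" "S $$ (k, t) = 0" if "j < k" "k < m" for k
      proof -
        show "S $$ (t, k) = 0"
        proof (rule ccontr)
          assume "S $$ (t, k) \<noteq> 0"
          then have "k \<le> j" unfolding j_def using that fin by (intro Max_ge) auto
          with that show False by simp
        qed
        then show "S $$ (k, t) = 0" using sym[of t k] that t by simp
      qed
      have jt0: "S $$ (j, t) \<noteq> 0" using sym[of t j] j t eps2 by simp
      define d where "d k = (if k < j then S $$ (k, t) / S $$ (j, t) else 0)" for k
      obtain g where g: "g \<in> unitri m"
        "\<And>k l. k < m \<Longrightarrow> l < m \<Longrightarrow> (g * S * g\<^sup>T) $$ (k, l) =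
           S $$ (k, l) - d k * S $$ (j, l) - d l * S $$ (k, j) + d k * d l * S $$ (j, j)"
        using pivot_congruence[OF Sc j(1), of d] by (auto simp: d_def)
      define T where "T = g * S * g\<^sup>T"
      have T: "T \<in> eps_symmetric \<epsilon> m" "T \<in> carrier_mat m m"
        using congruence_eps_symmetric[OF unitri_carrier[OF g(1)] S] by (auto simp: T_def dest: eps_symmetric_carrier)
      have Tsym: "T $$ (b, a) = \<epsilon> * T $$ (a, b)" if "a < m" "b < m" for a b
        by (rule eps_symmetricD[OF T(1) that])
      have Tcol: "T $$ (k, t) = (if k = j then S $$ (j, t) else 0)" if "k < m" for k
        using that t jt jt0 g(2)[of k t] jmax(2)[of k] 3(1)
        by (cases k j rule: linorder_cases) (auto simp: d_def T_def)
      have Trow: "T $$ (t, k) = (if k = j then S $$ (t, j) else 0)" if "k < m" for k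
        using Tsym[of k t] Tcol[of k] sym[of j t] that t j by simp
      have TX: "T $$ (k, l) = S $$ (k, l)" if "k \<in> X" "l < m" for k l
      proof -
        have "k < m" using that X by auto
        moreover have "S $$ (k, t) = 0" "S $$ (k, j) = 0" using zX that t j jX by auto
        moreover from this have "d k = 0" by (simp add: d_def)
        ultimately show ?thesis using that g(2)[of k l] by (simp add: T_def)
      qed
      \<comment> \<open>Row \<open>t\<close> now has its only nonzero entry in column
        \<open>j\<close> and is used to clear row and column \<open>j\<close>. The entry at
        \<open>(j, j)\<close> is hit once through its row and once through its column, hence the
        factor 2; in the antisymmetric case it is zero anyway.\<close>
      define c where "c k = (if k = j then T $$ (j, j) / (2 * S $$ (j, t))
        else if k < t then T $$ (k, j) / S $$ (t, j) else 0)" for k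
      obtain h where h: "h \<in> unitri m"
        "\<And>k l. k < m \<Longrightarrow> l < m \<Longrightarrow> (h * T * h\<^sup>T) $$ (k, l) =
           T $$ (k, l) - c k * T $$ (t, l) - c l * T $$ (k, t) + c k * c l * T $$ (t, t)"
        using pivot_congruence[OF T(2) t(1), of c] jt by (auto simp: c_def)
      let ?S = "h * T * h\<^sup>T"
      have hk: "?S $$ (k, l) = T $$ (k, l) - c k * T $$ (t, l) - c l * T $$ (k, t)"
        if "k < m" "l < m" for k l
        using h(2)[OF that] Trow[OF t(1)] jt by simp
      have rowt: "?S $$ (t, l) = (if l = j then S $$ (t, j) else 0)" if "l < m" for l
        using hk[OF t(1) that] Trow[OF that] Tcol[OF t(1)] jt by (simp add: c_def)
      have rowj: "?S $$ (j, l) = (if l = t then S $$ (j, t) else 0)" if l: "l < m" for l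
      proof -
        have eq: "?S $$ (j, l) = T $$ (j, l) - c j * (if l = j then S $$ (t, j) else 0) - c l * S $$ (j, t)"
          using hk[OF j(1) l] Trow[OF l] Tcol[OF j(1)] by simp
        consider "l = j" | "l = t" | "l < t" "l \<noteq> j" | "t < l" by linarith
        then show ?thesis
        proof cases
          case 1
          have "T $$ (j, j) - c j * S $$ (t, j) - c j * S $$ (j, t) = 0"
          proof (cases "\<epsilon> = 1")
            case True
            then have "S $$ (t, j) = S $$ (j, t)" using sym[of j t] t j by simp
            then show ?thesis using jt0 two by (simp add: c_def field_simps)
          next
            case False
            then have e: "\<epsilon> = -1" using eps by auto
            then have "T $$ (j, j) = - T $$ (j, j)" using Tsym[of j j] j by simp
            then have "2 * T $$ (j, j) = 0" by (metis add_eq_0_iff mult_2)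
            then have "T $$ (j, j) = 0" using two by simp
            then show ?thesis by (simp add: c_def)
          qed
          then show ?thesis using eq 1 jt by simp
        next
          case 2
          then show ?thesis using eq Tcol[OF j(1)] jt by (simp add: c_def)
        next
          case 3
          have "T $$ (l, j) / S $$ (t, j) * S $$ (j, t) = T $$ (j, l)"
            using sym[of j t] Tsym[of l j] t j l jt0 eps by (auto simp: field_simps)
          then show ?thesis using eq 3 by (simp add: c_def)
        next
          case 4
          then have "l \<in> X" using above l by auto
          then have "T $$ (l, j) = 0" using TX zX(1) j jX by simp
          then have "T $$ (j, l) = 0" using Tsym[of l j] l j by simp
          then show ?thesis using eq 4 jt by (simp add: c_def)
        qed
      qed
      have rowX: "?S $$ (k, l) = S $$ (k, l)" if "k \<in> X" "l < m" for k l
      proof -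
        have "k < m" using that X by auto
        moreover have "T $$ (k, t) = 0" "T $$ (k, j) = 0" using zX TX that t j jX by auto
        moreover from this have "c k = 0" using jX that by (auto simp: c_def)
        ultimately show ?thesis using that hk[of k l] TX by simp
      qed
      have comp: "(h * g) * S * (h * g)\<^sup>T = ?S"
        unfolding T_def by (rule congruence_mult) (use g h Sc in \<open>auto simp: unitri_carrier\<close>)
      show ?thesis
      proof (rule step[OF mult_unitri[OF h(1) g(1)], of "insert j (insert t X)", unfolded comp])
        show "c \<in> insert j (insert t X)" if "a \<in> insert j (insert t X)" "c < m" "?S $$ (a, c) \<noteq> 0" for a c
          using that done1 by (cases "a = j"; cases "a = t") (auto simp: rowt rowj rowX split: if_splits)
        show "b = c" if "a \<in> insert j (insert t X)" "b < m" "c < m" "?S $$ (a, b) \<noteq> 0" "?S $$ (a, c) \<noteq> 0" for a b c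
          using that done2[of a b c]
          by (cases "a = j"; cases "a = t") (auto simp: rowt rowj rowX split: if_splits)
      qed (use t X j in auto)
    qed
  qed
qed

lemma congruent_to_monomial:
  fixes S :: "'a::field mat"
  assumes "(2 :: 'a) \<noteq> 0" "\<epsilon> = 1 \<or> \<epsilon> = -1" "S \<in> eps_symmetric \<epsilon> m"
  obtains g where "g \<in> unitri m" "monomial_rows m (g * S * g\<^sup>T)"
proof -
  have "\<exists>g\<in>unitri m. monomial_rows m (g * S * g\<^sup>T)"
    by (rule congruent_to_monomial_aux[OF assms, of "{}"]) simp_all
  then show ?thesis using that by blast
qed

subsection \<open>Staircase matrices and averaged characters\<close>

text \<open>With 0-based indices the antidiagonal is \<open>a + b + 1 = m\<close>. The condition is
  what strict upper triangularity becomes when multiplication by \<Omega> reverses the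
  columns.\<close>

definition staircase :: "'a::field \<Rightarrow> nat \<Rightarrow> 'a mat set" where
  "staircase \<epsilon> m = {S \<in> eps_symmetric \<epsilon> m. \<forall>a<m. \<forall>b<m. m \<le> Suc (a + b) \<longrightarrow> S $$ (a, b) = 0}"

definition monomials :: "'a::field \<Rightarrow> nat \<Rightarrow> 'a mat set" where
  "monomials \<epsilon> m = {S \<in> staircase \<epsilon> m. monomial_rows m S}"

definition congruence_orbit :: "nat \<Rightarrow> 'a::field mat \<Rightarrow> 'a mat set" where
  "congruence_orbit m S = (\<lambda>g. g * S * g\<^sup>T) ` unitri m"

text \<open>Each root occupies two mirror entries of an \<epsilon>-symmetric matrix. Summing over
  \<open>a \<le> b\<close> counts it once, just as an elementary character reads off the positive
  entry only.\<close>

definition upper_pairing :: "nat \<Rightarrow> 'a::field mat \<Rightarrow> 'a mat \<Rightarrow> 'a" where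
  "upper_pairing m M S = (\<Sum>a<m. \<Sum>b<m. if a \<le> b then M $$ (a, b) * S $$ (a, b) else 0)"

definition orbit_sum :: "('a::{field,finite} \<Rightarrow> complex) \<Rightarrow> nat \<Rightarrow> 'a mat \<Rightarrow> 'a mat \<Rightarrow> complex" where
  "orbit_sum \<theta> m M S = (\<Sum>g\<in>unitri m. \<theta> (upper_pairing m M (g * S * g\<^sup>T)))"

lemma staircase_eps: "S \<in> staircase \<epsilon> m \<Longrightarrow> S \<in> eps_symmetric \<epsilon> m"
  by (simp add: staircase_def)

lemma staircase_carrier: "S \<in> staircase \<epsilon> m \<Longrightarrow> S \<in> carrier_mat m m"
  by (rule eps_symmetric_carrier[OF staircase_eps])

lemma staircase_zero:
  "S \<in> staircase \<epsilon> m \<Longrightarrow> a < m \<Longrightarrow> b < m \<Longrightarrow> m \<le> Suc (a + b) \<Longrightarrow> S $$ (a, b) = 0"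
  by (simp add: staircase_def)

lemma staircaseI:
  assumes "S \<in> carrier_mat m m"
    "\<And>a b. a < m \<Longrightarrow> b < m \<Longrightarrow> S $$ (b, a) = \<epsilon> * S $$ (a, b)"
    "\<And>a b. a < m \<Longrightarrow> b < m \<Longrightarrow> m \<le> Suc (a + b) \<Longrightarrow> S $$ (a, b) = 0"
  shows "S \<in> staircase \<epsilon> m"
  using eps_symmetricI[OF assms(1,2)] assms(3) unfolding staircase_def by blast

lemma finite_staircase [simp]: "finite (staircase \<epsilon> m :: 'a::{field,finite} mat set)"
  by (rule finite_subset[OF _ finite_carrier_mat[of m m]]) (auto dest: staircase_carrier)

lemma finite_monomials [simp]: "finite (monomials \<epsilon> m :: 'a::{field,finite} mat set)"
  by (rule finite_subset[OF _ finite_staircase[of \<epsilon> m]]) (auto simp: monomials_def)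

text \<open>Entry \<open>(a, b)\<close> of \<open>S\<close> contributes only to entries
  \<open>(i, j)\<close> with \<open>i \<le> a\<close> and \<open>j \<le> b\<close>, which lie
  further above the antidiagonal.\<close>

lemma staircase_congruence:
  assumes g: "g \<in> unitri m" and S: "S \<in> staircase \<epsilon> m"
  shows "g * S * g\<^sup>T \<in> staircase \<epsilon> m"
proof -
  note gc = unitri_carrier[OF g] and Sc = staircase_carrier[OF S]
  have "(g * S * g\<^sup>T) $$ (i, j) = 0" if "i < m" "j < m" "m \<le> Suc (i + j)" for i j
  proof -
    have "g $$ (i, a) * S $$ (a, b) * g $$ (j, b) = 0" if "a < m" "b < m" for a b
    proof -
      consider "a < i" | "b < j" | "m \<le> Suc (a + b)" using \<open>m \<le> Suc (i + j)\<close> by linarith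
      then show ?thesis
        by cases (use g S that \<open>i < m\<close> \<open>j < m\<close> in \<open>simp_all add: unitri_lower staircase_zero\<close>)
    qed
    then show ?thesis by (simp add: congruence_index[OF gc Sc that(1,2)] sum.neutral del: mult_eq_0_iff)
  qed
  then show ?thesis
    using congruence_eps_symmetric[OF gc staircase_eps[OF S]] unfolding staircase_def by blast
qed

lemma staircase_add:
  assumes "S \<in> staircase \<epsilon> m" "T \<in> staircase \<epsilon> m"
  shows "S + T \<in> staircase \<epsilon> m"
proof (rule staircaseI)
  note c = staircase_carrier[OF assms(1)] staircase_carrier[OF assms(2)]
  show "S + T \<in> carrier_mat m m" using c by simp
  fix a b assume ab: "a < m" "b < m"
  show "(S + T) $$ (b, a) = \<epsilon> * (S + T) $$ (a, b)"
    using ab c eps_symmetricD[OF staircase_eps[OF assms(1)] ab] eps_symmetricD[OF staircase_eps[OF assms(2)] ab]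
    by (simp add: distrib_left)
  show "(S + T) $$ (a, b) = 0" if "m \<le> Suc (a + b)"
    using ab c that staircase_zero[OF assms(1)] staircase_zero[OF assms(2)] by simp
qed

lemma staircase_smult:
  assumes "S \<in> staircase \<epsilon> m"
  shows "c \<cdot>\<^sub>m S \<in> staircase \<epsilon> m"
proof (rule staircaseI)
  note Sc = staircase_carrier[OF assms]
  show "c \<cdot>\<^sub>m S \<in> carrier_mat m m" using Sc by simp
  fix a b assume ab: "a < m" "b < m"
  show "(c \<cdot>\<^sub>m S) $$ (b, a) = \<epsilon> * (c \<cdot>\<^sub>m S) $$ (a, b)"
    using ab Sc eps_symmetricD[OF staircase_eps[OF assms] ab] by simp
  show "(c \<cdot>\<^sub>m S) $$ (a, b) = 0" if "m \<le> Suc (a + b)"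
    using ab Sc that staircase_zero[OF assms] by simp
qed

lemma zero_staircase [simp]: "0\<^sub>m m m \<in> staircase \<epsilon> m"
  by (rule staircaseI) auto

lemma sum_unitri_right_mult:
  fixes h :: "'a::{field,finite} mat"
  assumes "h \<in> unitri m"
  shows "(\<Sum>g\<in>unitri m. f (g * h)) = (\<Sum>g\<in>unitri m. f g)"
proof (rule sum.reindex_bij_witness[of _ "\<lambda>g. g * uinv m h" "\<lambda>g. g * h"])
  fix g :: "'a mat" assume g: "g \<in> unitri m"
  note c = unitri_carrier[OF g] unitri_carrier[OF assms] unitri_carrier[OF uinv(1)[OF assms]]
  show "g * h * uinv m h = g" "g * uinv m h * h = g"
    using c uinv[OF assms] by (simp_all add: assoc_mult_mat[of _ m m _ m _ m])
  show "g * h \<in> unitri m" "g * uinv m h \<in> unitri m"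
    using g assms uinv by (auto intro: mult_unitri)
qed simp

lemma orbit_sum_congruence:
  assumes h: "h \<in> unitri m" and S: "S \<in> carrier_mat m m"
  shows "orbit_sum \<theta> m M (h * S * h\<^sup>T) = orbit_sum \<theta> m M S"
proof -
  have "orbit_sum \<theta> m M (h * S * h\<^sup>T) =
      (\<Sum>g\<in>unitri m. \<theta> (upper_pairing m M ((g * h) * S * (g * h)\<^sup>T)))"
    unfolding orbit_sum_def
    by (intro sum.cong refl) (simp add: congruence_mult[OF unitri_carrier unitri_carrier[OF h] S])
  also have "\<dots> = orbit_sum \<theta> m M S"
    unfolding orbit_sum_def by (rule sum_unitri_right_mult[OF h])
  finally show ?thesis .
qed

lemma congruence_add:
  fixes g :: "'a::field mat"
  assumes "g \<in> carrier_mat m m" "S \<in> carrier_mat m m" "T \<in> carrier_mat m m"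
  shows "g * (S + T) * g\<^sup>T = g * S * g\<^sup>T + g * T * g\<^sup>T"
  using assms by (simp add: mult_add_distrib_mat[of _ m m _ m] add_mult_distrib_mat[of _ m m _ _ m])

lemma congruence_smult:
  fixes g :: "'a::field mat"
  assumes "g \<in> carrier_mat m m" "S \<in> carrier_mat m m"
  shows "g * (c \<cdot>\<^sub>m S) * g\<^sup>T = c \<cdot>\<^sub>m (g * S * g\<^sup>T)"
  using assms by (simp add: mult_smult_distrib[of _ m m _ m] mult_smult_assoc_mat[of _ m m _ m])

lemma upper_pairing_add:
  assumes "S \<in> carrier_mat m m" "T \<in> carrier_mat m m"
  shows "upper_pairing m M (S + T) = upper_pairing m M S + upper_pairing m M T"
  unfolding upper_pairing_def sum.distrib[symmetric]
  using assms by (intro sum.cong refl) (auto simp: distrib_left)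

lemma upper_pairing_smult:
  assumes "S \<in> carrier_mat m m"
  shows "upper_pairing m M (c \<cdot>\<^sub>m S) = c * upper_pairing m M S"
  unfolding upper_pairing_def sum_distrib_left
  using assms by (intro sum.cong refl) auto

lemma upper_pairing_zero: "upper_pairing m M (0\<^sub>m m m) = 0"
  unfolding upper_pairing_def by (intro sum.neutral ballI) auto

subsection \<open>Uniqueness of monomial representatives\<close>

lemma monomial_cols:
  assumes S: "S \<in> eps_symmetric \<epsilon> m" and "\<epsilon> \<noteq> 0" and mono: "monomial_rows m S"
    and "a < m" "b < m" "c < m" "S $$ (b, a) \<noteq> 0" "S $$ (c, a) \<noteq> 0"
  shows "b = c"
proof -
  have "S $$ (a, b) \<noteq> 0" "S $$ (a, c) \<noteq> 0"
    using assms eps_symmetricD[OF S, of b a] eps_symmetricD[OF S, of c a] by simp_all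
  then show ?thesis using mono assms unfolding monomial_rows_def by blast
qed

text \<open>The two factors are independent because superclasses are two-sided orbits, while orbits
  of staircase matrices are congruence orbits. Moving \<open>C\<close> to the other side turns the
  equation into the form required by \<open>monomial_uniqueness\<close>.\<close>

lemma monomial_two_sided_unique:
  fixes M M' :: "'a::{field,finite} mat"
  assumes A: "A \<in> unitri m" and C: "C \<in> unitri m" and eps: "\<epsilon> \<noteq> 0"
    and M: "M \<in> eps_symmetric \<epsilon> m" "monomial_rows m M"
    and M': "M' \<in> eps_symmetric \<epsilon> m" "monomial_rows m M'"
    and eq: "A * M * C\<^sup>T = M'"
  shows "M = M'"
proof -
  note c = unitri_carrier[OF A] unitri_carrier[OF C] unitri_carrier[OF uinv(1)[OF C]]
    eps_symmetric_carrier[OF M(1)] eps_symmetric_carrier[OF M'(1)]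
  let ?C = "uinv m C"
  have "C\<^sup>T * ?C\<^sup>T = (?C * C)\<^sup>T" using c by (simp add: transpose_mult[of _ m m _ m])
  then have CC: "C\<^sup>T * ?C\<^sup>T = 1\<^sub>m m" using uinv(3)[OF C] by simp
  have "M' * ?C\<^sup>T = A * M * (C\<^sup>T * ?C\<^sup>T)"
    using c unfolding eq[symmetric] by (simp add: assoc_mult_mat[of _ m m _ m _ m])
  then have eq': "A * M = M' * ?C\<^sup>T" using c by (simp add: CC)
  define F where "F N = (\<lambda>i j. if i < m \<and> j < m then N $$ (i, j) else 0)" for N :: "'a mat"
  have "F M = F M'"
  \<comment> \<open>Here both operations bring in rows or columns of larger index, so the weights
    must decrease with the index.\<close>
  proof (rule monomial_uniqueness[where I = "{..<m}" and J = "{..<m}" and R = UNIV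
        and \<rho> = "\<lambda>k. m - k" and \<kappa> = "\<lambda>k. m - k"
        and G = "\<lambda>i k. A $$ (i, k)" and H = "\<lambda>k j. ?C $$ (j, k)"])
    show "j = k" if "F M i j \<noteq> 0" "F M i k \<noteq> 0" for i j k
      using that M(2) by (auto simp: F_def monomial_rows_def split: if_splits)
    show "j = k" if "F M' i j \<noteq> 0" "F M' i k \<noteq> 0" for i j k
      using that M'(2) by (auto simp: F_def monomial_rows_def split: if_splits)
    show "i = j" if "F M i k \<noteq> 0" "F M j k \<noteq> 0" for i j k
      using that monomial_cols[OF M(1) eps M(2)] by (auto simp: F_def split: if_splits)
    show "i = j" if "F M' i k \<noteq> 0" "F M' j k \<noteq> 0" for i j k
      using that monomial_cols[OF M'(1) eps M'(2)] by (auto simp: F_def split: if_splits)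
    show "A $$ (i, i) = 1" "?C $$ (i, i) = 1" if "i \<in> {..<m}" for i
      using that A uinv(1)[OF C] by (auto simp: unitri_diag)
    show "m - k < m - i" if "i \<in> {..<m}" "k \<in> {..<m}" "A $$ (i, k) \<noteq> 0" "k \<noteq> i" for i k
      using that unitri_lower[OF A, of k i] by (cases i k rule: linorder_cases) auto
    show "m - k < m - j" if "k \<in> {..<m}" "j \<in> {..<m}" "?C $$ (j, k) \<noteq> 0" "k \<noteq> j" for k j
      using that unitri_lower[OF uinv(1)[OF C], of k j] by (cases j k rule: linorder_cases) auto
    show "(\<Sum>k<m. A $$ (i, k) * F M k j) = (\<Sum>k<m. F M' i k * ?C $$ (j, k))"
      if "i \<in> {..<m}" "j \<in> {..<m}" for i j
    proof -
      have "(\<Sum>k<m. A $$ (i, k) * F M k j) = (A * M) $$ (i, j)"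
        using that by (simp add: index_mult_mat_sum[OF c(1,4)] F_def)
      also have "\<dots> = (\<Sum>k<m. F M' i k * ?C $$ (j, k))"
        unfolding eq' using that c
        by (subst index_mult_mat_sum[OF c(5), of _ m]) (auto simp: F_def intro!: sum.cong)
      finally show ?thesis .
    qed
  qed (auto simp: F_def split: if_splits)
  then show ?thesis
    using c by (intro eq_matI) (auto simp: F_def fun_eq_iff split: if_splits)
qed

text \<open>Doubling replaces the half sum by a sum over all entries: mirror entries contribute
  equally because the two signs multiply to 1, and diagonal entries keep the factor 2.\<close>

lemma two_upper_pairing:
  fixes M :: "'a::field mat"
  assumes M: "M \<in> eps_symmetric \<epsilon> m" and S: "S \<in> eps_symmetric \<epsilon> m" and eps: "\<epsilon> * \<epsilon> = 1"
  shows "2 * upper_pairing m M S =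
    (\<Sum>a<m. \<Sum>b<m. (if a = b then 2 else 1) * M $$ (a, b) * S $$ (a, b))"
proof -
  have "upper_pairing m M S = (\<Sum>b<m. \<Sum>a<m. if b \<le> a then M $$ (b, a) * S $$ (b, a) else 0)"
    unfolding upper_pairing_def ..
  also have "\<dots> = (\<Sum>a<m. \<Sum>b<m. if b \<le> a then M $$ (a, b) * S $$ (a, b) else 0)"
  proof (subst sum.swap, intro sum.cong refl)
    fix a b assume ab: "a \<in> {..<m}" "b \<in> {..<m}"
    have "M $$ (b, a) * S $$ (b, a) = (\<epsilon> * \<epsilon>) * (M $$ (a, b) * S $$ (a, b))"
      using ab by (subst eps_symmetricD[OF M, of a b], simp, simp, subst eps_symmetricD[OF S, of a b]) simp_all
    then show "(if b \<le> a then M $$ (b, a) * S $$ (b, a) else 0) = (if b \<le> a then M $$ (a, b) * S $$ (a, b) else 0)"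
      by (simp add: eps)
  qed
  finally have "upper_pairing m M S + upper_pairing m M S =
      (\<Sum>a<m. \<Sum>b<m. (if a \<le> b then M $$ (a, b) * S $$ (a, b) else 0) +
        (if b \<le> a then M $$ (a, b) * S $$ (a, b) else 0))"
    unfolding sum.distrib by (simp add: upper_pairing_def)
  also have "\<dots> = (\<Sum>a<m. \<Sum>b<m. (if a = b then 2 else 1) * M $$ (a, b) * S $$ (a, b))"
    by (intro sum.cong refl) auto
  finally show ?thesis by (simp only: mult_2)
qed

subsection \<open>Orthogonality of the averaged characters\<close>

text \<open>The matrix whose full entrywise pairing with an \<epsilon>-symmetric \<open>S\<close> is
  twice the half pairing of \<open>M\<close> with \<open>S\<close>.\<close>

definition double_diag :: "nat \<Rightarrow> 'a::field mat \<Rightarrow> 'a mat" where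
  "double_diag m M = mat m m (\<lambda>(a, b). (if a = b then 2 else 1) * M $$ (a, b))"

lemma double_diag_carrier [simp]: "double_diag m M \<in> carrier_mat m m"
  by (simp add: double_diag_def)

lemma double_diag_eps_symmetric:
  assumes "M \<in> eps_symmetric \<epsilon> m"
  shows "double_diag m M \<in> eps_symmetric \<epsilon> m"
proof (rule eps_symmetricI)
  fix a b assume "a < m" "b < m"
  then show "double_diag m M $$ (b, a) = \<epsilon> * double_diag m M $$ (a, b)"
    using eps_symmetricD[OF assms, of a b] by (simp add: double_diag_def)
qed simp

text \<open>Moves the group element from the argument to the functional. The adjoint of S to p S p^T
  is M to p^T M p for the sum over all entries, but not for the half sum, which is why both sides
  are doubled.\<close>

lemma upper_pairing_congruence:
  fixes M :: "'a::field mat"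
  assumes M: "M \<in> eps_symmetric \<epsilon> m" and S: "S \<in> eps_symmetric \<epsilon> m" and eps: "\<epsilon> * \<epsilon> = 1"
    and p: "p \<in> carrier_mat m m"
  shows "2 * upper_pairing m M (p * S * p\<^sup>T) =
    (\<Sum>c<m. \<Sum>d<m. (p\<^sup>T * double_diag m M * p) $$ (c, d) * S $$ (c, d))"
proof -
  let ?M = "double_diag m M"
  note Sc = eps_symmetric_carrier[OF S]
  have "2 * upper_pairing m M (p * S * p\<^sup>T) =
      (\<Sum>a<m. \<Sum>b<m. ?M $$ (a, b) * (p * S * p\<^sup>T) $$ (a, b))"
    unfolding two_upper_pairing[OF M congruence_eps_symmetric[OF p S] eps]
    by (intro sum.cong refl) (simp add: double_diag_def)
  also have "\<dots> = (\<Sum>a<m. \<Sum>b<m. \<Sum>c<m. \<Sum>d<m. ?M $$ (a, b) * (p $$ (a, c) * S $$ (c, d) * p $$ (b, d)))"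
    by (intro sum.cong refl) (simp add: congruence_index[OF p Sc] sum_distrib_left)
  also have "\<dots> = (\<Sum>a<m. \<Sum>c<m. \<Sum>b<m. \<Sum>d<m. ?M $$ (a, b) * (p $$ (a, c) * S $$ (c, d) * p $$ (b, d)))"
    by (rule sum.cong[OF refl]) (rule sum.swap)
  also have "\<dots> = (\<Sum>c<m. \<Sum>a<m. \<Sum>b<m. \<Sum>d<m. ?M $$ (a, b) * (p $$ (a, c) * S $$ (c, d) * p $$ (b, d)))"
    by (rule sum.swap)
  also have "\<dots> = (\<Sum>c<m. \<Sum>a<m. \<Sum>d<m. \<Sum>b<m. ?M $$ (a, b) * (p $$ (a, c) * S $$ (c, d) * p $$ (b, d)))"
    by (rule sum.cong[OF refl], rule sum.cong[OF refl], rule sum.swap)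
  also have "\<dots> = (\<Sum>c<m. \<Sum>d<m. \<Sum>a<m. \<Sum>b<m. ?M $$ (a, b) * (p $$ (a, c) * S $$ (c, d) * p $$ (b, d)))"
    by (rule sum.cong[OF refl]) (rule sum.swap)
  also have "\<dots> = (\<Sum>c<m. \<Sum>d<m. (p\<^sup>T * ?M * p) $$ (c, d) * S $$ (c, d))"
  proof (intro sum.cong refl)
    fix c d assume "c \<in> {..<m}" "d \<in> {..<m}"
    then have "(p\<^sup>T * ?M * (p\<^sup>T)\<^sup>T) $$ (c, d) = (\<Sum>a<m. \<Sum>b<m. p $$ (a, c) * ?M $$ (a, b) * p $$ (b, d))"
      using p by (subst congruence_index[of _ m]) (auto intro!: sum.cong)
    then show "(\<Sum>a<m. \<Sum>b<m. ?M $$ (a, b) * (p $$ (a, c) * S $$ (c, d) * p $$ (b, d))) =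
        (p\<^sup>T * ?M * p) $$ (c, d) * S $$ (c, d)"
      by (simp add: sum_distrib_left sum_distrib_right mult_ac)
  qed
  finally show ?thesis .
qed

text \<open>The dual form of uniqueness: a functional on staircase matrices determines its matrix
  only strictly above the antidiagonal, so the equation is available only there.\<close>

lemma monomial_unique_mod_staircase:
  fixes M M' :: "'a::{field,finite} mat"
  assumes two: "(2 :: 'a) \<noteq> 0" and eps: "\<epsilon> \<noteq> 0" and p: "p \<in> unitri m"
    and M: "M \<in> monomials \<epsilon> m" and M': "M' \<in> monomials \<epsilon> m"
    and eq: "\<And>i j. i < m \<Longrightarrow> j < m \<Longrightarrow> Suc (i + j) < m \<Longrightarrow>
      (p\<^sup>T * double_diag m M * p) $$ (i, j) = double_diag m M' $$ (i, j)"
  shows "M = M'"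
proof -
  let ?M = "double_diag m M" and ?M' = "double_diag m M'" and ?q = "uinv m p"
  have Ms: "M \<in> eps_symmetric \<epsilon> m" "monomial_rows m M" "M' \<in> eps_symmetric \<epsilon> m" "monomial_rows m M'"
    using M M' by (auto simp: monomials_def staircase_eps)
  have Mst: "M \<in> staircase \<epsilon> m" "M' \<in> staircase \<epsilon> m" using M M' by (auto simp: monomials_def)
  have Mc: "M \<in> carrier_mat m m" "M' \<in> carrier_mat m m" using Mst staircase_carrier by auto
  note c = unitri_carrier[OF p] unitri_carrier[OF uinv(1)[OF p]]
  define T where "T = p\<^sup>T * ?M * p"
  have Tc: "T \<in> carrier_mat m m"
    unfolding T_def by (rule mult_carrier_mat[of _ m m], rule mult_carrier_mat[of _ m m]) (use c in simp_all)
  have pM: "p\<^sup>T * ?M = T * ?q"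
    using c uinv(2)[OF p] double_diag_carrier[of m M] by (simp add: T_def assoc_mult_mat[of _ m m _ m _ m] del: double_diag_carrier)
  define F where "F N = (\<lambda>i j. if i < m \<and> j < m then double_diag m N $$ (i, j) else 0)" for N :: "'a mat"
  have Fnz: "i < m" "j < m" "N $$ (i, j) \<noteq> 0" if "F N i j \<noteq> 0" for N i j
    using that by (auto simp: F_def double_diag_def split: if_splits)
  have "F M = F M'"
  \<comment> \<open>In contrast to the two-sided case, p^T and the inverse of p bring in smaller
    indices. From a position above the antidiagonal only such positions are reached, so the weights
    increase and \<open>R\<close> can be this region.\<close>
  proof (rule monomial_uniqueness[where I = "{..<m}" and J = "{..<m}"
        and R = "{(i, j). Suc (i + j) < m}" and \<rho> = "\<lambda>k. k" and \<kappa> = "\<lambda>k. k"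
        and G = "\<lambda>i k. p $$ (k, i)" and H = "\<lambda>k j. ?q $$ (k, j)"])
    show "i \<in> {..<m} \<and> j \<in> {..<m} \<and> (i, j) \<in> {(i, j). Suc (i + j) < m}" if "F M i j \<noteq> 0" for i j
      using Fnz[OF that] staircase_zero[OF Mst(1), of i j] by (auto simp: not_le[symmetric])
    show "i \<in> {..<m} \<and> j \<in> {..<m} \<and> (i, j) \<in> {(i, j). Suc (i + j) < m}" if "F M' i j \<noteq> 0" for i j
      using Fnz[OF that] staircase_zero[OF Mst(2), of i j] by (auto simp: not_le[symmetric])
    show "j = k" if "F M i j \<noteq> 0" "F M i k \<noteq> 0" for i j k
      using Fnz[OF that(1)] Fnz[OF that(2)] Ms(2) by (auto simp: monomial_rows_def)
    show "j = k" if "F M' i j \<noteq> 0" "F M' i k \<noteq> 0" for i j k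
      using Fnz[OF that(1)] Fnz[OF that(2)] Ms(4) by (auto simp: monomial_rows_def)
    show "i = j" if "F M i k \<noteq> 0" "F M j k \<noteq> 0" for i j k
      using Fnz[OF that(1)] Fnz[OF that(2)] monomial_cols[OF Ms(1) eps Ms(2)] by blast
    show "i = j" if "F M' i k \<noteq> 0" "F M' j k \<noteq> 0" for i j k
      using Fnz[OF that(1)] Fnz[OF that(2)] monomial_cols[OF Ms(3) eps Ms(4)] by blast
    show "p $$ (i, i) = 1" "?q $$ (i, i) = 1" if "i \<in> {..<m}" for i
      using that p uinv(1)[OF p] by (auto simp: unitri_diag)
    show "k < i" if "i \<in> {..<m}" "k \<in> {..<m}" "p $$ (k, i) \<noteq> 0" "k \<noteq> i" for i k
      using that unitri_lower[OF p, of i k] by (cases i k rule: linorder_cases) auto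
    show "k < j" if "k \<in> {..<m}" "j \<in> {..<m}" "?q $$ (k, j) \<noteq> 0" "k \<noteq> j" for k j
      using that unitri_lower[OF uinv(1)[OF p], of j k] by (cases j k rule: linorder_cases) auto
    show "(\<Sum>k<m. p $$ (k, i) * F M k j) = (\<Sum>k<m. F M' i k * ?q $$ (k, j))"
      if "i \<in> {..<m}" "j \<in> {..<m}" "(i, j) \<in> {(i, j). Suc (i + j) < m}" for i j
    proof -
      have "(\<Sum>k<m. p $$ (k, i) * F M k j) = (p\<^sup>T * ?M) $$ (i, j)"
        using that c by (subst index_mult_mat_sum[of _ m m _ m]) (auto simp: F_def intro!: sum.cong)
      also have "\<dots> = (\<Sum>k<m. T $$ (i, k) * ?q $$ (k, j))"
        unfolding pM using that c Tc by (subst index_mult_mat_sum[of _ m m _ m]) auto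
      also have "\<dots> = (\<Sum>k<m. F M' i k * ?q $$ (k, j))"
      proof (intro sum.cong refl)
        fix k assume k: "k \<in> {..<m}"
        show "T $$ (i, k) * ?q $$ (k, j) = F M' i k * ?q $$ (k, j)"
        \<comment> \<open>Terms with \<open>k\<close> beyond \<open>j\<close> vanish; in the others
          \<open>(i, k)\<close> stays above the antidiagonal, where \<open>eq\<close>
          applies.\<close>
        proof (cases "j < k")
          case True
          then show ?thesis using k by (simp add: unitri_lower[OF uinv(1)[OF p]])
        next
          case False
          then have "T $$ (i, k) = ?M' $$ (i, k)" unfolding T_def using that k by (intro eq) auto
          then show ?thesis using that k by (simp add: F_def)
        qed
      qed
      finally show ?thesis .
    qed
  qed simp_all
  then have "double_diag m M $$ (i, j) = double_diag m M' $$ (i, j)" if "i < m" "j < m" for i j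
    using that by (auto simp: F_def fun_eq_iff split: if_splits)
  then have "M $$ (i, j) = M' $$ (i, j)" if "i < m" "j < m" for i j
    using that two by (cases "i = j") (fastforce simp: double_diag_def)+
  then show ?thesis using Mc by (intro eq_matI) auto
qed

text \<open>If the two functionals agreed, replacing \<open>S\<close> by its congruence under the
  inverse of \<open>h\<close> would leave the single group element \<open>p = g * uinv m h\<close>.
  Testing on elementary \<epsilon>-symmetric matrices then gives
  \<open>monomial_unique_mod_staircase\<close>.\<close>

lemma upper_pairings_differ:
  fixes M M' :: "'a::{field,finite} mat"
  assumes two: "(2 :: 'a) \<noteq> 0" and eps: "\<epsilon> * \<epsilon> = 1"
    and M: "M \<in> monomials \<epsilon> m" and M': "M' \<in> monomials \<epsilon> m" and ne: "M \<noteq> M'"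
    and g: "g \<in> unitri m" and h: "h \<in> unitri m"
  shows "\<exists>S\<in>staircase \<epsilon> m. upper_pairing m M (g * S * g\<^sup>T) \<noteq> upper_pairing m M' (h * S * h\<^sup>T)"
proof (rule ccontr)
  assume "\<not> ?thesis"
  then have all: "upper_pairing m M (g * S * g\<^sup>T) = upper_pairing m M' (h * S * h\<^sup>T)"
    if "S \<in> staircase \<epsilon> m" for S using that by blast
  have eps0: "\<epsilon> \<noteq> 0" using eps by auto
  define p where "p = g * uinv m h"
  have p: "p \<in> unitri m" using g uinv(1)[OF h] by (auto simp: p_def intro: mult_unitri)
  note c = unitri_carrier[OF g] unitri_carrier[OF h] unitri_carrier[OF uinv(1)[OF h]] unitri_carrier[OF p]
  have Ms: "M \<in> eps_symmetric \<epsilon> m" "M' \<in> eps_symmetric \<epsilon> m"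
    using M M' by (auto simp: monomials_def staircase_eps)
  have eq1: "upper_pairing m M (p * S * p\<^sup>T) = upper_pairing m M' (1\<^sub>m m * S * (1\<^sub>m m)\<^sup>T)"
    if S: "S \<in> staircase \<epsilon> m" for S
  proof -
    let ?S = "uinv m h * S * (uinv m h)\<^sup>T"
    have "?S \<in> staircase \<epsilon> m" using staircase_congruence[OF uinv(1)[OF h] S] .
    from all[OF this] show ?thesis
      unfolding p_def congruence_mult[OF c(1,3) staircase_carrier[OF S]]
        congruence_mult[OF c(2,3) staircase_carrier[OF S], symmetric] uinv(2)[OF h] .
  qed
  have "M = M'"
  proof (rule monomial_unique_mod_staircase[OF two eps0 p M M'])
    fix i j assume ij: "i < m" "j < m" "Suc (i + j) < m"
    \<comment> \<open>The elementary \<epsilon>-symmetric matrix at \<open>(i, j)\<close>; pairing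
      with it yields twice that entry, also for \<open>i = j\<close>.\<close>
    let ?E = "mat m m (\<lambda>(a, b). of_bool (a = i \<and> b = j) + \<epsilon> * of_bool (a = j \<and> b = i))"
    have E: "?E \<in> staircase \<epsilon> m"
    proof (rule staircaseI)
      fix a b assume ab: "a < m" "b < m"
      show "?E $$ (b, a) = \<epsilon> * ?E $$ (a, b)"
        using ab by (simp add: distrib_left mult.assoc[symmetric] eps conj_commute)
      show "?E $$ (a, b) = 0" if "m \<le> Suc (a + b)"
      proof -
        have "(a = i \<and> b = j) = False" "(a = j \<and> b = i) = False" using that ij by auto
        then show ?thesis using ab by (simp only: index_mat split_conv of_bool_eq) simp
      qed
    qed simp
    have sum: "(\<Sum>c<m. \<Sum>d<m. T $$ (c, d) * ?E $$ (c, d)) = 2 * T $$ (i, j)"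
      if T: "T \<in> eps_symmetric \<epsilon> m" for T
    proof -
      have "(\<Sum>c<m. \<Sum>d<m. T $$ (c, d) * ?E $$ (c, d)) =
          (\<Sum>c<m. \<Sum>d<m. (if d = j then if c = i then T $$ (c, d) else 0 else 0) +
            (if d = i then if c = j then \<epsilon> * T $$ (c, d) else 0 else 0))"
        by (intro sum.cong refl) (auto simp: algebra_simps)
      also have "\<dots> = T $$ (i, j) + \<epsilon> * T $$ (j, i)"
        using ij by (simp add: sum.distrib)
      also have "\<epsilon> * T $$ (j, i) = (\<epsilon> * \<epsilon>) * T $$ (i, j)"
        using eps_symmetricD[OF T ij(1,2)] by (simp add: mult.assoc)
      finally show ?thesis by (simp add: eps)
    qed
    have sym: "q\<^sup>T * double_diag m N * q \<in> eps_symmetric \<epsilon> m"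
      if "N \<in> eps_symmetric \<epsilon> m" "q \<in> carrier_mat m m" for N q
      using congruence_eps_symmetric[of "q\<^sup>T" m "double_diag m N" \<epsilon>,
          OF _ double_diag_eps_symmetric[OF that(1)]] that(2) by simp
    have "2 * (2 * upper_pairing m M (p * ?E * p\<^sup>T)) = 2 * (2 * upper_pairing m M' (1\<^sub>m m * ?E * (1\<^sub>m m)\<^sup>T))"
      by (simp only: eq1[OF E])
    then have "2 * (2 * (p\<^sup>T * double_diag m M * p) $$ (i, j)) =
        2 * (2 * ((1\<^sub>m m)\<^sup>T * double_diag m M' * 1\<^sub>m m) $$ (i, j))"
      unfolding upper_pairing_congruence[OF Ms(1) staircase_eps[OF E] eps c(4)]
        upper_pairing_congruence[OF Ms(2) staircase_eps[OF E] eps one_carrier_mat]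
        sum[OF sym[OF Ms(1) c(4)]] sum[OF sym[OF Ms(2) one_carrier_mat]] .
    then show "(p\<^sup>T * double_diag m M * p) $$ (i, j) = double_diag m M' $$ (i, j)"
      unfolding mult_left_cancel[OF two] using left_mult_one_mat[OF double_diag_carrier[of m M']]
        right_mult_one_mat[OF double_diag_carrier[of m M']] by simp
  qed
  with ne show False by simp
qed

text \<open>Translation by \<open>S0\<close>, with \<open>f\<close> in the role of addition,
  permutes \<open>A\<close> and multiplies the sum by \<open>\<theta> (L S0)\<close>, which differs
  from 1.\<close>

lemma sum_additive_character_zero:
  fixes \<theta> :: "'a::{field,finite} \<Rightarrow> complex"
  assumes \<theta>: "nontrivial_additive_character \<theta>"
    and A: "finite A" "\<And>S T. S \<in> A \<Longrightarrow> T \<in> A \<Longrightarrow> f S T \<in> A"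
    and inj: "\<And>S. S \<in> A \<Longrightarrow> inj_on (f S) A"
    and add: "\<And>S T. S \<in> A \<Longrightarrow> T \<in> A \<Longrightarrow> L (f S T) = L S + L T"
    and S0: "S0 \<in> A" "\<theta> (L S0) \<noteq> 1"
  shows "(\<Sum>S\<in>A. \<theta> (L S)) = 0"
proof -
  have "f S0 ` A = A" using A inj[OF S0(1)] S0(1) by (intro endo_inj_surj) auto
  then have "(\<Sum>S\<in>A. \<theta> (L S)) = (\<Sum>S\<in>A. \<theta> (L (f S0 S)))"
    using sum.reindex[OF inj[OF S0(1)], of "\<lambda>S. \<theta> (L S)"] by simp
  also have "\<dots> = \<theta> (L S0) * (\<Sum>S\<in>A. \<theta> (L S))"
    unfolding sum_distrib_left
    by (intro sum.cong refl) (simp add: add S0(1) additive_character_add[OF \<theta>])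
  finally show ?thesis using S0(2) by simp
qed

text \<open>Expanding both orbit sums leaves, for each pair \<open>g\<close>, \<open>h\<close>, the
  character sum of a difference of two functionals. This difference is additive and nonzero, so
  every such sum vanishes.\<close>

lemma orbit_sum_orthogonal:
  fixes M M' :: "'a::{field,finite} mat"
  assumes two: "(2 :: 'a) \<noteq> 0" and eps: "\<epsilon> * \<epsilon> = 1" and \<theta>: "nontrivial_additive_character \<theta>"
    and M: "M \<in> monomials \<epsilon> m" and M': "M' \<in> monomials \<epsilon> m" and ne: "M \<noteq> M'"
  shows "(\<Sum>S\<in>staircase \<epsilon> m. orbit_sum \<theta> m M S * cnj (orbit_sum \<theta> m M' S)) = 0"
proof -
  define L where "L g h S = upper_pairing m M (g * S * g\<^sup>T) - upper_pairing m M' (h * S * h\<^sup>T)" for g h S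
  have "orbit_sum \<theta> m M S * cnj (orbit_sum \<theta> m M' S) = (\<Sum>g\<in>unitri m. \<Sum>h\<in>unitri m. \<theta> (L g h S))" for S
    unfolding orbit_sum_def cnj_sum sum_product L_def
    by (simp add: additive_character_minus[OF \<theta>, symmetric] additive_character_add[OF \<theta>, symmetric])
  then have "(\<Sum>S\<in>staircase \<epsilon> m. orbit_sum \<theta> m M S * cnj (orbit_sum \<theta> m M' S)) =
      (\<Sum>S\<in>staircase \<epsilon> m. \<Sum>g\<in>unitri m. \<Sum>h\<in>unitri m. \<theta> (L g h S))" by simp
  also have "\<dots> = (\<Sum>g\<in>unitri m. \<Sum>S\<in>staircase \<epsilon> m. \<Sum>h\<in>unitri m. \<theta> (L g h S))"
    by (rule sum.swap)
  also have "\<dots> = (\<Sum>g\<in>unitri m. \<Sum>h\<in>unitri m. \<Sum>S\<in>staircase \<epsilon> m. \<theta> (L g h S))"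
    by (rule sum.cong[OF refl]) (rule sum.swap)
  also have "\<dots> = 0"
  proof (rule sum.neutral, rule ballI, rule sum.neutral, rule ballI)
    fix g h :: "'a mat" assume g: "g \<in> unitri m" and h: "h \<in> unitri m"
    note c = unitri_carrier[OF g] unitri_carrier[OF h]
    obtain S where S: "S \<in> staircase \<epsilon> m" "L g h S \<noteq> 0"
      using upper_pairings_differ[OF two eps M M' ne g h] by (auto simp: L_def)
    obtain a where a: "\<theta> a \<noteq> 1" using \<theta> by (auto simp: nontrivial_additive_character_def)
    \<comment> \<open>Rescaled so that the difference of functionals takes the value
      \<open>a\<close>, at which \<open>\<theta>\<close> is nontrivial.\<close>
    define S0 where "S0 = (a / L g h S) \<cdot>\<^sub>m S"
    have S0: "S0 \<in> staircase \<epsilon> m" using S by (simp add: S0_def staircase_smult)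
    have cong_c: "k * T * k\<^sup>T \<in> carrier_mat m m" if "k \<in> unitri m" "T \<in> staircase \<epsilon> m" for k T
      using staircase_carrier[OF staircase_congruence[OF that]] .
    have "L g h S0 = a"
      using S(2) unfolding S0_def L_def congruence_smult[OF c(1) staircase_carrier[OF S(1)]]
        congruence_smult[OF c(2) staircase_carrier[OF S(1)]]
        upper_pairing_smult[OF cong_c[OF g S(1)]] upper_pairing_smult[OF cong_c[OF h S(1)]]
      by (simp add: diff_divide_distrib[symmetric] right_diff_distrib[symmetric])
    with a have ne1: "\<theta> (L g h S0) \<noteq> 1" by simp
    show "(\<Sum>S\<in>staircase \<epsilon> m. \<theta> (L g h S)) = 0"
    proof (rule sum_additive_character_zero[where f = "(+)" and L = "L g h" and \<theta> = \<theta> and ?S0.0 = S0])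
      show "inj_on ((+) T) (staircase \<epsilon> m)" if T: "T \<in> staircase \<epsilon> m" for T
      proof (rule inj_onI)
        fix X Y assume X: "X \<in> staircase \<epsilon> m" and Y: "Y \<in> staircase \<epsilon> m" and e: "T + X = T + Y"
        note XY = staircase_carrier[OF X] staircase_carrier[OF Y] staircase_carrier[OF T]
        have "X $$ (i, j) = Y $$ (i, j)" if "i < m" "j < m" for i j
          using arg_cong[OF e, of "\<lambda>Z. Z $$ (i, j)"] that XY by simp
        then show "X = Y" using XY by (intro eq_matI) auto
      qed
      show "L g h (T + X) = L g h T + L g h X" if T: "T \<in> staircase \<epsilon> m" and X: "X \<in> staircase \<epsilon> m" for T X
        unfolding L_def congruence_add[OF c(1) staircase_carrier[OF T] staircase_carrier[OF X]]
          congruence_add[OF c(2) staircase_carrier[OF T] staircase_carrier[OF X]]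
          upper_pairing_add[OF cong_c[OF g T] cong_c[OF g X]] upper_pairing_add[OF cong_c[OF h T] cong_c[OF h X]]
        by simp
      show "\<theta> (L g h S0) \<noteq> 1" by (rule ne1)
      show "S0 \<in> staircase \<epsilon> m" by (rule S0)
    qed (use \<theta> staircase_add in simp_all)
  qed
  finally show ?thesis .
qed

subsection \<open>The orthogonality relations on staircase matrices\<close>

lemma staircase_in_orbit:
  fixes S :: "'a::{field,finite} mat"
  assumes two: "(2 :: 'a) \<noteq> 0" and eps: "\<epsilon> = 1 \<or> \<epsilon> = -1" and S: "S \<in> staircase \<epsilon> m"
  obtains M where "M \<in> monomials \<epsilon> m" "S \<in> congruence_orbit m M"
proof -
  obtain g where g: "g \<in> unitri m" "monomial_rows m (g * S * g\<^sup>T)"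
    using congruent_to_monomial[OF two eps staircase_eps[OF S]] by blast
  note c = unitri_carrier[OF g(1)] unitri_carrier[OF uinv(1)[OF g(1)]] staircase_carrier[OF S]
  have "S = uinv m g * (g * S * g\<^sup>T) * (uinv m g)\<^sup>T"
    using c unfolding congruence_mult[OF c(2,1,3), symmetric] uinv(3)[OF g(1)] by simp
  then have "S \<in> congruence_orbit m (g * S * g\<^sup>T)"
    using uinv(1)[OF g(1)] unfolding congruence_orbit_def by blast
  moreover have "g * S * g\<^sup>T \<in> monomials \<epsilon> m"
    using g staircase_congruence[OF g(1) S] by (simp add: monomials_def)
  ultimately show ?thesis using that by blast
qed

lemma congruence_orbit_disjoint:
  fixes M M' :: "'a::{field,finite} mat"
  assumes eps: "\<epsilon> \<noteq> 0" and M: "M \<in> monomials \<epsilon> m" and M': "M' \<in> monomials \<epsilon> m"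
    and S: "S \<in> congruence_orbit m M" "S \<in> congruence_orbit m M'"
  shows "M = M'"
proof -
  obtain g h where g: "g \<in> unitri m" "S = g * M * g\<^sup>T" and h: "h \<in> unitri m" "S = h * M' * h\<^sup>T"
    using S by (auto simp: congruence_orbit_def)
  have Ms: "M \<in> eps_symmetric \<epsilon> m" "monomial_rows m M" "M' \<in> eps_symmetric \<epsilon> m" "monomial_rows m M'"
    using M M' by (auto simp: monomials_def staircase_eps)
  let ?k = "uinv m h"
  note c = unitri_carrier[OF g(1)] unitri_carrier[OF h(1)] unitri_carrier[OF uinv(1)[OF h(1)]]
    eps_symmetric_carrier[OF Ms(1)] eps_symmetric_carrier[OF Ms(3)]
  have "(?k * g) * M * (?k * g)\<^sup>T = ?k * S * ?k\<^sup>T"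
    unfolding g(2) by (rule congruence_mult[OF c(3,1,4)])
  also have "\<dots> = M'"
    unfolding h(2) congruence_mult[OF c(3,2,5), symmetric] uinv(3)[OF h(1)] using c by simp
  finally have "(?k * g) * M * (?k * g)\<^sup>T = M'" .
  moreover have "?k * g \<in> unitri m" using mult_unitri[OF uinv(1)[OF h(1)] g(1)] .
  ultimately show ?thesis using monomial_two_sided_unique[OF _ _ eps Ms] by blast
qed

lemma congruence_orbit_subset:
  "M \<in> staircase \<epsilon> m \<Longrightarrow> congruence_orbit m M \<subseteq> staircase \<epsilon> m"
  unfolding congruence_orbit_def using staircase_congruence by blast

text \<open>The orbits of the monomial matrices partition the staircase matrices and orbit sums are
  constant on them. Orthogonality over all staircase matrices thus becomes orthogonality over
  monomials weighted by orbit sizes, a statement about a square array.\<close>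

lemma orbit_sum_column_orthogonality:
  fixes N N' :: "'a::{field,finite} mat"
  assumes two: "(2 :: 'a) \<noteq> 0" and eps: "\<epsilon> = 1 \<or> \<epsilon> = -1" and \<theta>: "nontrivial_additive_character \<theta>"
    and N: "N \<in> monomials \<epsilon> m" and N': "N' \<in> monomials \<epsilon> m"
  shows "(\<Sum>M\<in>monomials \<epsilon> m. orbit_sum \<theta> m M N * cnj (orbit_sum \<theta> m M N') /
      (\<Sum>S\<in>staircase \<epsilon> m. orbit_sum \<theta> m M S * cnj (orbit_sum \<theta> m M S))) =
    of_bool (N = N') / of_nat (card (congruence_orbit m N))"
proof -
  let ?X = "orbit_sum \<theta> m" and ?I = "monomials \<epsilon> m" and ?o = "\<lambda>k. congruence_orbit m k :: 'a mat set"
  define nrm where "nrm M = (\<Sum>S\<in>staircase \<epsilon> m. ?X M S * cnj (?X M S))" for M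
  have eps2: "\<epsilon> * \<epsilon> = 1" and eps0: "\<epsilon> \<noteq> 0" using eps by auto
  have st: "M \<in> staircase \<epsilon> m" if "M \<in> ?I" for M using that by (simp add: monomials_def)
  have nrm0: "nrm M \<noteq> 0" if "M \<in> ?I" for M
  proof -
    \<comment> \<open>The zero matrix is fixed by the group, so every summand is 1; this single
      value makes the norm positive.\<close>
    have zero: "?X M (0\<^sub>m m m) = of_nat (card (unitri m :: 'a mat set))"
    proof -
      have "\<theta> (upper_pairing m M (g * 0\<^sub>m m m * g\<^sup>T)) = 1" if "g \<in> unitri m" for g
        using unitri_carrier[OF that] by (simp add: upper_pairing_zero additive_character_zero[OF \<theta>])
      then show ?thesis by (simp add: orbit_sum_def)
    qed
    have "nrm M = of_real (\<Sum>S\<in>staircase \<epsilon> m. (cmod (?X M S))\<^sup>2)"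
      unfolding nrm_def of_real_sum by (intro sum.cong refl) (rule complex_norm_square[symmetric])
    moreover have "(\<Sum>S\<in>staircase \<epsilon> m. (cmod (?X M S))\<^sup>2) > 0"
    proof (rule sum_pos2[OF finite_staircase zero_staircase])
      have "(unitri m :: 'a mat set) \<noteq> {}" using one_unitri by blast
      then show "0 < (cmod (?X M (0\<^sub>m m m)))\<^sup>2" unfolding zero by simp
    qed simp
    ultimately show ?thesis by (metis less_irrefl of_real_eq_0_iff)
  qed
  have const: "?X M S = ?X M k" if "k \<in> ?I" "S \<in> ?o k" for M S k
    using that orbit_sum_congruence[OF _ staircase_carrier[OF st[OF that(1)]]]
    by (auto simp: congruence_orbit_def)
  have union: "staircase \<epsilon> m = (\<Union>k\<in>?I. ?o k)"
  proof (intro equalityI subsetI)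
    fix S :: "'a mat" assume "S \<in> staircase \<epsilon> m"
    then show "S \<in> (\<Union>k\<in>?I. ?o k)" using staircase_in_orbit[OF two eps] by blast
  next
    fix S :: "'a mat" assume "S \<in> (\<Union>k\<in>?I. ?o k)"
    then show "S \<in> staircase \<epsilon> m" using congruence_orbit_subset st by blast
  qed
  have disj: "?o k \<inter> ?o l = {}" if "k \<in> ?I" "l \<in> ?I" "k \<noteq> l" for k l
    using congruence_orbit_disjoint[OF eps0 that(1,2)] that(3) by blast
  have split: "(\<Sum>S\<in>staircase \<epsilon> m. ?X i S * cnj (?X j S)) =
      (\<Sum>k\<in>?I. of_nat (card (?o k)) * (?X i k * cnj (?X j k)))" for i j
  proof -
    have "(\<Sum>S\<in>staircase \<epsilon> m. ?X i S * cnj (?X j S)) =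
        (\<Sum>k\<in>?I. \<Sum>S\<in>?o k. ?X i S * cnj (?X j S))"
      unfolding union by (rule sum.UNION_disjoint) (use disj in \<open>auto simp: congruence_orbit_def\<close>)
    also have "\<dots> = (\<Sum>k\<in>?I. \<Sum>S\<in>?o k. ?X i k * cnj (?X j k))"
      using const by (intro sum.cong refl) simp
    finally show ?thesis by simp
  qed
  \<comment> \<open>Read as a matrix product equal to the identity: the weight of the orbit and the
    norm are put into the second factor, which is then a right inverse of \<open>?X\<close>.\<close>
  have row: "(\<Sum>k\<in>?I. ?X i k * (of_nat (card (?o k)) * cnj (?X j k) / nrm j)) = of_bool (i = j)"
    if "i \<in> ?I" "j \<in> ?I" for i j
  proof -
    have "(\<Sum>k\<in>?I. ?X i k * (of_nat (card (?o k)) * cnj (?X j k) / nrm j)) =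
        (\<Sum>k\<in>?I. of_nat (card (?o k)) * (?X i k * cnj (?X j k))) / nrm j"
      unfolding sum_divide_distrib by (intro sum.cong refl) simp
    also have "\<dots> = (\<Sum>S\<in>staircase \<epsilon> m. ?X i S * cnj (?X j S)) / nrm j" by (simp only: split)
    also have "\<dots> = of_bool (i = j)"
      using orbit_sum_orthogonal[OF two eps2 \<theta> that] nrm0[OF that(2)]
      by (cases "i = j") (simp_all add: nrm_def)
    finally show ?thesis .
  qed
  have col: "(\<Sum>k\<in>?I. (of_nat (card (?o N')) * cnj (?X k N') / nrm k) * ?X k N) = of_bool (N' = N)"
    by (rule right_inverse_imp_left_inverse[where A = ?X and B = "\<lambda>k j. of_nat (card (?o k)) * cnj (?X j k) / nrm j",
          OF finite_monomials row N' N])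
  have card0: "of_nat (card (?o k)) \<noteq> (0 :: complex)" if "k \<in> ?I" for k
  proof -
    have "1\<^sub>m m * k * (1\<^sub>m m)\<^sup>T \<in> ?o k"
      unfolding congruence_orbit_def by (rule imageI[OF one_unitri])
    moreover have "finite (?o k)" by (simp add: congruence_orbit_def)
    ultimately show ?thesis by auto
  qed
  \<comment> \<open>In the reversed product the orbit size is that of \<open>N'\<close>, independent
    of the summation index, and can be divided out.\<close>
  have "(\<Sum>k\<in>?I. ?X k N * cnj (?X k N') / nrm k) =
      (\<Sum>k\<in>?I. (of_nat (card (?o N')) * cnj (?X k N') / nrm k) * ?X k N) / of_nat (card (?o N'))"
    unfolding sum_divide_distrib using card0[OF N'] by (intro sum.cong refl) simp
  also have "\<dots> = of_bool (N = N') / of_nat (card (?o N))"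
    unfolding col by auto
  finally show ?thesis unfolding nrm_def .
qed

subsection \<open>Block matrices\<close>

lemma sum_lessThan_add:
  fixes f :: "nat \<Rightarrow> 'b::comm_monoid_add"
  shows "(\<Sum>k<a + b. f k) = (\<Sum>k<a. f k) + (\<Sum>k<b. f (a + k))"
  by (induction b) (simp_all add: add.assoc)

lemma index_append_rows:
  assumes "C \<in> carrier_mat r1 c" "E \<in> carrier_mat r2 c" "i < r1 + r2" "j < c"
  shows "(C @\<^sub>r E) $$ (i, j) = (if i < r1 then C $$ (i, j) else E $$ (i - r1, j))"
  using assms unfolding append_rows_def by (auto simp: Let_def)

lemma block3_carrier:
  assumes "A \<in> carrier_mat n n" "B \<in> carrier_mat n r" "C \<in> carrier_mat n k"
    "D \<in> carrier_mat r r" "E \<in> carrier_mat r k" "F \<in> carrier_mat k k"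
  shows "block3 A B C D E F \<in> carrier_mat (n + r + k) (n + r + k)"
  using assms unfolding block3_def by (auto simp: Let_def)

lemma block3_index:
  assumes c: "A \<in> carrier_mat n n" "B \<in> carrier_mat n r" "C \<in> carrier_mat n k"
    "D \<in> carrier_mat r r" "E \<in> carrier_mat r k" "F \<in> carrier_mat k k"
  shows
    "\<And>i j. i < n \<Longrightarrow> j < n \<Longrightarrow> block3 A B C D E F $$ (i, j) = A $$ (i, j)"
    "\<And>i j. i < n \<Longrightarrow> j < r \<Longrightarrow> block3 A B C D E F $$ (i, n + j) = B $$ (i, j)"
    "\<And>i j. i < n \<Longrightarrow> j < k \<Longrightarrow> block3 A B C D E F $$ (i, n + r + j) = C $$ (i, j)"
    "\<And>i j. i < r \<Longrightarrow> j < n \<Longrightarrow> block3 A B C D E F $$ (n + i, j) = 0"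
    "\<And>i j. i < r \<Longrightarrow> j < r \<Longrightarrow> block3 A B C D E F $$ (n + i, n + j) = D $$ (i, j)"
    "\<And>i j. i < r \<Longrightarrow> j < k \<Longrightarrow> block3 A B C D E F $$ (n + i, n + r + j) = E $$ (i, j)"
    "\<And>i j. i < k \<Longrightarrow> j < n \<Longrightarrow> block3 A B C D E F $$ (n + r + i, j) = 0"
    "\<And>i j. i < k \<Longrightarrow> j < r \<Longrightarrow> block3 A B C D E F $$ (n + r + i, n + j) = 0"
    "\<And>i j. i < k \<Longrightarrow> j < k \<Longrightarrow> block3 A B C D E F $$ (n + r + i, n + r + j) = F $$ (i, j)"
  using c unfolding block3_def by (auto simp: Let_def index_append_rows[OF c(3) c(5)])

lemma block3_cases:
  assumes "i < n + r + (k::nat)"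
  obtains (1) a where "a < n" "i = a" | (2) a where "a < r" "i = n + a" | (3) a where "a < k" "i = n + r + a"
proof -
  consider "i < n" | "n \<le> i" "i < n + r" | "n + r \<le> i" by linarith
  then show ?thesis
  proof cases
    case 1
    then show ?thesis using that(1)[of i] by simp
  next
    case 2
    then show ?thesis using that(2)[of "i - n"] by simp
  next
    case 3
    then show ?thesis using that(3)[of "i - n - r"] assms by simp
  qed
qed

lemma block3_eqI:
  assumes "X \<in> carrier_mat (n + r + k) (n + r + k)" "Y \<in> carrier_mat (n + r + k) (n + r + k)"
    "\<And>i j. i < n \<Longrightarrow> j < n \<Longrightarrow> X $$ (i, j) = Y $$ (i, j)"
    "\<And>i j. i < n \<Longrightarrow> j < r \<Longrightarrow> X $$ (i, n + j) = Y $$ (i, n + j)"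
    "\<And>i j. i < n \<Longrightarrow> j < k \<Longrightarrow> X $$ (i, n + r + j) = Y $$ (i, n + r + j)"
    "\<And>i j. i < r \<Longrightarrow> j < n \<Longrightarrow> X $$ (n + i, j) = Y $$ (n + i, j)"
    "\<And>i j. i < r \<Longrightarrow> j < r \<Longrightarrow> X $$ (n + i, n + j) = Y $$ (n + i, n + j)"
    "\<And>i j. i < r \<Longrightarrow> j < k \<Longrightarrow> X $$ (n + i, n + r + j) = Y $$ (n + i, n + r + j)"
    "\<And>i j. i < k \<Longrightarrow> j < n \<Longrightarrow> X $$ (n + r + i, j) = Y $$ (n + r + i, j)"
    "\<And>i j. i < k \<Longrightarrow> j < r \<Longrightarrow> X $$ (n + r + i, n + j) = Y $$ (n + r + i, n + j)"
    "\<And>i j. i < k \<Longrightarrow> j < k \<Longrightarrow> X $$ (n + r + i, n + r + j) = Y $$ (n + r + i, n + r + j)"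
  shows "X = Y"
proof (rule eq_matI)
  fix i j assume "i < dim_row Y" "j < dim_col Y"
  then have ij: "i < n + r + k" "j < n + r + k" using assms(2) by auto
  show "X $$ (i, j) = Y $$ (i, j)"
    using ij(1) by (cases rule: block3_cases; use ij(2) in \<open>cases rule: block3_cases\<close>)
      (simp_all add: assms(3-11))
qed (use assms(1,2) in auto)

lemma block3_mult:
  assumes c: "A \<in> carrier_mat n n" "B \<in> carrier_mat n r" "C \<in> carrier_mat n k"
    "D \<in> carrier_mat r r" "E \<in> carrier_mat r k" "F \<in> carrier_mat k k"
    and c': "A' \<in> carrier_mat n n" "B' \<in> carrier_mat n r" "C' \<in> carrier_mat n k"
    "D' \<in> carrier_mat r r" "E' \<in> carrier_mat r k" "F' \<in> carrier_mat k k"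
  shows "block3 A B C D E F * block3 A' B' C' D' E' F' =
    block3 (A * A') (A * B' + B * D') (A * C' + B * E' + C * F') (D * D') (D * E' + E * F') (F * F')"
proof -
  note X = block3_carrier[OF c] and Y = block3_carrier[OF c']
  have Z: "A * A' \<in> carrier_mat n n" "A * B' + B * D' \<in> carrier_mat n r"
    "A * C' + B * E' + C * F' \<in> carrier_mat n k" "D * D' \<in> carrier_mat r r"
    "D * E' + E * F' \<in> carrier_mat r k" "F * F' \<in> carrier_mat k k"
    using c c' by auto
  note XY = index_mult_mat_sum[OF X Y]
  note ix = block3_index[OF c] block3_index[OF c'] block3_index[OF Z]
  note dims = c[THEN carrier_matD(1)] c[THEN carrier_matD(2)] c'[THEN carrier_matD(1)] c'[THEN carrier_matD(2)]
  show ?thesis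
    by (rule block3_eqI[of _ n r k], rule mult_carrier_mat[OF X Y], rule block3_carrier[OF Z])
      (simp_all add: XY sum_lessThan_add ix c c' dims index_mult_mat_sum[OF c(1) c'(1)] index_mult_mat_sum[OF c(1) c'(2)]
         index_mult_mat_sum[OF c(1) c'(3)] index_mult_mat_sum[OF c(2) c'(4)] index_mult_mat_sum[OF c(2) c'(5)]
         index_mult_mat_sum[OF c(3) c'(6)] index_mult_mat_sum[OF c(4) c'(4)] index_mult_mat_sum[OF c(4) c'(5)]
         index_mult_mat_sum[OF c(5) c'(6)] index_mult_mat_sum[OF c(6) c'(6)] del: index_mult_mat(1))
qed

lemma block3_unitri:
  assumes "A \<in> unitri n" "B \<in> carrier_mat n r" "C \<in> carrier_mat n k"
    "D \<in> unitri r" "E \<in> carrier_mat r k" "F \<in> unitri k"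
  shows "block3 A B C D E F \<in> unitri (n + r + k)"
proof -
  note c = unitri_carrier[OF assms(1)] assms(2,3) unitri_carrier[OF assms(4)] assms(5) unitri_carrier[OF assms(6)]
  note ix = block3_index[OF c]
  have "block3 A B C D E F $$ (i, j) = 0" if ij: "i < n + r + k" "j < n + r + k" "j < i" for i j
    using ij(1) by (cases rule: block3_cases; use ij(2) in \<open>cases rule: block3_cases\<close>)
      (use ij(3) assms in \<open>auto simp: ix unitri_lower\<close>)
  moreover have "block3 A B C D E F $$ (i, i) = 1" if i: "i < n + r + k" for i
    using i by (cases rule: block3_cases) (use assms in \<open>auto simp: ix unitri_diag\<close>)
  ultimately show ?thesis using block3_carrier[OF c] unfolding unitri_iff by blast
qed

subsection \<open>The antidiagonal and the invariant form\<close>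

lemma antidiag_carrier [simp]: "antidiag n \<in> carrier_mat n n"
  by (simp add: antidiag_def)

lemma antidiag_dim [simp]: "dim_row (antidiag n) = n" "dim_col (antidiag n) = n"
  by (simp_all add: antidiag_def)

lemma antidiag_mult_index:
  assumes "X \<in> carrier_mat n k" "i < n" "j < k"
  shows "(antidiag n * X) $$ (i, j) = X $$ (n - Suc i, j)"
proof -
  have "(antidiag n * X) $$ (i, j) = (\<Sum>l<n. if l = n - Suc i then X $$ (l, j) else 0)"
    unfolding index_mult_mat_sum[OF antidiag_carrier assms]
    using assms by (intro sum.cong refl) (auto simp: antidiag_def)
  then show ?thesis using assms by simp
qed

lemma mult_antidiag_index:
  assumes "X \<in> carrier_mat k n" "i < k" "j < n"
  shows "(X * antidiag n) $$ (i, j) = X $$ (i, n - Suc j)"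
proof -
  have "(X * antidiag n) $$ (i, j) = (\<Sum>l<n. if l = n - Suc j then X $$ (i, l) else 0)"
    unfolding index_mult_mat_sum[OF assms(1) antidiag_carrier assms(2,3)]
    using assms by (intro sum.cong refl) (auto simp: antidiag_def)
  then show ?thesis using assms by simp
qed

lemma antidiag_square [simp]: "antidiag n * antidiag n = (1\<^sub>m n :: 'a::field mat)"
proof (rule eq_matI)
  fix i j assume "i < dim_row (1\<^sub>m n :: 'a mat)" "j < dim_col (1\<^sub>m n :: 'a mat)"
  then show "(antidiag n * antidiag n) $$ (i, j) = (1\<^sub>m n :: 'a mat) $$ (i, j)"
    by (simp add: antidiag_mult_index[OF antidiag_carrier] del: index_mult_mat(1)) (auto simp: antidiag_def)
qed auto

text \<open>The symmetry sign of \<open>a * \<Omega>\<close> for \<open>a\<close> in the Lie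
  algebra, which is opposite to the sign of \<Omega> itself: the symplectic form is antisymmetric,
  but its staircase matrices are symmetric.\<close>

definition form_sign :: "gtype \<Rightarrow> 'a::field" where
  "form_sign ty = (if ty = Symplectic then 1 else -1)"

text \<open>The nonzero entry of \<Omega> in column \<open>b\<close>: minus signs fill the lower
  left block of the symplectic Gram matrix.\<close>

definition column_sign :: "gtype \<Rightarrow> nat \<Rightarrow> nat \<Rightarrow> 'a::field" where
  "column_sign ty n b = (if ty = Symplectic \<and> b < n then -1 else 1)"

definition form_matrix :: "gtype \<Rightarrow> nat \<Rightarrow> 'a::field mat" where
  "form_matrix ty n = mat (msize ty n) (msize ty n)
     (\<lambda>(a, b). if a + b + 1 = msize ty n then column_sign ty n b else 0)"

lemma column_sign_square [simp]: "column_sign ty n b * column_sign ty n b = 1"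
  by (simp add: column_sign_def)

lemma column_sign_nz [simp]: "column_sign ty n b \<noteq> 0"
  by (simp add: column_sign_def)

lemma form_matrix_carrier [simp]: "form_matrix ty n \<in> carrier_mat (msize ty n) (msize ty n)"
  by (simp add: form_matrix_def)

lemma form_matrix_dim [simp]:
  "dim_row (form_matrix ty n) = msize ty n" "dim_col (form_matrix ty n) = msize ty n"
  by (simp_all add: form_matrix_def)

lemma mult_form_matrix_index:
  assumes "X \<in> carrier_mat k (msize ty n)" "i < k" "j < msize ty n"
  shows "(X * form_matrix ty n) $$ (i, j) = X $$ (i, msize ty n - Suc j) * column_sign ty n j"
proof -
  have "(X * form_matrix ty n) $$ (i, j) =
      (\<Sum>l<msize ty n. if l = msize ty n - Suc j then X $$ (i, l) * column_sign ty n j else 0)"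
    unfolding index_mult_mat_sum[OF assms(1) form_matrix_carrier assms(2,3)]
    using assms by (intro sum.cong refl) (auto simp: form_matrix_def)
  then show ?thesis using assms by simp
qed

lemma form_matrix_mult_index:
  assumes "X \<in> carrier_mat (msize ty n) k" "i < msize ty n" "j < k"
  shows "(form_matrix ty n * X) $$ (i, j) =
    column_sign ty n (msize ty n - Suc i) * X $$ (msize ty n - Suc i, j)"
proof -
  have "(form_matrix ty n * X) $$ (i, j) =
      (\<Sum>l<msize ty n. if l = msize ty n - Suc i then column_sign ty n l * X $$ (l, j) else 0)"
    unfolding index_mult_mat_sum[OF form_matrix_carrier assms]
    using assms by (intro sum.cong refl) (auto simp: form_matrix_def)
  then show ?thesis using assms by simp
qed

lemma form_matrix_transpose: "(form_matrix ty n)\<^sup>T = - form_sign ty \<cdot>\<^sub>m (form_matrix ty n :: 'a::field mat)"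
  by (rule eq_matI) (auto simp: form_matrix_def form_sign_def column_sign_def msize_def mid_def)

lemma form_matrix_inverse:
  "form_matrix ty n * (form_matrix ty n)\<^sup>T = (1\<^sub>m (msize ty n) :: 'a::field mat)"
  "(form_matrix ty n)\<^sup>T * form_matrix ty n = (1\<^sub>m (msize ty n) :: 'a::field mat)"
proof -
  let ?\<Omega> = "form_matrix ty n :: 'a mat" and ?m = "msize ty n"
  show 1: "?\<Omega> * ?\<Omega>\<^sup>T = 1\<^sub>m ?m"
  proof (rule eq_matI)
    fix i j assume "i < dim_row (1\<^sub>m ?m :: 'a mat)" "j < dim_col (1\<^sub>m ?m :: 'a mat)"
    then have ij: "i < ?m" "j < ?m" by auto
    have "(?\<Omega> * ?\<Omega>\<^sup>T) $$ (i, j) = column_sign ty n (?m - Suc i) * ?\<Omega>\<^sup>T $$ (?m - Suc i, j)"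
      by (rule form_matrix_mult_index) (use ij in simp_all)
    also have "\<dots> = 1\<^sub>m ?m $$ (i, j)" using ij by (auto simp: form_matrix_def)
    finally show "(?\<Omega> * ?\<Omega>\<^sup>T) $$ (i, j) = 1\<^sub>m ?m $$ (i, j)" .
  qed auto
  show "?\<Omega>\<^sup>T * ?\<Omega> = 1\<^sub>m ?m"
    by (rule mat_mult_left_right_inverse[OF _ _ 1]) simp_all
qed

subsection \<open>Block description of the group\<close>

lemma msize_eq: "msize ty n = n + mid ty + n"
  by (simp add: msize_def)

lemma mid_le: "mid ty \<le> 1"
  by (simp add: mid_def)

text \<open>Invariance is imposed in the same congruence form as the action on staircase matrices,
  which lets \<Omega> and \<open>S\<close> be treated by the same lemmas.\<close>

definition isometries :: "gtype \<Rightarrow> nat \<Rightarrow> 'a::field mat set" where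
  "isometries ty n = {z \<in> unitri (msize ty n). z * form_matrix ty n * z\<^sup>T = form_matrix ty n}"

lemma form_congruence_index:
  fixes z :: "'a::field mat"
  assumes z: "z \<in> carrier_mat (msize ty n) (msize ty n)" and ab: "a < msize ty n" "b < msize ty n"
  shows "(z * form_matrix ty n * z\<^sup>T) $$ (a, b) =
    - form_sign ty * (\<Sum>c<n. z $$ (a, n + mid ty + (n - Suc c)) * z $$ (b, c))
    + (\<Sum>k<mid ty. z $$ (a, n + k) * z $$ (b, n + k))
    + (\<Sum>c<n. z $$ (a, c) * z $$ (b, n + mid ty + (n - Suc c)))"
proof -
  let ?m = "msize ty n"
  have "(z * form_matrix ty n * z\<^sup>T) $$ (a, b) =
      (\<Sum>c<?m. z $$ (a, ?m - Suc c) * column_sign ty n c * z $$ (b, c))"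
    using z ab by (subst index_mult_mat_sum[of _ ?m ?m _ ?m])
      (auto intro!: sum.cong simp: mult_form_matrix_index[OF z ab(1)] simp del: index_mult_mat(1))
  also have "\<dots> = (\<Sum>c<n. z $$ (a, ?m - Suc c) * column_sign ty n c * z $$ (b, c))
      + (\<Sum>k<mid ty. z $$ (a, ?m - Suc (n + k)) * column_sign ty n (n + k) * z $$ (b, n + k))
      + (\<Sum>k<n. z $$ (a, ?m - Suc (n + mid ty + k)) * column_sign ty n (n + mid ty + k) * z $$ (b, n + mid ty + k))"
    (is "_ = ?s1 + ?s2 + ?s3")
    by (simp add: msize_eq sum_lessThan_add)
  \<comment> \<open>In the left half \<open>column_sign\<close> equals minus
    \<open>form_sign\<close> for all three types, so no case distinction is needed.\<close>
  also have "?s1 = - form_sign ty * (\<Sum>c<n. z $$ (a, n + mid ty + (n - Suc c)) * z $$ (b, c))"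
    unfolding sum_distrib_left
  proof (intro sum.cong refl)
    fix c assume "c \<in> {..<n}"
    then have "?m - Suc c = n + mid ty + (n - Suc c)" "column_sign ty n c = (- form_sign ty :: 'a)"
      by (auto simp: msize_eq column_sign_def form_sign_def)
    then show "z $$ (a, ?m - Suc c) * column_sign ty n c * z $$ (b, c) =
        - form_sign ty * (z $$ (a, n + mid ty + (n - Suc c)) * z $$ (b, c))" by simp
  qed
  also have "?s2 = (\<Sum>k<mid ty. z $$ (a, n + k) * z $$ (b, n + k))"
  proof (intro sum.cong refl)
    fix k assume "k \<in> {..<mid ty}"
    then have "?m - Suc (n + k) = n + k" using mid_le[of ty] by (simp add: msize_eq)
    then show "z $$ (a, ?m - Suc (n + k)) * column_sign ty n (n + k) * z $$ (b, n + k) =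
        z $$ (a, n + k) * z $$ (b, n + k)" by (simp add: column_sign_def)
  qed
  also have "?s3 = (\<Sum>k<n. z $$ (a, n - Suc k) * z $$ (b, n + mid ty + (n - Suc (n - Suc k))))"
  proof (intro sum.cong refl)
    fix k assume "k \<in> {..<n}"
    then have "?m - Suc (n + mid ty + k) = n - Suc k" "n - Suc (n - Suc k) = k" by (auto simp: msize_eq)
    then show "z $$ (a, ?m - Suc (n + mid ty + k)) * column_sign ty n (n + mid ty + k) * z $$ (b, n + mid ty + k) =
        z $$ (a, n - Suc k) * z $$ (b, n + mid ty + (n - Suc (n - Suc k)))" by (simp add: column_sign_def)
  qed
  also have "\<dots> = (\<Sum>c<n. z $$ (a, c) * z $$ (b, n + mid ty + (n - Suc c)))"
    by (rule sum.nat_diff_reindex)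
  finally show ?thesis .
qed

text \<open>One equation serves the three types: \<open>form_sign\<close> carries the sign, and the
  sum over \<open>mid ty\<close> is empty when there is no middle block.\<close>

lemma U_data_iff:
  "(x, v, w) \<in> U_data ty n \<longleftrightarrow> x \<in> unitri n \<and> v \<in> carrier_mat n (mid ty) \<and> w \<in> carrier_mat n n \<and>
    (\<forall>i<n. \<forall>j<n. w $$ (j, n - Suc i) - form_sign ty * w $$ (i, n - Suc j) =
       - (\<Sum>k<mid ty. v $$ (i, k) * v $$ (j, k)))"
    (is "_ \<longleftrightarrow> ?x \<and> ?v \<and> ?w \<and> ?eq")
proof (cases "?v \<and> ?w")
  case True
  then have v: "v \<in> carrier_mat n (mid ty)" and w: "w \<in> carrier_mat n n" by auto
  have Jw: "(antidiag n * w\<^sup>T) $$ (i, j) = w $$ (j, n - Suc i)" if "i < n" "j < n" for i j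
    using antidiag_mult_index[of "w\<^sup>T" n n i j] w that by simp
  have wJ: "(w * antidiag n) $$ (i, j) = w $$ (i, n - Suc j)" if "i < n" "j < n" for i j
    using mult_antidiag_index[OF w] that by simp
  have vv: "(v * v\<^sup>T) $$ (i, j) = (\<Sum>k<mid ty. v $$ (i, k) * v $$ (j, k))" if "i < n" "j < n" for i j
    using v that by (subst index_mult_mat_sum[of _ n "mid ty" _ n]) (auto intro!: sum.cong)
  have eqI: "(A = B) \<longleftrightarrow> (\<forall>i<n. \<forall>j<n. A $$ (i, j) = B $$ (i, j))"
    if "A \<in> carrier_mat n n" "B \<in> carrier_mat n n" for A B :: "'a mat"
    using that by (auto intro!: eq_matI)
  have c: "antidiag n * w\<^sup>T - w * antidiag n \<in> carrier_mat n n"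
    "antidiag n * w\<^sup>T + w * antidiag n \<in> carrier_mat n n" "- (v * v\<^sup>T) \<in> carrier_mat n n"
    using v w by auto
  have e: "(antidiag n * w\<^sup>T - w * antidiag n) $$ (i, j) = w $$ (j, n - Suc i) - w $$ (i, n - Suc j)"
    "(antidiag n * w\<^sup>T + w * antidiag n) $$ (i, j) = w $$ (j, n - Suc i) + w $$ (i, n - Suc j)"
    "(- (v * v\<^sup>T)) $$ (i, j) = - (\<Sum>k<mid ty. v $$ (i, k) * v $$ (j, k))" if "i < n" "j < n" for i j
    using v w that Jw[OF that] wJ[OF that] vv[OF that] by (simp_all del: index_mult_mat(1))
  have "(case ty of
        Symplectic \<Rightarrow> antidiag n * w\<^sup>T - w * antidiag n = 0\<^sub>m n n
      | EvenOrth \<Rightarrow> antidiag n * w\<^sup>T + w * antidiag n = 0\<^sub>m n n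
      | OddOrth \<Rightarrow> antidiag n * w\<^sup>T + w * antidiag n = - (v * v\<^sup>T)) \<longleftrightarrow> ?eq"
    by (cases ty)
      (simp_all add: eqI[OF c(1) zero_carrier_mat] eqI[OF c(2) zero_carrier_mat] eqI[OF c(2,3)] e
        form_sign_def mid_def del: index_mult_mat(1))
  then show ?thesis using v w by (simp add: U_data_def)
qed (auto simp: U_data_def)

lemma U_data_carrier:
  "(x, v, w) \<in> U_data ty n \<Longrightarrow>
    x \<in> unitri n \<and> v \<in> carrier_mat n (mid ty) \<and> w \<in> carrier_mat n n"
  by (simp add: U_data_iff)

lemma antidual_index:
  assumes "X \<in> carrier_mat n n" "i < n" "j < n"
  shows "(antidiag n * X\<^sup>T * antidiag n) $$ (i, j) = X $$ (n - Suc j, n - Suc i)"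
  using assms
  by (subst mult_antidiag_index[of _ n]) (auto simp: antidiag_mult_index[of "X\<^sup>T" n n] simp del: index_mult_mat(1))

lemma transpose_antidiag_index:
  assumes "v \<in> carrier_mat n r" "i < r" "j < n"
  shows "(v\<^sup>T * antidiag n) $$ (i, j) = v $$ (n - Suc j, i)"
  using assms by (subst mult_antidiag_index[of _ r]) auto

lemma U_mat_eq:
  assumes "x \<in> (unitri n :: 'a::{field,finite} mat set)"
  shows "U_mat ty n (x, v, w) = block3 x (x * v) (x * w) (1\<^sub>m (mid ty)) (- (v\<^sup>T * antidiag n))
    (antidiag n * (uinv n x)\<^sup>T * antidiag n)"
  by (simp add: U_mat_def inv_unitri_group[OF assms])

lemma U_mat_blocks:
  fixes x :: "'a::{field,finite} mat"
  assumes "(x, v, w) \<in> U_data ty n"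
  shows "x \<in> carrier_mat n n" "x * v \<in> carrier_mat n (mid ty)" "x * w \<in> carrier_mat n n"
    "1\<^sub>m (mid ty) \<in> carrier_mat (mid ty) (mid ty)"
    "- (v\<^sup>T * antidiag n) \<in> carrier_mat (mid ty) n"
    "antidiag n * (uinv n x)\<^sup>T * antidiag n \<in> carrier_mat n n"
  using U_data_carrier[OF assms] unitri_carrier[of x n] unitri_carrier[OF uinv(1), of x n]
    antidiag_carrier[of n, where 'a = 'a]
  by (auto simp del: antidiag_carrier)

lemma U_mat_index:
  fixes x :: "'a::{field,finite} mat"
  assumes d: "(x, v, w) \<in> U_data ty n"
  shows
    "\<And>i j. i < n \<Longrightarrow> j < n \<Longrightarrow> U_mat ty n (x, v, w) $$ (i, j) = x $$ (i, j)"
    "\<And>i j. i < n \<Longrightarrow> j < mid ty \<Longrightarrow> U_mat ty n (x, v, w) $$ (i, n + j) = (x * v) $$ (i, j)"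
    "\<And>i j. i < n \<Longrightarrow> j < n \<Longrightarrow> U_mat ty n (x, v, w) $$ (i, n + mid ty + j) = (x * w) $$ (i, j)"
    "\<And>i j. i < mid ty \<Longrightarrow> j < n \<Longrightarrow> U_mat ty n (x, v, w) $$ (n + i, j) = 0"
    "\<And>i j. i < mid ty \<Longrightarrow> j < mid ty \<Longrightarrow> U_mat ty n (x, v, w) $$ (n + i, n + j) = of_bool (i = j)"
    "\<And>i j. i < mid ty \<Longrightarrow> j < n \<Longrightarrow> U_mat ty n (x, v, w) $$ (n + i, n + mid ty + j) = - v $$ (n - Suc j, i)"
    "\<And>i j. i < n \<Longrightarrow> j < n \<Longrightarrow> U_mat ty n (x, v, w) $$ (n + mid ty + i, j) = 0"
    "\<And>i j. i < n \<Longrightarrow> j < mid ty \<Longrightarrow> U_mat ty n (x, v, w) $$ (n + mid ty + i, n + j) = 0"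
    "\<And>i j. i < n \<Longrightarrow> j < n \<Longrightarrow>
       U_mat ty n (x, v, w) $$ (n + mid ty + i, n + mid ty + j) = uinv n x $$ (n - Suc j, n - Suc i)"
proof -
  have x: "x \<in> unitri n" and v: "v \<in> carrier_mat n (mid ty)" using U_data_carrier[OF d] by auto
  have E: "(- (v\<^sup>T * antidiag n)) $$ (i, j) = - v $$ (n - Suc j, i)" if "i < mid ty" "j < n" for i j
    using that v transpose_antidiag_index[OF v that] by (simp del: index_mult_mat(1))
  note ix = block3_index[OF U_mat_blocks[OF d]] U_mat_eq[OF x] antidual_index[OF unitri_carrier[OF uinv(1)[OF x]]] E
  show "\<And>i j. i < n \<Longrightarrow> j < n \<Longrightarrow> U_mat ty n (x, v, w) $$ (i, j) = x $$ (i, j)"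
    "\<And>i j. i < n \<Longrightarrow> j < mid ty \<Longrightarrow> U_mat ty n (x, v, w) $$ (i, n + j) = (x * v) $$ (i, j)"
    "\<And>i j. i < n \<Longrightarrow> j < n \<Longrightarrow> U_mat ty n (x, v, w) $$ (i, n + mid ty + j) = (x * w) $$ (i, j)"
    "\<And>i j. i < mid ty \<Longrightarrow> j < n \<Longrightarrow> U_mat ty n (x, v, w) $$ (n + i, j) = 0"
    "\<And>i j. i < mid ty \<Longrightarrow> j < mid ty \<Longrightarrow> U_mat ty n (x, v, w) $$ (n + i, n + j) = of_bool (i = j)"
    "\<And>i j. i < mid ty \<Longrightarrow> j < n \<Longrightarrow> U_mat ty n (x, v, w) $$ (n + i, n + mid ty + j) = - v $$ (n - Suc j, i)"
    "\<And>i j. i < n \<Longrightarrow> j < n \<Longrightarrow> U_mat ty n (x, v, w) $$ (n + mid ty + i, j) = 0"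
    "\<And>i j. i < n \<Longrightarrow> j < mid ty \<Longrightarrow> U_mat ty n (x, v, w) $$ (n + mid ty + i, n + j) = 0"
    "\<And>i j. i < n \<Longrightarrow> j < n \<Longrightarrow>
       U_mat ty n (x, v, w) $$ (n + mid ty + i, n + mid ty + j) = uinv n x $$ (n - Suc j, n - Suc i)"
    by (simp_all add: ix del: index_mult_mat(1))
qed

lemma antidual_unitri:
  assumes "x \<in> unitri n"
  shows "antidiag n * x\<^sup>T * antidiag n \<in> unitri n"
proof -
  have c: "antidiag n * x\<^sup>T * antidiag n \<in> carrier_mat n n"
    using unitri_carrier[OF assms] by (intro mult_carrier_mat[of _ n n]) auto
  show ?thesis
    using c assms
    by (auto simp: unitri_iff antidual_index[OF unitri_carrier[OF assms]] simp del: index_mult_mat(1) intro: unitri_lower)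
qed

lemma U_mat_unitri:
  fixes x :: "'a::{field,finite} mat"
  assumes d: "(x, v, w) \<in> U_data ty n"
  shows "U_mat ty n (x, v, w) \<in> unitri (msize ty n)"
proof -
  have x: "x \<in> unitri n" using U_data_carrier[OF d] by auto
  show ?thesis unfolding U_mat_eq[OF x] msize_eq
    by (rule block3_unitri[OF x U_mat_blocks(2,3)[OF d] one_unitri U_mat_blocks(5)[OF d] antidual_unitri[OF uinv(1)[OF x]]])
qed

lemma U_mat_isometry:
  fixes x :: "'a::{field,finite} mat"
  assumes d: "(x, v, w) \<in> U_data ty n"
  shows "U_mat ty n (x, v, w) \<in> isometries ty n"
proof -
  let ?z = "U_mat ty n (x, v, w)" and ?\<epsilon> = "form_sign ty :: 'a" and ?r = "mid ty"
  define rv where "rv c = n - Suc c" for c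
  have rv: "rv c < n" "rv (rv c) = c" if "c < n" for c using that by (auto simp: rv_def)
  have x: "x \<in> unitri n" and v: "v \<in> carrier_mat n ?r" and w: "w \<in> carrier_mat n n"
    and rel: "\<And>i j. i < n \<Longrightarrow> j < n \<Longrightarrow> w $$ (j, rv i) - ?\<epsilon> * w $$ (i, rv j) =
       - (\<Sum>k<?r. v $$ (i, k) * v $$ (j, k))"
    using d by (auto simp: U_data_iff rv_def)
  note xc = unitri_carrier[OF x] and yc = unitri_carrier[OF uinv(1)[OF x]]
  have zc: "?z \<in> carrier_mat (n + ?r + n) (n + ?r + n)" using unitri_carrier[OF U_mat_unitri[OF d]] by (simp add: msize_eq)
  note ix = U_mat_index[OF d, folded rv_def] rv
  have fi: "(?z * form_matrix ty n * ?z\<^sup>T) $$ (a, b) =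
    - ?\<epsilon> * (\<Sum>c<n. ?z $$ (a, n + ?r + (rv c)) * ?z $$ (b, c))
    + (\<Sum>k<?r. ?z $$ (a, n + k) * ?z $$ (b, n + k))
    + (\<Sum>c<n. ?z $$ (a, c) * ?z $$ (b, n + ?r + (rv c)))" if "a < n + ?r + n" "b < n + ?r + n" for a b
    unfolding rv_def by (rule form_congruence_index) (use zc that in \<open>simp_all add: msize_eq\<close>)
  have xy: "(\<Sum>c<n. x $$ (i, c) * uinv n x $$ (c, j)) = of_bool (i = j)" if "i < n" "j < n" for i j
    using index_mult_mat_sum[OF xc yc that, symmetric] uinv(2)[OF x] that by simp
  have xv: "(x * v) $$ (i, j) = (\<Sum>c<n. x $$ (i, c) * v $$ (c, j))" if "i < n" "j < ?r" for i j
    by (rule index_mult_mat_sum[OF xc v that])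
  have xw: "(x * w) $$ (i, j) = (\<Sum>c<n. x $$ (i, c) * w $$ (c, j))" if "i < n" "j < n" for i j
    by (rule index_mult_mat_sum[OF xc w that])
  \<comment> \<open>The only block relation that uses the equation for \<open>v\<close> and
    \<open>w\<close>: after expanding the products, every pair of entries of \<open>x\<close> is
    multiplied by an instance of \<open>rel\<close>.\<close>
  have upup: "- ?\<epsilon> * (\<Sum>c<n. (x * w) $$ (i, rv c) * x $$ (j, c))
      + (\<Sum>k<?r. (x * v) $$ (i, k) * (x * v) $$ (j, k))
      + (\<Sum>c<n. x $$ (i, c) * (x * w) $$ (j, rv c)) = 0" if "i < n" "j < n" for i j
  proof -
    have 1: "- ?\<epsilon> * (\<Sum>c<n. (x * w) $$ (i, rv c) * x $$ (j, c)) =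
        (\<Sum>p<n. \<Sum>q<n. x $$ (i, p) * x $$ (j, q) * (- ?\<epsilon> * w $$ (p, rv q)))"
      using that by (subst sum.swap) (simp add: xw rv sum_distrib_left sum_distrib_right mult_ac sum_negf del: index_mult_mat(1))
    have "(\<Sum>k<?r. (x * v) $$ (i, k) * (x * v) $$ (j, k)) =
        (\<Sum>k<?r. \<Sum>p<n. \<Sum>q<n. x $$ (i, p) * x $$ (j, q) * (v $$ (p, k) * v $$ (q, k)))"
      using that by (simp add: xv sum_product mult_ac del: index_mult_mat(1))
    also have "\<dots> = (\<Sum>p<n. \<Sum>k<?r. \<Sum>q<n. x $$ (i, p) * x $$ (j, q) * (v $$ (p, k) * v $$ (q, k)))"
      by (rule sum.swap)
    also have "\<dots> = (\<Sum>p<n. \<Sum>q<n. \<Sum>k<?r. x $$ (i, p) * x $$ (j, q) * (v $$ (p, k) * v $$ (q, k)))"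
      by (rule sum.cong[OF refl]) (rule sum.swap)
    also have "\<dots> = (\<Sum>p<n. \<Sum>q<n. x $$ (i, p) * x $$ (j, q) * (\<Sum>k<?r. v $$ (p, k) * v $$ (q, k)))"
      by (simp add: sum_distrib_left)
    finally have 2: "(\<Sum>k<?r. (x * v) $$ (i, k) * (x * v) $$ (j, k)) = \<dots>" .
    have 3: "(\<Sum>c<n. x $$ (i, c) * (x * w) $$ (j, rv c)) =
        (\<Sum>p<n. \<Sum>q<n. x $$ (i, p) * x $$ (j, q) * w $$ (q, rv p))"
      using that by (simp add: xw rv sum_distrib_left mult_ac del: index_mult_mat(1))
    show ?thesis
      unfolding 1 2 3 sum.distrib[symmetric]
    proof (rule sum.neutral, rule ballI, rule sum.neutral, rule ballI)
      fix p q assume "p \<in> {..<n}" "q \<in> {..<n}"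
      then have "w $$ (q, rv p) - ?\<epsilon> * w $$ (p, rv q) = - (\<Sum>k<?r. v $$ (p, k) * v $$ (q, k))"
        using rel by simp
      then have e: "- ?\<epsilon> * w $$ (p, rv q) + (\<Sum>k<?r. v $$ (p, k) * v $$ (q, k)) + w $$ (q, rv p) = 0"
        by (simp add: algebra_simps)
      show "x $$ (i, p) * x $$ (j, q) * (- ?\<epsilon> * w $$ (p, rv q)) +
          x $$ (i, p) * x $$ (j, q) * (\<Sum>k<?r. v $$ (p, k) * v $$ (q, k)) +
          x $$ (i, p) * x $$ (j, q) * w $$ (q, rv p) = 0"
        unfolding distrib_left[symmetric] e by simp
    qed
  qed
  have "?z * form_matrix ty n * ?z\<^sup>T = form_matrix ty n"
  proof (rule block3_eqI[of _ n ?r n])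
    have "form_matrix ty n \<in> carrier_mat (n + ?r + n) (n + ?r + n)"
      using form_matrix_carrier[of ty n] by (simp only: msize_eq)
    then show "?z * form_matrix ty n * ?z\<^sup>T \<in> carrier_mat (n + ?r + n) (n + ?r + n)"
      "form_matrix ty n \<in> carrier_mat (n + ?r + n) (n + ?r + n)" using zc by auto
    fix i j
    show "(?z * form_matrix ty n * ?z\<^sup>T) $$ (i, j) = form_matrix ty n $$ (i, j)" if "i < n" "j < n"
    proof -
      have "form_matrix ty n $$ (i, j) = (0 :: 'a)" using that by (simp add: form_matrix_def msize_eq)
      then show ?thesis using upup[OF that] that by (simp add: fi ix del: index_mult_mat(1))
    qed
    show "(?z * form_matrix ty n * ?z\<^sup>T) $$ (i, n + j) = form_matrix ty n $$ (i, n + j)" if "i < n" "j < ?r"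
    proof -
      have "(\<Sum>k<?r. (x * v) $$ (i, k) * of_bool (j = k)) = (\<Sum>k<?r. if k = j then (x * v) $$ (i, k) else 0)"
        by (intro sum.cong) auto
      also have "\<dots> = (x * v) $$ (i, j)" using that by (simp del: index_mult_mat(1))
      finally have 1: "(\<Sum>k<?r. (x * v) $$ (i, k) * of_bool (j = k)) = (x * v) $$ (i, j)" .
      have "form_matrix ty n $$ (i, n + j) = (0 :: 'a)" using that mid_le[of ty] by (auto simp: form_matrix_def msize_eq)
      then show ?thesis using that
        by (simp add: fi ix 1 sum_negf del: index_mult_mat(1)) (simp add: xv del: index_mult_mat(1))
    qed
    show "(?z * form_matrix ty n * ?z\<^sup>T) $$ (i, n + ?r + j) = form_matrix ty n $$ (i, n + ?r + j)"
      if "i < n" "j < n"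
    proof -
      have "form_matrix ty n $$ (i, n + ?r + j) = (of_bool (i = rv j) :: 'a)"
        using that by (auto simp: form_matrix_def msize_eq column_sign_def rv_def)
      then show ?thesis using that by (simp add: fi ix xy del: index_mult_mat(1))
    qed
    show "(?z * form_matrix ty n * ?z\<^sup>T) $$ (n + i, j) = form_matrix ty n $$ (n + i, j)" if "i < ?r" "j < n"
    proof -
      have "form_matrix ty n $$ (n + i, j) = (0 :: 'a)" using that mid_le[of ty] by (auto simp: form_matrix_def msize_eq)
      moreover have "?\<epsilon> = -1" using that by (auto simp: form_sign_def mid_def split: if_splits)
      moreover have "(\<Sum>k<?r. of_bool (i = k) * (x * v) $$ (j, k)) = (\<Sum>k<?r. if k = i then (x * v) $$ (j, k) else 0)"
        by (intro sum.cong) auto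
      moreover have "\<dots> = (x * v) $$ (j, i)" using that by (simp del: index_mult_mat(1))
      ultimately show ?thesis using that
        by (simp add: fi ix sum_negf del: index_mult_mat(1)) (simp add: xv mult.commute del: index_mult_mat(1))
    qed
    show "(?z * form_matrix ty n * ?z\<^sup>T) $$ (n + i, n + j) = form_matrix ty n $$ (n + i, n + j)"
      if "i < ?r" "j < ?r"
    proof -
      have r1: "?r = 1" "i = 0" "j = 0" using that mid_le[of ty] by auto
      have "form_matrix ty n $$ (n + i, n + j) = (1 :: 'a)"
        unfolding form_matrix_def using r1 by (simp add: msize_eq column_sign_def)
      moreover have "(\<Sum>k<?r. of_bool (i = k) * of_bool (j = k)) = (1 :: 'a)" using r1 by simp
      ultimately show ?thesis using that by (simp add: fi ix del: index_mult_mat(1) of_bool_eq_iff)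
    qed
    show "(?z * form_matrix ty n * ?z\<^sup>T) $$ (n + i, n + ?r + j) = form_matrix ty n $$ (n + i, n + ?r + j)"
      if "i < ?r" "j < n"
      using that by (simp add: fi ix del: index_mult_mat(1)) (auto simp: form_matrix_def msize_eq)
    show "(?z * form_matrix ty n * ?z\<^sup>T) $$ (n + ?r + i, j) = form_matrix ty n $$ (n + ?r + i, j)"
      if "i < n" "j < n"
    proof -
      have "form_matrix ty n $$ (n + ?r + i, j) = (- ?\<epsilon> * of_bool (j = rv i) :: 'a)"
        using that by (auto simp: form_matrix_def msize_eq column_sign_def form_sign_def rv_def)
      moreover have "(\<Sum>c<n. uinv n x $$ (rv (rv c), rv i) * x $$ (j, c)) = of_bool (j = rv i)"
        using xy[of j "rv i"] that by (simp add: mult.commute rv)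
      ultimately show ?thesis using that by (simp add: fi ix del: index_mult_mat(1))
    qed
    show "(?z * form_matrix ty n * ?z\<^sup>T) $$ (n + ?r + i, n + j) = form_matrix ty n $$ (n + ?r + i, n + j)"
      if "i < n" "j < ?r"
      using that by (simp add: fi ix del: index_mult_mat(1)) (auto simp: form_matrix_def msize_eq)
    show "(?z * form_matrix ty n * ?z\<^sup>T) $$ (n + ?r + i, n + ?r + j) = form_matrix ty n $$ (n + ?r + i, n + ?r + j)"
      if "i < n" "j < n"
      using that by (simp add: fi ix del: index_mult_mat(1)) (auto simp: form_matrix_def msize_eq)
  qed
  then show ?thesis using U_mat_unitri[OF d] by (simp add: isometries_def)
qed

lemma U_mat_inj: "inj_on (U_mat ty n) (U_data ty n :: ('a::{field,finite} mat \<times> 'a mat \<times> 'a mat) set)"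
proof (rule inj_onI)
  fix d d' :: "'a mat \<times> 'a mat \<times> 'a mat"
  assume dd: "d \<in> U_data ty n" "d' \<in> U_data ty n" and eq: "U_mat ty n d = U_mat ty n d'"
  obtain x v w x' v' w' where d: "d = (x, v, w)" "d' = (x', v', w')" by (cases d, cases d')
  note c = U_data_carrier[OF dd(1)[unfolded d]] U_data_carrier[OF dd(2)[unfolded d]]
  note c1 = unitri_carrier[OF conjunct1[OF c(1)]] unitri_carrier[OF conjunct1[OF c(2)]]
  note ix = U_mat_index[OF dd(1)[unfolded d]] and ix' = U_mat_index[OF dd(2)[unfolded d]]
  have "x $$ (i, j) = x' $$ (i, j)" if "i < n" "j < n" for i j
    using ix(1)[OF that] ix'(1)[OF that] eq d by simp
  then have x: "x = x'" using c1 by (intro eq_matI) auto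
  have "(x * v) $$ (i, j) = (x' * v') $$ (i, j)" if "i < n" "j < mid ty" for i j
    using ix(2)[OF that] ix'(2)[OF that] eq d by simp
  then have "x * v = x * v'" using c c1 x by (intro eq_matI) auto
  then have v: "v = v'" using c by (intro unitri_left_cancel[of x n v "mid ty" v']) auto
  have "(x * w) $$ (i, j) = (x' * w') $$ (i, j)" if "i < n" "j < n" for i j
    using ix(3)[OF that] ix'(3)[OF that] eq d by simp
  then have "x * w = x * w'" using c c1 x by (intro eq_matI) auto
  then have w: "w = w'" using c by (intro unitri_left_cancel[of x n w n w']) auto
  show "d = d'" using d x v w by simp
qed

subsection \<open>The Cayley transform\<close>

text \<open>Halving puts 1 on the diagonal, so the denominator of the Cayley transform is itself
  unitriangular and is inverted inside \<open>unitri\<close>.\<close>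

definition half_sum :: "nat \<Rightarrow> 'a::field mat \<Rightarrow> 'a mat" where
  "half_sum m z = (1 / 2) \<cdot>\<^sub>m (z + 1\<^sub>m m)"

definition cayley :: "nat \<Rightarrow> 'a::{field,finite} mat \<Rightarrow> 'a mat" where
  "cayley m z = (z - 1\<^sub>m m) * uinv m (half_sum m z)"

lemma half_sum_unitri:
  assumes "(2 :: 'a::field) \<noteq> 0" "z \<in> unitri m"
  shows "half_sum m z \<in> (unitri m :: 'a mat set)"
  using assms unitri_carrier[OF assms(2)] by (auto simp: unitri_iff half_sum_def)

lemma half_sum_commute:
  fixes z :: "'a::field mat"
  assumes "z \<in> carrier_mat m m"
  shows "half_sum m z * (z - 1\<^sub>m m) = (z - 1\<^sub>m m) * half_sum m z"
proof -
  have "(z + 1\<^sub>m m) * (z - 1\<^sub>m m) = z * z + z - (z + 1\<^sub>m m)" "(z - 1\<^sub>m m) * (z + 1\<^sub>m m) = z * z + z - (z + 1\<^sub>m m)"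
    using assms by (simp_all add: mult_minus_distrib_mat[of _ m m _ m] mult_add_distrib_mat[of _ m m _ m]
        add_mult_distrib_mat[of _ m m _ _ m] minus_mult_distrib_mat[of _ m m _ _ m])
  then have "(z + 1\<^sub>m m) * (z - 1\<^sub>m m) = (z - 1\<^sub>m m) * (z + 1\<^sub>m m)" by simp
  moreover have c: "z + 1\<^sub>m m \<in> carrier_mat m m" "z - 1\<^sub>m m \<in> carrier_mat m m"
    using assms by (simp, intro minus_carrier_mat one_carrier_mat)
  ultimately show ?thesis
    unfolding half_sum_def mult_smult_distrib[OF c(2,1)] mult_smult_assoc_mat[OF c] by simp
qed

context
  fixes m :: nat and z :: "'a::{field,finite} mat"
  assumes two: "(2 :: 'a) \<noteq> 0" and z: "z \<in> unitri m"
begin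

lemmas half_sum_carriers = unitri_carrier[OF half_sum_unitri[OF two z]]
  unitri_carrier[OF uinv(1)[OF half_sum_unitri[OF two z]]]

lemma minus_one_carrier: "z - 1\<^sub>m m \<in> carrier_mat m m"
  by (rule minus_carrier_mat[OF one_carrier_mat])

lemma cayley_carrier: "cayley m z \<in> carrier_mat m m"
  unfolding cayley_def by (rule mult_carrier_mat[OF minus_one_carrier half_sum_carriers(2)])

lemma cayley_half_sum: "cayley m z * half_sum m z = z - 1\<^sub>m m"
  unfolding cayley_def assoc_mult_mat[OF minus_one_carrier half_sum_carriers(2,1)]
    uinv(3)[OF half_sum_unitri[OF two z]] by (rule right_mult_one_mat[OF minus_one_carrier])

lemma half_sum_cayley: "half_sum m z * cayley m z = z - 1\<^sub>m m"
  unfolding cayley_def assoc_mult_mat[OF half_sum_carriers(1) minus_one_carrier half_sum_carriers(2), symmetric]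
    half_sum_commute[OF unitri_carrier[OF z]] assoc_mult_mat[OF minus_one_carrier half_sum_carriers]
    uinv(2)[OF half_sum_unitri[OF two z]] by (rule right_mult_one_mat[OF minus_one_carrier])

lemma cayley_strict_upper:
  assumes "i < m" "j \<le> i"
  shows "cayley m z $$ (i, j) = 0"
proof -
  let ?K = "uinv m (half_sum m z)"
  have K: "?K \<in> unitri m" by (rule uinv(1)[OF half_sum_unitri[OF two z]])
  have "(z - 1\<^sub>m m) $$ (i, k) * ?K $$ (k, j) = 0" if k: "k < m" for k
  proof (cases "k \<le> i")
    case True
    then have "(z - 1\<^sub>m m) $$ (i, k) = 0"
      using assms k z unitri_carrier[OF z] by (cases "k = i") (auto simp: unitri_diag unitri_lower)
    then show ?thesis by simp
  next
    case False
    then show ?thesis using assms k by (simp add: unitri_lower[OF K])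
  qed
  then show ?thesis
    unfolding cayley_def using unitri_carrier[OF z] unitri_carrier[OF K] assms
    by (subst index_mult_mat_sum[of _ m m _ m]) (auto intro: sum.neutral)
qed

end

lemma half_sum_conjugate:
  fixes z :: "'a::field mat"
  assumes "z \<in> carrier_mat m m" "y \<in> carrier_mat m m" "y' \<in> carrier_mat m m" "y * y' = 1\<^sub>m m"
  shows "half_sum m (y * z * y') = y * half_sum m z * y'"
  using assms unfolding half_sum_def
  by (simp add: mult_smult_distrib[of _ m m _ m] mult_smult_assoc_mat[of _ m m _ m]
      mult_add_distrib_mat[of _ m m _ m] add_mult_distrib_mat[of _ m m _ _ m])

lemma cayley_conjugate:
  fixes z :: "'a::{field,finite} mat"
  assumes two: "(2 :: 'a) \<noteq> 0" and z: "z \<in> unitri m" and y: "y \<in> unitri m"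
  shows "cayley m (y * z * uinv m y) = y * cayley m z * uinv m y"
proof -
  let ?y = "uinv m y" and ?h = "half_sum m z"
  let ?z = "y * z * ?y"
  have z': "?z \<in> unitri m" using mult_unitri[OF mult_unitri[OF y z] uinv(1)[OF y]] .
  note c = unitri_carrier[OF z] unitri_carrier[OF y] unitri_carrier[OF uinv(1)[OF y]]
    unitri_carrier[OF half_sum_unitri[OF two z]] cayley_carrier[OF two z] cayley_carrier[OF two z']
  have h': "half_sum m ?z = y * ?h * ?y"
    by (rule half_sum_conjugate[OF c(1-3) uinv(2)[OF y]])
  note hh = half_sum_unitri[OF two z']
  have yy: "?y * (y * X) = X" if "X \<in> carrier_mat m m" for X
    using that c uinv(3)[OF y] by (simp add: assoc_mult_mat[symmetric, of ?y m m y m X m])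
  have "(y * cayley m z * ?y) * half_sum m ?z = y * (cayley m z * ?h) * ?y"
    unfolding h' using c by (simp add: assoc_mult_mat[of _ m m _ m _ m] yy)
  also have "\<dots> = ?z - 1\<^sub>m m"
    unfolding cayley_half_sum[OF two z] using c uinv(2)[OF y]
    by (simp add: mult_minus_distrib_mat[of _ m m _ m] minus_mult_distrib_mat[of _ m m _ _ m])
  also have "\<dots> = cayley m ?z * half_sum m ?z" by (rule cayley_half_sum[OF two z', symmetric])
  finally have eq: "(y * cayley m z * ?y) * half_sum m ?z = cayley m ?z * half_sum m ?z" .
  let ?K = "uinv m (half_sum m ?z)"
  note c2 = unitri_carrier[OF hh] unitri_carrier[OF uinv(1)[OF hh]]
  have X: "X * half_sum m ?z * ?K = X" if "X \<in> carrier_mat m m" for X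
    using assoc_mult_mat[OF that c2] uinv(2)[OF hh] that by simp
  have "y * cayley m z * ?y = y * cayley m z * ?y * half_sum m ?z * ?K"
    using X[of "y * cayley m z * ?y"] c by simp
  also have "\<dots> = cayley m ?z" unfolding eq by (rule X[OF c(6)])
  finally show ?thesis by simp
qed

text \<open>Writing a for the transform, a (z + 1) / 2 = z - 1 rearranges to (1 - a/2) z = 1 + a/2.
  Since a is strictly upper triangular, 1 - a/2 is unitriangular and z is determined by a.\<close>

lemma cayley_inj:
  fixes m :: nat
  assumes two: "(2 :: 'a::{field,finite}) \<noteq> 0"
  shows "inj_on (cayley m) (unitri m :: 'a mat set)"
proof (rule inj_onI)
  fix z z' :: "'a mat" assume z: "z \<in> unitri m" and z': "z' \<in> unitri m" and eq: "cayley m z = cayley m z'"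
  define k where "k = 1\<^sub>m m - (1 / 2) \<cdot>\<^sub>m cayley m z"
  have key: "k * y = 1\<^sub>m m + (1 / 2) \<cdot>\<^sub>m cayley m z" if y: "y \<in> unitri m" and e: "cayley m y = cayley m z" for y
  proof -
    note c = unitri_carrier[OF y] cayley_carrier[OF two y, unfolded e]
    have "cayley m z * half_sum m y = y - 1\<^sub>m m"
      using cayley_half_sum[OF two y] by (simp add: e)
    then have h: "(1 / 2) \<cdot>\<^sub>m (cayley m z * y) + (1 / 2) \<cdot>\<^sub>m cayley m z = y - 1\<^sub>m m"
      using c unfolding half_sum_def
      by (simp add: mult_smult_distrib[of _ m m _ m] mult_add_distrib_mat[of _ m m _ m] add_smult_distrib_left_mat[of _ m m])
    have ent: "1 / 2 * (cayley m z * y) $$ (i, j) + 1 / 2 * cayley m z $$ (i, j) = y $$ (i, j) - 1\<^sub>m m $$ (i, j)"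
      if "i < m" "j < m" for i j
      using that c arg_cong[OF h, of "\<lambda>X. X $$ (i, j)"] by (simp del: index_mult_mat(1))
    have "k * y = y - (1 / 2) \<cdot>\<^sub>m (cayley m z * y)"
      using c unfolding k_def
      by (simp add: minus_mult_distrib_mat[of _ m m _ _ m] mult_smult_assoc_mat[of _ m m _ m])
    also have "\<dots> = 1\<^sub>m m + (1 / 2) \<cdot>\<^sub>m cayley m z"
    proof (rule eq_matI)
      fix i j assume "i < dim_row (1\<^sub>m m + (1 / 2) \<cdot>\<^sub>m cayley m z)" "j < dim_col (1\<^sub>m m + (1 / 2) \<cdot>\<^sub>m cayley m z)"
      then have ij: "i < m" "j < m" using c by auto
      show "(y - (1 / 2) \<cdot>\<^sub>m (cayley m z * y)) $$ (i, j) = (1\<^sub>m m + (1 / 2) \<cdot>\<^sub>m cayley m z) $$ (i, j)"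
        using ent[OF ij] ij c by (simp add: algebra_simps del: index_mult_mat(1))
    qed (use c in auto)
    finally show ?thesis .
  qed
  have "k \<in> unitri m"
    using cayley_carrier[OF two z] cayley_strict_upper[OF two z] by (auto simp: unitri_iff k_def)
  moreover have "k * z = k * z'" using key[OF z refl] key[OF z' eq[symmetric]] by simp
  ultimately show "z = z'"
    using unitri_left_cancel[of k m z m z'] unitri_carrier[OF z] unitri_carrier[OF z'] by simp
qed

lemma form_sign_square [simp]: "form_sign ty * form_sign ty = (1 :: 'a::field)"
  by (simp add: form_sign_def)

text \<open>With h = (z + 1) / 2, invariance of the form gives h (a \<Omega>) h^T = (z \<Omega> -
  \<Omega> z^T) / 2, whose symmetry is visible from the transpose of \<Omega>. Congruence by the
  inverse of h carries the symmetry over to a \<Omega>.\<close>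

lemma isometry_cayley_staircase:
  fixes z :: "'a::{field,finite} mat"
  assumes two: "(2 :: 'a) \<noteq> 0" and z: "z \<in> isometries ty n"
  shows "cayley (msize ty n) z * form_matrix ty n \<in> staircase (form_sign ty) (msize ty n)"
proof -
  let ?m = "msize ty n" and ?\<Omega> = "form_matrix ty n :: 'a mat" and ?\<epsilon> = "form_sign ty :: 'a"
  have zu: "z \<in> unitri ?m" and iso: "z * ?\<Omega> * z\<^sup>T = ?\<Omega>" using z by (auto simp: isometries_def)
  note zc = unitri_carrier[OF zu] and Oc = form_matrix_carrier[of ty n, where 'a = 'a]
  let ?h = "half_sum ?m z" and ?a = "cayley ?m z"
  note hu = half_sum_unitri[OF two zu]
  note hc = unitri_carrier[OF hu] and kc = unitri_carrier[OF uinv(1)[OF hu]] and ac = cayley_carrier[OF two zu]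
  define T where "T = (1 / 2) \<cdot>\<^sub>m (z * ?\<Omega> - ?\<Omega> * z\<^sup>T)"
  have hT: "?h\<^sup>T = (1 / 2) \<cdot>\<^sub>m (z\<^sup>T + 1\<^sub>m ?m)"
    using zc by (intro eq_matI) (auto simp: half_sum_def)
  have c: "z * ?\<Omega> \<in> carrier_mat ?m ?m" "?\<Omega> * z\<^sup>T \<in> carrier_mat ?m ?m" using zc Oc by auto
  have "?h * (?a * ?\<Omega>) * ?h\<^sup>T = (z - 1\<^sub>m ?m) * ?\<Omega> * ?h\<^sup>T"
    unfolding half_sum_cayley[OF two zu, symmetric] using assoc_mult_mat[OF hc ac Oc] by simp
  also have "\<dots> = (1 / 2) \<cdot>\<^sub>m ((z * ?\<Omega> - ?\<Omega>) * (z\<^sup>T + 1\<^sub>m ?m))"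
  proof -
    have "(z - 1\<^sub>m ?m) * ?\<Omega> = z * ?\<Omega> - ?\<Omega>"
      using zc Oc by (simp add: minus_mult_distrib_mat[of _ ?m ?m _ _ ?m] del: form_matrix_carrier)
    moreover have "z * ?\<Omega> - ?\<Omega> \<in> carrier_mat ?m ?m" "z\<^sup>T + 1\<^sub>m ?m \<in> carrier_mat ?m ?m"
      using Oc zc by (simp_all add: minus_carrier_mat)
    ultimately show ?thesis unfolding hT by (simp only: mult_smult_distrib)
  qed
  also have "(z * ?\<Omega> - ?\<Omega>) * (z\<^sup>T + 1\<^sub>m ?m) = z * ?\<Omega> * z\<^sup>T + z * ?\<Omega> - (?\<Omega> * z\<^sup>T + ?\<Omega>)"
    using zc Oc c by (simp add: minus_mult_distrib_mat[of _ ?m ?m _ _ ?m] mult_add_distrib_mat[of _ ?m ?m _ ?m] del: form_matrix_carrier)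
  also have "\<dots> = z * ?\<Omega> - ?\<Omega> * z\<^sup>T"
    unfolding iso using c Oc by (intro eq_matI) (auto simp del: index_mult_mat(1) form_matrix_carrier)
  finally have hS: "?h * (?a * ?\<Omega>) * ?h\<^sup>T = T" unfolding T_def .
  have t1: "(z * ?\<Omega>)\<^sup>T = - ?\<epsilon> \<cdot>\<^sub>m (?\<Omega> * z\<^sup>T)"
    unfolding transpose_mult[OF zc Oc] form_matrix_transpose using zc Oc
    by (simp add: mult_smult_assoc_mat[of _ ?m ?m _ ?m] del: form_matrix_carrier)
  have Tsym: "T \<in> eps_symmetric ?\<epsilon> ?m"
  proof (rule eps_symmetricI)
    show "T \<in> carrier_mat ?m ?m" unfolding T_def by (rule smult_carrier_mat[OF minus_carrier_mat[OF c(2)]])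
    fix a b assume ab: "a < ?m" "b < ?m"
    have e: "(z * ?\<Omega>) $$ (b, a) = - ?\<epsilon> * (?\<Omega> * z\<^sup>T) $$ (a, b)" if "a < ?m" "b < ?m" for a b
      using arg_cong[OF t1, of "\<lambda>X. X $$ (a, b)"] that zc by (simp del: index_mult_mat(1))
    have e2: "(?\<Omega> * z\<^sup>T) $$ (b, a) = - ?\<epsilon> * (z * ?\<Omega>) $$ (a, b)"
    proof -
      have "- ?\<epsilon> * (z * ?\<Omega>) $$ (a, b) = - ?\<epsilon> * (- ?\<epsilon> * (?\<Omega> * z\<^sup>T) $$ (b, a))"
        by (simp only: e[OF ab(2,1)])
      also have "\<dots> = (?\<epsilon> * ?\<epsilon>) * (?\<Omega> * z\<^sup>T) $$ (b, a)"
        by (simp only: mult.assoc minus_mult_left[symmetric] minus_mult_right[symmetric] minus_minus)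
      finally show ?thesis by simp
    qed
    show "T $$ (b, a) = ?\<epsilon> * T $$ (a, b)"
      using ab zc e[OF ab] e2 by (simp add: T_def algebra_simps del: index_mult_mat(1))
  qed
  have "?a * ?\<Omega> = uinv ?m ?h * T * (uinv ?m ?h)\<^sup>T"
    unfolding hS[symmetric] using ac Oc uinv(3)[OF hu]
    by (subst congruence_mult[OF kc hc, symmetric]) (simp_all del: form_matrix_carrier)
  then have sym: "?a * ?\<Omega> \<in> eps_symmetric ?\<epsilon> ?m"
    using congruence_eps_symmetric[OF kc Tsym] by simp
  show ?thesis
    unfolding staircase_def
  proof (intro CollectI conjI sym allI impI)
    fix a b assume ab: "a < ?m" "b < ?m" "?m \<le> Suc (a + b)"
    then have "?m - Suc b \<le> a" by simp
    then have "?a $$ (a, ?m - Suc b) = 0" by (rule cayley_strict_upper[OF two zu ab(1)])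
    then show "(?a * ?\<Omega>) $$ (a, b) = 0"
      unfolding mult_form_matrix_index[OF ac ab(1,2)] by simp
  qed
qed

subsection \<open>The parametrisation by the span of the root vectors\<close>

text \<open>Since \<Omega> transposed is minus \<open>form_sign\<close> times \<Omega>, the symmetry
  condition is a \<Omega> + \<Omega> a^T = 0, the equation of the Lie algebra; the staircase
  condition adds strict upper triangularity.\<close>

definition lie_matrices :: "gtype \<Rightarrow> nat \<Rightarrow> 'a::field mat set" where
  "lie_matrices ty n = {a \<in> carrier_mat (msize ty n) (msize ty n).
     a * form_matrix ty n \<in> staircase (form_sign ty) (msize ty n)}"

lemma lie_strict_upper:
  assumes a: "a \<in> lie_matrices ty n" and ij: "i < msize ty n" "j \<le> i"
  shows "a $$ (i, j) = 0"
proof -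
  let ?m = "msize ty n"
  have ac: "a \<in> carrier_mat ?m ?m" and S: "a * form_matrix ty n \<in> staircase (form_sign ty) ?m"
    using a by (auto simp: lie_matrices_def)
  have "(a * form_matrix ty n) $$ (i, ?m - Suc j) = 0"
    by (rule staircase_zero[OF S]) (use ij in auto)
  then show ?thesis using mult_form_matrix_index[OF ac ij(1), of "?m - Suc j"] ij by simp
qed

lemma lie_dual:
  fixes a :: "'a::field mat"
  assumes a: "a \<in> lie_matrices ty n" and ij: "i < msize ty n" "j < msize ty n"
  shows "a $$ (msize ty n - Suc j, msize ty n - Suc i) =
    form_sign ty * column_sign ty n i * column_sign ty n (msize ty n - Suc j) * a $$ (i, j)"
proof -
  let ?m = "msize ty n" and ?s = "column_sign ty n :: nat \<Rightarrow> 'a"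
  let ?c = "?m - Suc j"
  have ac: "a \<in> carrier_mat ?m ?m" and S: "a * form_matrix ty n \<in> staircase (form_sign ty) ?m"
    using a by (auto simp: lie_matrices_def)
  have c: "?c < ?m" "?m - Suc ?c = j" using ij by auto
  have "(a * form_matrix ty n) $$ (?c, i) = form_sign ty * (a * form_matrix ty n) $$ (i, ?c)"
    by (rule eps_symmetricD[OF staircase_eps[OF S] ij(1) c(1)])
  then have "a $$ (?c, ?m - Suc i) * ?s i = form_sign ty * (a $$ (i, j) * ?s ?c)"
    unfolding mult_form_matrix_index[OF ac c(1) ij(1)] mult_form_matrix_index[OF ac ij(1) c(1)] c(2) .
  then have "a $$ (?c, ?m - Suc i) * (?s i * ?s i) = form_sign ty * (a $$ (i, j) * ?s ?c) * ?s i"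
    by (simp only: mult.assoc[symmetric])
  then show ?thesis by (simp add: mult_ac)
qed

text \<open>Without a middle block \<open>v\<close> has no columns and the correction term is zero,
  so one formula serves all types.\<close>

lemma a_mat_U_mat:
  fixes x :: "'a::{field,finite} mat"
  assumes d: "(x, v, w) \<in> U_data ty n"
  shows "a_mat ty n (U_mat ty n (x, v, w)) =
    block3 (x - 1\<^sub>m n) v (w + (1 / 2) \<cdot>\<^sub>m (v * v\<^sup>T * antidiag n)) (0\<^sub>m (mid ty) (mid ty))
      (- (v\<^sup>T * antidiag n)) (- (antidiag n * (x - 1\<^sub>m n)\<^sup>T * antidiag n))"
proof -
  have v: "v \<in> carrier_mat n (mid ty)" and w: "w \<in> carrier_mat n n" using U_data_carrier[OF d] by auto
  have "w = w + (1 / 2) \<cdot>\<^sub>m (v * v\<^sup>T * antidiag n)" if "ty \<noteq> OddOrth"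
  proof -
    have r: "mid ty = 0" using that by (simp add: mid_def)
    have "v * v\<^sup>T = 0\<^sub>m n n" using v unfolding r by (intro eq_matI) (auto simp: scalar_prod_def)
    then show ?thesis using w by simp
  qed
  then show ?thesis
    unfolding a_mat_def the_inv_into_f_f[OF U_mat_inj d] by (simp add: Let_def)
qed

text \<open>The three upper blocks of \<open>a\<close> supply \<open>x\<close>, \<open>v\<close> and
  \<open>w\<close>; the lower blocks are then forced by the reflection symmetry
  \<open>lie_dual\<close>. Only this inclusion is computed directly: injectivity of
  \<open>a_mat\<close> comes later from counting.\<close>

lemma lie_matrices_in_a_mat_image:
  fixes a :: "'a::{field,finite} mat"
  assumes two: "(2 :: 'a) \<noteq> 0" and a: "a \<in> lie_matrices ty n"
  shows "a \<in> a_mat ty n ` U_set ty n"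
proof -
  let ?m = "msize ty n" and ?r = "mid ty" and ?\<epsilon> = "form_sign ty :: 'a"
  have ac: "a \<in> carrier_mat ?m ?m" using a by (simp add: lie_matrices_def)
  define A where "A = mat n n (\<lambda>(i, j). a $$ (i, j))"
  define B where "B = mat n ?r (\<lambda>(i, j). a $$ (i, n + j))"
  define C where "C = mat n n (\<lambda>(i, j). a $$ (i, n + ?r + j))"
  define x where "x = 1\<^sub>m n + A"
  \<comment> \<open>The correction spreads the right-hand side of the relation for \<open>w\<close>
    evenly over two mirror entries, hence the factor one half.\<close>
  define w where "w = C - (1 / 2) \<cdot>\<^sub>m (B * B\<^sup>T * antidiag n)"
  have c: "A \<in> carrier_mat n n" "B \<in> carrier_mat n ?r" "C \<in> carrier_mat n n"
    by (simp_all add: A_def B_def C_def)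
  have BBJ: "B * B\<^sup>T * antidiag n \<in> carrier_mat n n"
    by (rule mult_carrier_mat[OF mult_carrier_mat[OF c(2) transpose_carrier_mat[THEN iffD2, OF c(2)]] antidiag_carrier])
  have BBJi: "(B * B\<^sup>T * antidiag n) $$ (i, j) = (\<Sum>k<?r. B $$ (i, k) * B $$ (n - Suc j, k))"
    if "i < n" "j < n" for i j
    using that c by (subst mult_antidiag_index[of _ n])
      (auto intro!: sum.cong simp: index_mult_mat_sum[of B n ?r "B\<^sup>T" n] simp del: index_mult_mat(1))
  have x: "x \<in> unitri n"
    using c lie_strict_upper[OF a] by (auto simp: unitri_iff x_def A_def msize_eq)
  have wi: "w $$ (i, j) = a $$ (i, n + ?r + j) - 1 / 2 * (\<Sum>k<?r. B $$ (i, k) * B $$ (n - Suc j, k))"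
    if "i < n" "j < n" for i j
    using that c BBJ BBJi[OF that] unfolding w_def by (simp add: C_def del: index_mult_mat(1))
  have d: "(x, B, w) \<in> U_data ty n"
    unfolding U_data_iff
  proof (intro conjI allI impI x c(2))
    show "w \<in> carrier_mat n n"
      unfolding w_def by (rule minus_carrier_mat[OF smult_carrier_mat[OF BBJ]])
    fix i j assume ij: "i < n" "j < n"
    define ri rj where "ri = n - Suc i" and "rj = n - Suc j"
    have rr: "ri < n" "rj < n" "n - Suc ri = i" "n - Suc rj = j" using ij by (auto simp: ri_def rj_def)
    have "?m - Suc (n + ?r + rj) = j" "?m - Suc i = n + ?r + ri"
      using ij by (auto simp: msize_eq ri_def rj_def)
    moreover have "column_sign ty n j = (- ?\<epsilon>)" "column_sign ty n i = (- ?\<epsilon>)"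
      using ij by (auto simp: column_sign_def form_sign_def)
    moreover have "n + ?r + rj < ?m" "i < ?m" using rr ij by (auto simp: msize_eq)
    ultimately have dual: "a $$ (j, n + ?r + ri) = ?\<epsilon> * a $$ (i, n + ?r + rj)"
      using lie_dual[OF a, of i "n + ?r + rj"] by simp
    define s where "s = (\<Sum>k<?r. B $$ (i, k) * B $$ (j, k))"
    have s2: "(\<Sum>k<?r. B $$ (j, k) * B $$ (i, k)) = s" unfolding s_def by (simp add: mult.commute)
    have es: "- (1 / 2) * s + ?\<epsilon> * (1 / 2 * s) = - s"
    proof (cases "ty = Symplectic")
      case True
      then have "s = 0" by (simp add: s_def mid_def)
      then show ?thesis by simp
    next
      case False
      then show ?thesis using two by (simp add: form_sign_def field_simps)
    qed
    have w1: "w $$ (j, ri) = a $$ (j, n + ?r + ri) - 1 / 2 * s"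
      using wi[OF ij(2) rr(1)] by (simp add: rr s2)
    have w2: "w $$ (i, rj) = a $$ (i, n + ?r + rj) - 1 / 2 * s"
      using wi[OF ij(1) rr(2)] by (simp add: rr s_def)
    have "w $$ (j, ri) - ?\<epsilon> * w $$ (i, rj) = - (1 / 2) * s + ?\<epsilon> * (1 / 2 * s)"
      unfolding w1 w2 dual by (simp only: right_diff_distrib) simp
    then show "w $$ (j, n - Suc i) - ?\<epsilon> * w $$ (i, n - Suc j) = - (\<Sum>k<?r. B $$ (i, k) * B $$ (j, k))"
      unfolding es s_def[symmetric] ri_def rj_def .
  qed
  have w': "w + (1 / 2) \<cdot>\<^sub>m (B * B\<^sup>T * antidiag n) = C"
    using c BBJ unfolding w_def by (intro eq_matI) (auto simp del: index_mult_mat(1))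
  have x': "x - 1\<^sub>m n = A" using c unfolding x_def by (intro eq_matI) auto
  have AT: "antidiag n * A\<^sup>T * antidiag n \<in> carrier_mat n n" using c by (intro mult_carrier_mat[of _ n n]) auto
  have BT: "B\<^sup>T * antidiag n \<in> carrier_mat ?r n" using c by (intro mult_carrier_mat[of _ _ n]) auto
  have bc: "0\<^sub>m ?r ?r \<in> carrier_mat ?r ?r" "- (B\<^sup>T * antidiag n) \<in> carrier_mat ?r n"
    "- (antidiag n * A\<^sup>T * antidiag n) \<in> carrier_mat n n"
    using AT BT by auto
  note ix = block3_index[OF c(1-3) bc]
  have Ai: "A $$ (i, j) = a $$ (i, j)" and Ci: "C $$ (i, j) = a $$ (i, n + ?r + j)" if "i < n" "j < n" for i j
    using that by (simp_all add: A_def C_def)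
  have Bi: "B $$ (i, j) = a $$ (i, n + j)" if "i < n" "j < ?r" for i j
    using that by (simp add: B_def)
  have "block3 A B C (0\<^sub>m ?r ?r) (- (B\<^sup>T * antidiag n)) (- (antidiag n * A\<^sup>T * antidiag n)) = a"
  proof (rule block3_eqI[OF block3_carrier[OF c(1-3) bc]])
    show "a \<in> carrier_mat (n + ?r + n) (n + ?r + n)" using ac by (simp add: msize_eq)
    fix i j
    let ?X = "block3 A B C (0\<^sub>m ?r ?r) (- (B\<^sup>T * antidiag n)) (- (antidiag n * A\<^sup>T * antidiag n))"
    show "?X $$ (i, j) = a $$ (i, j)" if "i < n" "j < n" using that by (simp add: ix Ai)
    show "?X $$ (i, n + j) = a $$ (i, n + j)" if "i < n" "j < ?r" using that by (simp add: ix Bi)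
    show "?X $$ (i, n + ?r + j) = a $$ (i, n + ?r + j)" if "i < n" "j < n" using that by (simp add: ix Ci)
    show "?X $$ (n + i, j) = a $$ (n + i, j)" if "i < ?r" "j < n"
      using that lie_strict_upper[OF a, of "n + i" j] by (simp add: ix msize_eq)
    show "?X $$ (n + i, n + j) = a $$ (n + i, n + j)" if "i < ?r" "j < ?r"
      using that lie_strict_upper[OF a, of "n + i" "n + j"] mid_le[of ty] by (simp add: ix msize_eq)
    show "?X $$ (n + ?r + i, j) = a $$ (n + ?r + i, j)" if "i < n" "j < n"
      using that lie_strict_upper[OF a, of "n + ?r + i" j] by (simp add: ix msize_eq)
    show "?X $$ (n + ?r + i, n + j) = a $$ (n + ?r + i, n + j)" if "i < n" "j < ?r"
      using that lie_strict_upper[OF a, of "n + ?r + i" "n + j"] by (simp add: ix msize_eq)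
    show "?X $$ (n + i, n + ?r + j) = a $$ (n + i, n + ?r + j)" if ij: "i < ?r" "j < n"
    proof -
      have "?m - Suc (n + i) = n + i" "?m - Suc (n - Suc j) = n + ?r + j"
        using ij mid_le[of ty] by (auto simp: msize_eq)
      moreover have "column_sign ty n (n - Suc j) = - ?\<epsilon>" "column_sign ty n (n + i) = (1 :: 'a)"
        using ij by (auto simp: column_sign_def form_sign_def)
      moreover have "n - Suc j < ?m" "n + i < ?m" using ij by (auto simp: msize_eq)
      ultimately have "a $$ (n + i, n + ?r + j) = - a $$ (n - Suc j, n + i)"
        using lie_dual[OF a, of "n - Suc j" "n + i"] by simp
      then show ?thesis
        using ij BT c by (simp add: ix transpose_antidiag_index[OF c(2)] Bi del: index_mult_mat(1))
    qed
    show "?X $$ (n + ?r + i, n + ?r + j) = a $$ (n + ?r + i, n + ?r + j)" if ij: "i < n" "j < n"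
    proof -
      have "?m - Suc (n - Suc i) = n + ?r + i" "?m - Suc (n - Suc j) = n + ?r + j"
        using ij by (auto simp: msize_eq)
      moreover have "column_sign ty n (n - Suc j) = - ?\<epsilon>" "column_sign ty n (n + ?r + i) = (1 :: 'a)"
        using ij by (auto simp: column_sign_def form_sign_def)
      moreover have "n - Suc j < ?m" "n - Suc i < ?m" using ij by (auto simp: msize_eq)
      ultimately have "a $$ (n + ?r + i, n + ?r + j) = - a $$ (n - Suc j, n - Suc i)"
        using lie_dual[OF a, of "n - Suc j" "n - Suc i"] by simp
      then show ?thesis
        using ij AT c by (simp add: ix antidual_index[OF c(1)] Ai del: index_mult_mat(1))
    qed
  qed
  then have "a_mat ty n (U_mat ty n (x, B, w)) = a"
    unfolding a_mat_U_mat[OF d] w' x' .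
  then show ?thesis using d unfolding U_set_def by blast
qed

section \<open>Cardinalities of the group, the isometries and the staircase matrices\<close>

lemma finite_isometries [simp]: "finite (isometries ty n :: 'a::{field,finite} mat set)"
  by (simp add: isometries_def)

lemma U_set_subset_isometries: "(U_set ty n :: 'a::{field,finite} mat set) \<subseteq> isometries ty n"
  unfolding U_set_def by (auto simp: U_mat_isometry)

lemma finite_U_set [simp]: "finite (U_set ty n :: 'a::{field,finite} mat set)"
  by (rule finite_subset[OF U_set_subset_isometries finite_isometries])

lemma mult_form_matrix_inj:
  "inj_on (\<lambda>a. a * form_matrix ty n) (carrier_mat (msize ty n) (msize ty n) :: 'a::field mat set)"
proof (rule inj_on_inverseI[where g = "\<lambda>S. S * (form_matrix ty n)\<^sup>T"])
  fix a :: "'a mat" assume a: "a \<in> carrier_mat (msize ty n) (msize ty n)"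
  note Oc = form_matrix_carrier[of ty n, where 'a = 'a]
  show "a * form_matrix ty n * (form_matrix ty n)\<^sup>T = a"
    using a Oc assoc_mult_mat[OF a Oc transpose_carrier_mat[THEN iffD2, OF Oc]] by (simp add: form_matrix_inverse)
qed

definition staircase_coord :: "gtype \<Rightarrow> nat \<Rightarrow> 'a::{field,finite} mat \<Rightarrow> 'a mat" where
  "staircase_coord ty n z = cayley (msize ty n) z * form_matrix ty n"

text \<open>A chain of cardinalities closes up: \<open>lie_matrices\<close> \<le> image of
  \<open>a_mat\<close> \<le> \<open>U_set\<close> \<le> \<open>isometries\<close> \<le>
  \<open>staircase\<close>, and the last has the size of the first. Equality throughout gives the
  three claims at once, in particular surjectivity of the Cayley coordinate without an inverse
  formula.\<close>

lemma
  fixes n :: nat and ty :: gtype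
  assumes two: "(2 :: 'a::{field,finite}) \<noteq> 0"
  shows U_set_eq: "(U_set ty n :: 'a mat set) = isometries ty n"
    and staircase_coord_bij:
      "bij_betw (staircase_coord ty n) (U_set ty n) (staircase (form_sign ty) (msize ty n) :: 'a mat set)"
    and a_mat_inj: "inj_on (a_mat ty n) (U_set ty n :: 'a mat set)"
proof -
  let ?m = "msize ty n" and ?S = "staircase (form_sign ty) (msize ty n) :: 'a mat set"
  let ?U = "U_set ty n :: 'a mat set" and ?I = "isometries ty n :: 'a mat set" and ?L = "lie_matrices ty n :: 'a mat set"
  have "bij_betw (\<lambda>a. a * form_matrix ty n) ?L ?S"
  proof (rule bij_betw_imageI)
    show "inj_on (\<lambda>a. a * form_matrix ty n) ?L"
      by (rule inj_on_subset[OF mult_form_matrix_inj]) (auto simp: lie_matrices_def)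
    show "(\<lambda>a. a * form_matrix ty n) ` ?L = ?S"
    proof (intro equalityI subsetI)
      fix S assume S: "S \<in> ?S"
      note Oc = form_matrix_carrier[of ty n, where 'a = 'a] and Sc = staircase_carrier[OF S]
      have e: "S * (form_matrix ty n)\<^sup>T * form_matrix ty n = S"
        using Oc Sc assoc_mult_mat[OF Sc transpose_carrier_mat[THEN iffD2, OF Oc] Oc] by (simp add: form_matrix_inverse)
      moreover from e have "S * (form_matrix ty n)\<^sup>T \<in> ?L"
        unfolding lie_matrices_def using Sc Oc by (intro CollectI conjI) (simp, subst e, rule S)
      ultimately show "S \<in> (\<lambda>a. a * form_matrix ty n) ` ?L" by (metis image_eqI)
    qed (auto simp: lie_matrices_def)
  qed
  then have LS: "card ?L = card ?S" by (rule bij_betw_same_card)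
  have injI: "inj_on (staircase_coord ty n) ?I"
  proof (rule inj_onI)
    fix z z' assume z: "z \<in> ?I" "z' \<in> ?I" and eq: "staircase_coord ty n z = staircase_coord ty n z'"
    have u: "z \<in> unitri ?m" "z' \<in> unitri ?m" using z by (auto simp: isometries_def)
    have "cayley ?m z = cayley ?m z'"
      by (rule inj_onD[OF mult_form_matrix_inj eq[unfolded staircase_coord_def]])
        (use u cayley_carrier[OF two] in auto)
    then show "z = z'" using inj_onD[OF cayley_inj[OF two] _ u] by blast
  qed
  have imI: "staircase_coord ty n ` ?I \<subseteq> ?S"
    using isometry_cayley_staircase[OF two] by (auto simp: staircase_coord_def)
  have IS: "card ?I \<le> card ?S" by (rule card_inj_on_le[OF injI imI finite_staircase])
  have UI: "card ?U \<le> card ?I" by (rule card_mono[OF finite_isometries U_set_subset_isometries])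
  have LU: "?L \<subseteq> a_mat ty n ` ?U" using lie_matrices_in_a_mat_image[OF two] by blast
  have "card ?L \<le> card (a_mat ty n ` ?U)" by (rule card_mono[OF _ LU]) simp
  moreover have "card (a_mat ty n ` ?U) \<le> card ?U" by (rule card_image_le) simp
  ultimately have cards: "card ?U = card ?S" "card ?I = card ?S" "card (a_mat ty n ` ?U) = card ?U"
    using IS UI LS by linarith+
  show eq: "?U = ?I"
    by (rule card_subset_eq[OF finite_isometries U_set_subset_isometries]) (simp add: cards)
  show "inj_on (a_mat ty n) ?U" by (rule eq_card_imp_inj_on[OF finite_U_set cards(3)])
  have "staircase_coord ty n ` ?I = ?S"
    by (rule card_subset_eq[OF finite_staircase imI]) (simp add: card_image[OF injI] cards)
  then show "bij_betw (staircase_coord ty n) ?U ?S" unfolding eq using injI by (rule bij_betw_imageI[rotated])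
qed

subsection \<open>The group structure\<close>

lemma isometries_unitri: "z \<in> isometries ty n \<Longrightarrow> z \<in> unitri (msize ty n)"
  by (simp add: isometries_def)

lemma isometries_one: "1\<^sub>m (msize ty n) \<in> isometries ty n"
  by (simp add: isometries_def)

lemma isometries_mult:
  fixes y z :: "'a::{field,finite} mat"
  assumes "y \<in> isometries ty n" "z \<in> isometries ty n"
  shows "y * z \<in> isometries ty n"
proof -
  have u: "y \<in> unitri (msize ty n)" "z \<in> unitri (msize ty n)" using assms by (auto simp: isometries_unitri)
  show ?thesis
    using assms mult_unitri[OF u]
      congruence_mult[OF unitri_carrier[OF u(1)] unitri_carrier[OF u(2)] form_matrix_carrier[of ty n]]
    by (simp add: isometries_def)
qed

lemma isometries_uinv:
  fixes z :: "'a::{field,finite} mat"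
  assumes z: "z \<in> isometries ty n"
  shows "uinv (msize ty n) z \<in> isometries ty n"
proof -
  let ?m = "msize ty n" and ?\<Omega> = "form_matrix ty n :: 'a mat"
  have u: "z \<in> unitri ?m" and iso: "z * ?\<Omega> * z\<^sup>T = ?\<Omega>" using z by (auto simp: isometries_def)
  have "uinv ?m z * ?\<Omega> * (uinv ?m z)\<^sup>T = uinv ?m z * (z * ?\<Omega> * z\<^sup>T) * (uinv ?m z)\<^sup>T" by (simp only: iso)
  also have "\<dots> = (uinv ?m z * z) * ?\<Omega> * (uinv ?m z * z)\<^sup>T"
    by (rule congruence_mult[OF unitri_carrier[OF uinv(1)[OF u]] unitri_carrier[OF u] form_matrix_carrier, symmetric])
  also have "\<dots> = ?\<Omega>" unfolding uinv(3)[OF u] by simp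
  finally show ?thesis using uinv(1)[OF u] by (simp add: isometries_def)
qed

lemma uinv_form:
  fixes z :: "'a::{field,finite} mat"
  assumes z: "z \<in> isometries ty n"
  shows "uinv (msize ty n) z * form_matrix ty n = form_matrix ty n * z\<^sup>T"
proof -
  let ?m = "msize ty n" and ?\<Omega> = "form_matrix ty n :: 'a mat"
  have u: "z \<in> unitri ?m" and iso: "z * ?\<Omega> * z\<^sup>T = ?\<Omega>" using z by (auto simp: isometries_def)
  note c = unitri_carrier[OF u] unitri_carrier[OF uinv(1)[OF u]] form_matrix_carrier[of ty n, where 'a = 'a]
  have zT: "z\<^sup>T \<in> carrier_mat ?m ?m" using c(1) by simp
  have "uinv ?m z * ?\<Omega> = uinv ?m z * (z * ?\<Omega> * z\<^sup>T)" by (simp only: iso)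
  also have "\<dots> = (uinv ?m z * z) * (?\<Omega> * z\<^sup>T)"
    unfolding assoc_mult_mat[OF c(1,3) zT] assoc_mult_mat[OF c(2,1) mult_carrier_mat[OF c(3) zT]] ..
  finally show ?thesis
    unfolding uinv(3)[OF u] left_mult_one_mat[OF mult_carrier_mat[OF c(3) zT]] .
qed

text \<open>The Cayley transform commutes with conjugation, and \<open>uinv_form\<close> moves the
  inverse of \<open>y\<close> across \<Omega>, where it becomes the transpose of
  \<open>y\<close>.\<close>

lemma staircase_coord_conjugate:
  fixes y z :: "'a::{field,finite} mat"
  assumes two: "(2 :: 'a) \<noteq> 0" and y: "y \<in> isometries ty n" and z: "z \<in> isometries ty n"
  shows "staircase_coord ty n (y * z * uinv (msize ty n) y) = y * staircase_coord ty n z * y\<^sup>T"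
proof -
  let ?m = "msize ty n" and ?\<Omega> = "form_matrix ty n :: 'a mat"
  have u: "y \<in> unitri ?m" "z \<in> unitri ?m" using y z by (auto simp: isometries_unitri)
  note c = unitri_carrier[OF u(1)] cayley_carrier[OF two u(2)] unitri_carrier[OF uinv(1)[OF u(1)]]
    form_matrix_carrier[of ty n, where 'a = 'a]
  have yT: "y\<^sup>T \<in> carrier_mat ?m ?m" using c(1) by simp
  show ?thesis
    unfolding staircase_coord_def cayley_conjugate[OF two u(2,1)]
      assoc_mult_mat[OF mult_carrier_mat[OF c(1,2)] c(3,4)] uinv_form[OF y]
      assoc_mult_mat[OF mult_carrier_mat[OF c(1,2)] c(4) yT, symmetric] assoc_mult_mat[OF c(1,2,4)] ..
qed

lemma U_group_simps [simp]:
  "carrier (U_group ty n) = U_set ty n" "x \<otimes>\<^bsub>U_group ty n\<^esub> y = x * y"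
  "\<one>\<^bsub>U_group ty n\<^esub> = 1\<^sub>m (msize ty n)"
  by (simp_all add: U_group_def)

lemma inv_U_group:
  assumes two: "(2 :: 'a::{field,finite}) \<noteq> 0" and z: "z \<in> (U_set ty n :: 'a mat set)"
  shows "inv\<^bsub>U_group ty n\<^esub> z = uinv (msize ty n) z"
proof -
  have "group (U_group ty n :: 'a mat monoid)"
  proof (rule groupI, unfold U_group_simps U_set_eq[OF two])
    fix x y z :: "'a mat" assume "x \<in> isometries ty n" "y \<in> isometries ty n" "z \<in> isometries ty n"
    then show "x * y * z = x * (y * z)"
      by (intro assoc_mult_mat[of _ "msize ty n" "msize ty n" _ "msize ty n" _ "msize ty n"] unitri_carrier isometries_unitri)
  next
    fix x :: "'a mat" assume x: "x \<in> isometries ty n"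
    then show "1\<^sub>m (msize ty n) * x = x" by (intro left_mult_one_mat[of _ "msize ty n" "msize ty n"] unitri_carrier isometries_unitri)
    show "\<exists>y\<in>isometries ty n. y * x = 1\<^sub>m (msize ty n)"
      using isometries_uinv[OF x] uinv(3)[OF isometries_unitri[OF x]] by blast
  qed (auto intro: isometries_mult isometries_one)
  then interpret group "U_group ty n :: 'a mat monoid" .
  have zi: "z \<in> isometries ty n" using z by (simp add: U_set_eq[OF two])
  show ?thesis
    by (rule inv_equality)
      (use z isometries_uinv[OF zi] uinv(3)[OF isometries_unitri[OF zi]] in \<open>auto simp: U_set_eq[OF two]\<close>)
qed

subsection \<open>Averaging over a complement\<close>

text \<open>In a finite group closure under products already yields a subgroup, so inverses in the
  polar groups never have to be computed.\<close>

lemma closed_imp_uinv_closed: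
  fixes P :: "'a::{field,finite} mat set"
  assumes sub: "P \<subseteq> unitri m" and one: "1\<^sub>m m \<in> P" and mult: "\<And>p q. p \<in> P \<Longrightarrow> q \<in> P \<Longrightarrow> p * q \<in> P"
    and p: "p \<in> P"
  shows "uinv m p \<in> P"
proof -
  have pu: "p \<in> unitri m" using p sub by blast
  have "inj_on ((*) p) P"
  proof (rule inj_onI)
    fix s t assume st: "s \<in> P" "t \<in> P" "p * s = p * t"
    show "s = t"
      by (rule unitri_left_cancel[OF pu unitri_carrier unitri_carrier st(3)]) (use st sub in auto)
  qed
  then have "(*) p ` P = P"
    using finite_subset[OF sub finite_unitri] mult[OF p] by (intro endo_inj_surj) auto
  then obtain q where q: "q \<in> P" "p * q = 1\<^sub>m m" using one by (metis image_iff)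
  have "q = uinv m p"
    by (rule unitri_left_cancel[OF pu unitri_carrier unitri_carrier])
      (use q sub uinv[OF pu] in auto)
  with q show ?thesis by simp
qed

text \<open>Every fibre of the product map is a copy of the intersection: from one factorisation
  \<open>p0 * y0\<close> the others arise as p0 t and t^{-1} y0 with t in both subgroups.\<close>

lemma sum_product_of_subgroups:
  fixes P Y :: "'a::{field,finite} mat set" and F :: "'a mat \<Rightarrow> complex"
  assumes P: "P \<subseteq> unitri m" "1\<^sub>m m \<in> P" "\<And>p q. p \<in> P \<Longrightarrow> q \<in> P \<Longrightarrow> p * q \<in> P"
    and Y: "Y \<subseteq> unitri m" "1\<^sub>m m \<in> Y" "\<And>p q. p \<in> Y \<Longrightarrow> q \<in> Y \<Longrightarrow> p * q \<in> Y"
    and gen: "\<And>g. g \<in> unitri m \<Longrightarrow> \<exists>p\<in>P. \<exists>y\<in>Y. g = p * y"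
  shows "(\<Sum>p\<in>P. \<Sum>y\<in>Y. F (p * y)) = of_nat (card (P \<inter> Y)) * (\<Sum>g\<in>unitri m. F g)"
proof -
  have fin: "finite P" "finite Y" using P(1) Y(1) finite_subset finite_unitri by blast+
  have fibre: "card {(p, y) \<in> P \<times> Y. p * y = g} = card (P \<inter> Y)" if g: "g \<in> unitri m" for g
  proof -
    obtain p0 y0 where py: "p0 \<in> P" "y0 \<in> Y" "g = p0 * y0" using gen[OF g] by blast
    have pu: "p0 \<in> unitri m" "y0 \<in> unitri m" using py P(1) Y(1) by auto
    note c0 = unitri_carrier[OF pu(1)] unitri_carrier[OF pu(2)]
    have cl: "uinv m p \<in> P" if "p \<in> P" for p
      using closed_imp_uinv_closed[OF P(1,2) _ that] P(3) by blast
    have clY: "uinv m y \<in> Y" if "y \<in> Y" for y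
      using closed_imp_uinv_closed[OF Y(1,2) _ that] Y(3) by blast
    have "bij_betw (\<lambda>t. (p0 * t, uinv m t * y0)) (P \<inter> Y) {(p, y) \<in> P \<times> Y. p * y = g}"
    proof (rule bij_betw_imageI)
      show "inj_on (\<lambda>t. (p0 * t, uinv m t * y0)) (P \<inter> Y)"
      proof (rule inj_onI)
        fix s t assume st: "s \<in> P \<inter> Y" "t \<in> P \<inter> Y" "(p0 * s, uinv m s * y0) = (p0 * t, uinv m t * y0)"
        then show "s = t"
          using P(1) unitri_left_cancel[OF pu(1), of s m t] unitri_carrier[of s m] unitri_carrier[of t m] by blast
      qed
      show "(\<lambda>t. (p0 * t, uinv m t * y0)) ` (P \<inter> Y) = {(p, y) \<in> P \<times> Y. p * y = g}"
      proof (intro equalityI subsetI)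
        fix w assume "w \<in> (\<lambda>t. (p0 * t, uinv m t * y0)) ` (P \<inter> Y)"
        then obtain t where t: "t \<in> P" "t \<in> Y" "w = (p0 * t, uinv m t * y0)" by auto
        have tu: "t \<in> unitri m" using t P(1) by blast
        note ct = unitri_carrier[OF tu] unitri_carrier[OF uinv(1)[OF tu]]
        have "p0 * t * (uinv m t * y0) = p0 * ((t * uinv m t) * y0)"
          using c0 ct by (simp add: assoc_mult_mat[of _ m m _ m _ m])
        then have "p0 * t * (uinv m t * y0) = g"
          unfolding uinv(2)[OF tu] left_mult_one_mat[OF c0(2)] py(3) .
        then show "w \<in> {(p, y) \<in> P \<times> Y. p * y = g}"
          using t py P(3) Y(3) clY by auto
      next
        fix w assume "w \<in> {(p, y) \<in> P \<times> Y. p * y = g}"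
        then obtain p y where w: "w = (p, y)" "p \<in> P" "y \<in> Y" "p * y = g" by auto
        have u: "p \<in> unitri m" "y \<in> unitri m" using w P(1) Y(1) by auto
        note cu = unitri_carrier[OF u(1)] unitri_carrier[OF u(2)] unitri_carrier[OF uinv(1)[OF u(2)]]
          unitri_carrier[OF uinv(1)[OF pu(1)]]
        define t where "t = uinv m p0 * p"
        have tP: "t \<in> P" using w py P(3) cl by (auto simp: t_def)
        have tu: "t \<in> unitri m" using tP P(1) by blast
        have pt: "p0 * t = p"
        proof -
          have "p0 * t = (p0 * uinv m p0) * p" unfolding t_def assoc_mult_mat[OF c0(1) cu(4,1)] ..
          then show ?thesis unfolding uinv(2)[OF pu(1)] left_mult_one_mat[OF cu(1)] .
        qed
        have ty: "t * y = y0"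
        proof (rule unitri_left_cancel[OF pu(1) _ c0(2)])
          show "t * y \<in> carrier_mat m m" using mult_carrier_mat[OF unitri_carrier[OF tu] cu(2)] .
          show "p0 * (t * y) = p0 * y0"
            unfolding assoc_mult_mat[OF c0(1) unitri_carrier[OF tu] cu(2), symmetric] pt w(4) py(3) ..
        qed
        have "t = y0 * uinv m y"
          unfolding ty[symmetric] assoc_mult_mat[OF unitri_carrier[OF tu] cu(2,3)] uinv(2)[OF u(2)]
          using unitri_carrier[OF tu] by simp
        then have tY: "t \<in> Y" using Y(3) py(2) clY[OF w(3)] by simp
        have "uinv m t * y0 = (uinv m t * t) * y"
          unfolding ty[symmetric] assoc_mult_mat[OF unitri_carrier[OF uinv(1)[OF tu]] unitri_carrier[OF tu] cu(2)] ..
        then have "uinv m t * y0 = y" unfolding uinv(3)[OF tu] left_mult_one_mat[OF cu(2)] .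
        then show "w \<in> (\<lambda>t. (p0 * t, uinv m t * y0)) ` (P \<inter> Y)"
          using w pt tP tY by (intro image_eqI[of _ _ t]) auto
      qed
    qed
    then show ?thesis by (rule bij_betw_same_card[symmetric])
  qed
  have "(\<Sum>p\<in>P. \<Sum>y\<in>Y. F (p * y)) = (\<Sum>(p, y)\<in>P \<times> Y. F (p * y))"
    by (rule sum.cartesian_product)
  also have "\<dots> = (\<Sum>g\<in>unitri m. \<Sum>w\<in>{w \<in> P \<times> Y. (\<lambda>(p, y). p * y) w = g}. (\<lambda>(p, y). F (p * y)) w)"
    by (rule sum.group[symmetric]) (use fin P(1) Y(1) in \<open>auto intro: mult_unitri\<close>)
  also have "\<dots> = (\<Sum>g\<in>unitri m. of_nat (card (P \<inter> Y)) * F g)"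
  proof (intro sum.cong refl)
    fix g :: "'a mat" assume g: "g \<in> unitri m"
    have "(\<Sum>w\<in>{w \<in> P \<times> Y. (\<lambda>(p, y). p * y) w = g}. (\<lambda>(p, y). F (p * y)) w) =
        (\<Sum>w\<in>{w \<in> P \<times> Y. (\<lambda>(p, y). p * y) w = g}. F g)"
      by (intro sum.cong refl) auto
    also have "\<dots> = of_nat (card {w \<in> P \<times> Y. (\<lambda>(p, y). p * y) w = g}) * F g" by simp
    also have "card {w \<in> P \<times> Y. (\<lambda>(p, y). p * y) w = g} = card (P \<inter> Y)"
      unfolding fibre[OF g, symmetric] by (rule arg_cong[of _ _ card]) auto
    finally show "(\<Sum>w\<in>{w \<in> P \<times> Y. (\<lambda>(p, y). p * y) w = g}. (\<lambda>(p, y). F (p * y)) w) =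
        of_nat (card (P \<inter> Y)) * F g" .
  qed
  finally show ?thesis by (simp add: sum_distrib_left)
qed

subsection \<open>Elementary characters as averages over all unitriangular matrices\<close>

text \<open>For a root at position \<open>(i, k)\<close>, \<open>polar_rows\<close> cuts $U_\alpha$ out of $U$ and the polar group out of
  all unitriangular matrices; \<open>polar_coords\<close> is the same condition in the coordinates \<open>S\<close>. The sum of
  the characters of $(p S p^T)_{i,k}$ over the polar group detects \<open>polar_coords\<close>, because the free
  entries of the rows \<open>i\<close> and \<open>k\<close> of \<open>p\<close> enter the exponent linearly.\<close>

definition polar_rows :: "gtype \<Rightarrow> nat \<Rightarrow> nat \<Rightarrow> nat \<Rightarrow> 'a::zero mat \<Rightarrow> bool" where
  "polar_rows ty n i k x \<longleftrightarrow>
     (\<forall>c. i < c \<and> c < n \<and> c < msize ty n - Suc k \<longrightarrow> x $$ (i, c) = 0) \<and>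
     (\<forall>c. k < c \<and> c < n + mid ty \<longrightarrow> x $$ (k, c) = 0)"

definition polar_group :: "gtype \<Rightarrow> nat \<Rightarrow> nat \<Rightarrow> nat \<Rightarrow> 'a::field mat set" where
  "polar_group ty n i k = {p \<in> unitri (msize ty n). polar_rows ty n i k p}"

definition polar_coords :: "gtype \<Rightarrow> nat \<Rightarrow> nat \<Rightarrow> nat \<Rightarrow> 'a::zero mat \<Rightarrow> bool" where
  "polar_coords ty n i k S \<longleftrightarrow>
     (\<forall>l. k < l \<and> l < msize ty n - Suc i \<and> n + mid ty \<le> l \<longrightarrow> S $$ (i, l) = 0) \<and>
     (\<forall>l. n \<le> l \<and> l < msize ty n - Suc k \<longrightarrow> S $$ (k, l) = 0)"

text \<open>The pair \<open>(i, k)\<close> is the position of a root in a staircase matrix: in the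
  upper half, strictly above the antidiagonal, and on the diagonal only for the roots 2\<epsilon>_i
  of the symplectic case.\<close>

context
  fixes ty :: gtype and n i k m :: nat
  assumes m_def: "m = msize ty n" and ik: "i \<le> k" "Suc (i + k) < m" and diag: "i = k \<Longrightarrow> ty = Symplectic"
begin

lemma polar_bounds: "i < n" "k < m" "i < m" "m = n + mid ty + n" "n + mid ty \<le> m"
  using ik mid_le[of ty] unfolding m_def msize_eq by auto

lemma one_polar_group: "1\<^sub>m m \<in> (polar_group ty n i k :: 'a::field mat set)"
  using polar_bounds unfolding polar_group_def polar_rows_def m_def[symmetric] by auto

text \<open>The prescribed zeros form a stretch of a row that starts right after the diagonal; such
  stretches survive products of upper triangular matrices.\<close>

lemma mult_polar_group:
  fixes p q :: "'a::field mat"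
  assumes p: "p \<in> polar_group ty n i k" and q: "q \<in> polar_group ty n i k"
  shows "p * q \<in> polar_group ty n i k"
proof -
  have pu: "p \<in> unitri m" "q \<in> unitri m" using p q by (auto simp: polar_group_def m_def)
  note c = unitri_carrier[OF pu(1)] unitri_carrier[OF pu(2)]
  have "(p * q) $$ (i, c) = 0" if cc: "i < c" "c < n" "c < m - Suc k" for c
  proof -
    have "p $$ (i, a) * q $$ (a, c) = 0" if "a < m" for a
    proof (cases "a = i")
      case True
      then show ?thesis using q cc by (simp add: polar_group_def polar_rows_def m_def)
    next
      case False
      consider "a < i" | "i < a" "a \<le> c" | "c < a" using False by linarith
      then show ?thesis
        by cases (use p cc that polar_bounds pu in \<open>auto simp: polar_group_def polar_rows_def m_def[symmetric] unitri_lower\<close>)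
    qed
    moreover have "c < m" using cc polar_bounds by simp
    ultimately show ?thesis using polar_bounds by (simp add: index_mult_mat_sum[OF c] sum.neutral del: mult_eq_0_iff)
  qed
  moreover have "(p * q) $$ (k, c) = 0" if cc: "k < c" "c < n + mid ty" for c
  proof -
    have "p $$ (k, a) * q $$ (a, c) = 0" if "a < m" for a
    proof (cases "a = k")
      case True
      then show ?thesis using q cc by (simp add: polar_group_def polar_rows_def m_def)
    next
      case False
      consider "a < k" | "k < a" "a \<le> c" | "c < a" using False by linarith
      then show ?thesis
        by cases (use p cc that polar_bounds pu in \<open>auto simp: polar_group_def polar_rows_def m_def[symmetric] unitri_lower\<close>)
    qed
    moreover have "c < m" using cc polar_bounds by simp
    ultimately show ?thesis using polar_bounds by (simp add: index_mult_mat_sum[OF c] sum.neutral del: mult_eq_0_iff)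
  qed
  ultimately show ?thesis
    using mult_unitri[OF pu] unfolding polar_group_def polar_rows_def m_def[symmetric] by blast
qed

text \<open>A further term with entry \<open>(a, l)\<close> of \<open>S\<close> would need
  \<open>a\<close> at least \<open>n\<close> or \<open>l\<close> at least \<open>n + mid ty\<close>,
  by the zeros of \<open>p\<close>. If both indices are moved, the entry lies below the
  antidiagonal; if only one is, \<open>polar_coords\<close> kills it.\<close>

lemma polar_group_value:
  fixes p S :: "'a::field mat"
  assumes p: "p \<in> polar_group ty n i k" and S: "S \<in> staircase \<epsilon> m" and cond: "polar_coords ty n i k S"
  shows "(p * S * p\<^sup>T) $$ (i, k) = S $$ (i, k)"
proof -
  have pu: "p \<in> unitri m" using p by (auto simp: polar_group_def m_def)
  note b = polar_bounds
  have trm: "p $$ (i, a) * S $$ (a, l) * p $$ (k, l) = (if l = k then if a = i then S $$ (i, k) else 0 else 0)"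
    if al: "a < m" "l < m" for a l
  proof (cases "a = i \<and> l = k")
    case True
    then show ?thesis using b pu by (simp add: unitri_diag)
  next
    case False
    have "p $$ (i, a) = 0 \<or> S $$ (a, l) = 0 \<or> p $$ (k, l) = 0"
    proof (rule ccontr)
      assume "\<not> ?thesis"
      then have nz: "p $$ (i, a) \<noteq> 0" "S $$ (a, l) \<noteq> 0" "p $$ (k, l) \<noteq> 0" by auto
      have ai: "i \<le> a" using nz(1) unitri_lower[OF pu, of a i] b by (cases "a < i") auto
      have lk: "k \<le> l" using nz(3) unitri_lower[OF pu, of l k] b by (cases "l < k") auto
      have st: "Suc (a + l) < m" using nz(2) staircase_zero[OF S al] by (cases "m \<le> Suc (a + l)") auto
      have A: "n \<le> a" if "a \<noteq> i"
      proof (rule ccontr)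
        assume "\<not> n \<le> a"
        then have "p $$ (i, a) = 0"
          using p ai that st lk unfolding polar_group_def polar_rows_def m_def[symmetric] by auto
        with nz show False by simp
      qed
      have L: "n + mid ty \<le> l" if "l \<noteq> k"
      proof (rule ccontr)
        assume "\<not> n + mid ty \<le> l"
        then have "p $$ (k, l) = 0"
          using p lk that unfolding polar_group_def polar_rows_def m_def[symmetric] by auto
        with nz show False by simp
      qed
      consider "a \<noteq> i" "l \<noteq> k" | "a = i" "l \<noteq> k" | "a \<noteq> i" "l = k" using False by blast
      then show False
      proof cases
        case 1
        then show False using A L st b by auto
      next
        case 2
        then have "S $$ (i, l) = 0"
          using cond L lk st unfolding polar_coords_def m_def[symmetric] by auto
        with nz 2 show False by simp
      next
        case 3
        then have "S $$ (k, a) = 0"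
          using cond A st unfolding polar_coords_def m_def[symmetric] by auto
        then have "S $$ (a, k) = 0" using eps_symmetricD[OF staircase_eps[OF S], of k a] al b by simp
        with nz 3 show False by simp
      qed
    qed
    then show ?thesis using False by auto
  qed
  have "(p * S * p\<^sup>T) $$ (i, k) = (\<Sum>a<m. \<Sum>l<m. if l = k then if a = i then S $$ (i, k) else 0 else 0)"
    unfolding congruence_index[OF unitri_carrier[OF pu] staircase_carrier[OF S] b(3,2)]
    by (intro sum.cong refl) (simp add: trm)
  then show ?thesis using b by simp
qed

text \<open>Adding \<open>t\<close> to the entry \<open>(r, b)\<close> permutes the polar group, and changes the exponent by a
  constant, so the character sum vanishes unless this constant is zero.\<close>

lemma polar_sum_shift:
  fixes S :: "'a::{field,finite} mat" and \<theta> :: "'a \<Rightarrow> complex"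
  assumes \<theta>: "nontrivial_additive_character \<theta>" and s: "s \<noteq> 0" and C: "C \<noteq> 0"
    and rb: "r < b" "b < m"
    and closed: "\<And>(p :: 'a mat) t. p \<in> polar_group ty n i k \<Longrightarrow>
      mat m m (\<lambda>(x, y). p $$ (x, y) + (if x = r \<and> y = b then t else 0)) \<in> polar_group ty n i k"
    and val: "\<And>(p :: 'a mat) t. p \<in> polar_group ty n i k \<Longrightarrow>
      V (mat m m (\<lambda>(x, y). p $$ (x, y) + (if x = r \<and> y = b then t else 0))) = V p + t * C"
  shows "(\<Sum>p\<in>(polar_group ty n i k :: 'a mat set). \<theta> (s * V p)) = 0"
proof -
  define f where "f t p = mat m m (\<lambda>(x, y). p $$ (x, y) + (if x = r \<and> y = b then t else 0))" for t and p :: "'a mat"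
  obtain a where a: "\<theta> a \<noteq> 1" using \<theta> by (auto simp: nontrivial_additive_character_def)
  \<comment> \<open>Chosen so that the shift multiplies every summand by \<open>\<theta> a\<close>,
    which is not 1.\<close>
  define t where "t = a / (s * C)"
  have pc: "p \<in> carrier_mat m m" if "p \<in> polar_group ty n i k" for p :: "'a mat"
    using that by (auto simp: polar_group_def m_def unitri_carrier)
  have inv: "f u (f v p) = p" if "p \<in> polar_group ty n i k" "u + v = 0" for u v p
  proof (rule eq_matI)
    fix x y assume "x < dim_row p" "y < dim_col p"
    then have "x < m" "y < m" using pc[OF that(1)] by auto
    then show "f u (f v p) $$ (x, y) = p $$ (x, y)" using that(2) by (simp add: f_def add.assoc add.commute[of v u])
  qed (use pc[OF that(1)] in \<open>auto simp: f_def\<close>)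
  have fc: "f u p \<in> polar_group ty n i k" if "p \<in> polar_group ty n i k" for u p
    unfolding f_def by (rule closed[OF that])
  have "(\<Sum>p\<in>polar_group ty n i k. \<theta> (s * V p)) = (\<Sum>p\<in>polar_group ty n i k. \<theta> (s * V (f t p)))"
    by (rule sum.reindex_bij_witness[of _ "f t" "f (- t)"]) (simp_all add: inv fc)
  also have "\<dots> = (\<Sum>p\<in>polar_group ty n i k. \<theta> a * \<theta> (s * V p))"
  proof (intro sum.cong refl)
    fix p :: "'a mat" assume "p \<in> polar_group ty n i k"
    then have "V (f t p) = V p + t * C" unfolding f_def by (rule val)
    then have "s * V (f t p) = a + s * V p" using s C by (simp add: t_def algebra_simps)
    then show "\<theta> (s * V (f t p)) = \<theta> a * \<theta> (s * V p)" by (simp add: additive_character_add[OF \<theta>])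
  qed
  also have "\<dots> = \<theta> a * (\<Sum>p\<in>polar_group ty n i k. \<theta> (s * V p))" by (rule sum_distrib_left[symmetric])
  finally show ?thesis using a by simp
qed

text \<open>Changing one entry of \<open>p\<close> changes row \<open>r\<close> only. The exponent
  is linear in that row unless both indices equal \<open>r\<close>, which is where the quadratic
  term appears.\<close>

lemma congruence_shift:
  fixes p S :: "'a::field mat" and t :: 'a
  assumes p: "p \<in> carrier_mat m m" and S: "S \<in> carrier_mat m m" and rb: "r < m" "b < m"
  defines "q \<equiv> mat m m (\<lambda>(x, y). p $$ (x, y) + (if x = r \<and> y = b then t else 0))"
  shows "(q * S * q\<^sup>T) $$ (i, k) = (p * S * p\<^sup>T) $$ (i, k)
    + (if i = r then t * (\<Sum>l<m. S $$ (b, l) * p $$ (k, l)) else 0)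
    + (if k = r then t * (\<Sum>a<m. p $$ (i, a) * S $$ (a, b)) else 0)
    + (if i = r \<and> k = r then t * t * S $$ (b, b) else 0)"
proof -
  note b = polar_bounds
  have qc: "q \<in> carrier_mat m m" by (simp add: q_def)
  define ui where "ui = (if i = r then t else 0)"
  define uk where "uk = (if k = r then t else 0)"
  have row: "(\<Sum>a<m. q $$ (x, a) * f a) = (\<Sum>a<m. p $$ (x, a) * f a) + (if x = r then t else 0) * f b"
    if x: "x < m" for x and f :: "nat \<Rightarrow> 'a"
  proof -
    have "(\<Sum>a<m. q $$ (x, a) * f a) =
        (\<Sum>a<m. p $$ (x, a) * f a + (if a = b then (if x = r then t else 0) * f a else 0))"
      using x by (intro sum.cong refl) (auto simp: q_def algebra_simps)
    then show ?thesis using rb by (simp add: sum.distrib)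
  qed
  have "(q * S * q\<^sup>T) $$ (i, k) = (\<Sum>a<m. q $$ (i, a) * (\<Sum>l<m. q $$ (k, l) * S $$ (a, l)))"
    unfolding congruence_index[OF qc S b(3,2)] sum_distrib_left by (intro sum.cong refl) (simp only: mult_ac)
  also have "\<dots> = (\<Sum>a<m. p $$ (i, a) * (\<Sum>l<m. p $$ (k, l) * S $$ (a, l)))
      + (\<Sum>a<m. p $$ (i, a) * (uk * S $$ (a, b))) + ui * ((\<Sum>l<m. p $$ (k, l) * S $$ (b, l)) + uk * S $$ (b, b))"
    unfolding row[OF b(2)] row[OF b(3)] uk_def[symmetric] ui_def[symmetric]
    by (simp only: distrib_left sum.distrib)
  also have "(\<Sum>a<m. p $$ (i, a) * (\<Sum>l<m. p $$ (k, l) * S $$ (a, l))) = (p * S * p\<^sup>T) $$ (i, k)"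
    unfolding congruence_index[OF p S b(3,2)] sum_distrib_left by (intro sum.cong refl) (simp only: mult_ac)
  also have "(\<Sum>a<m. p $$ (i, a) * (uk * S $$ (a, b))) = uk * (\<Sum>a<m. p $$ (i, a) * S $$ (a, b))"
    unfolding sum_distrib_left by (intro sum.cong refl) (simp only: mult_ac)
  also have "(\<Sum>l<m. p $$ (k, l) * S $$ (b, l)) = (\<Sum>l<m. S $$ (b, l) * p $$ (k, l))"
    by (simp only: mult.commute)
  finally show ?thesis by (auto simp: ui_def uk_def algebra_simps)
qed

text \<open>If \<open>polar_coords\<close> fails, some entry \<open>S $$ (i, l)\<close> or
  \<open>S $$ (k, l)\<close> is nonzero, and it is the coefficient with which a free entry of row
  \<open>k\<close>, respectively row \<open>i\<close>, of \<open>p\<close> enters the exponent (up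
  to sign, and up to a factor 2 when \<open>i = k\<close>). Shifting that entry shows that the sum
  vanishes.\<close>

lemma polar_group_sum:
  fixes S :: "'a::{field,finite} mat" and \<theta> :: "'a \<Rightarrow> complex"
  assumes two: "(2 :: 'a) \<noteq> 0" and \<theta>: "nontrivial_additive_character \<theta>" and s: "s \<noteq> 0"
    and S: "S \<in> staircase (form_sign ty) m"
  shows "(\<Sum>p\<in>(polar_group ty n i k :: 'a mat set). \<theta> (s * (p * S * p\<^sup>T) $$ (i, k))) =
    (if polar_coords ty n i k S then of_nat (card (polar_group ty n i k :: 'a mat set)) * \<theta> (s * S $$ (i, k)) else 0)"
proof (cases "polar_coords ty n i k S")
  case True
  then show ?thesis using polar_group_value[OF _ S True] by simp
next
  case False
  note b = polar_bounds and Sc = staircase_carrier[OF S]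
  let ?P = "polar_group ty n i k :: 'a mat set" and ?V = "\<lambda>p. (p * S * p\<^sup>T) $$ (i, k)"
  have pu: "p \<in> unitri m" "p \<in> carrier_mat m m" if "p \<in> ?P" for p
    using that by (auto simp: polar_group_def m_def unitri_carrier)
  have closed: "mat m m (\<lambda>(x, y). p $$ (x, y) + (if x = r \<and> y = b then t else 0)) \<in> ?P"
    if p: "p \<in> ?P" and rb: "r < b" "b < m"
      and r1: "r = i \<Longrightarrow> \<not> (b < n \<and> b < m - Suc k)" and r2: "r = k \<Longrightarrow> \<not> b < n + mid ty" for p r b t
  proof -
    have "mat m m (\<lambda>(x, y). p $$ (x, y) + (if x = r \<and> y = b then t else 0)) \<in> unitri m"
      using pu(1)[OF p] rb unfolding unitri_iff by auto
    moreover have "polar_rows ty n i k (mat m m (\<lambda>(x, y). p $$ (x, y) + (if x = r \<and> y = b then t else 0)))"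
      using p r1 r2 polar_bounds unfolding polar_group_def polar_rows_def m_def[symmetric] by auto
    ultimately show ?thesis by (simp add: polar_group_def m_def)
  qed
  have rowi: "(\<Sum>a<m. p $$ (i, a) * S $$ (a, l)) = S $$ (i, l)"
    if p: "p \<in> ?P" and l: "k < l" "l < m" "n + mid ty \<le> l" for p l
  proof -
    have "p $$ (i, a) * S $$ (a, l) = (if a = i then S $$ (i, l) else 0)" if a: "a < m" for a
    proof -
      consider "a = i" | "a < i" | "i < a" "a < n" "a < m - Suc k" | "i < a" "m \<le> Suc (a + l)"
        using l b by linarith
      then show ?thesis
      proof cases
        case 1
        then show ?thesis using pu(1)[OF p] b by (simp add: unitri_diag)
      next
        case 2
        then show ?thesis using unitri_lower[OF pu(1)[OF p]] b by simp
      next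
        case 3
        then show ?thesis using p unfolding polar_group_def polar_rows_def m_def[symmetric] by auto
      next
        case 4
        then show ?thesis using staircase_zero[OF S a l(2)] by simp
      qed
    qed
    then show ?thesis using b by simp
  qed
  have rowk: "(\<Sum>a<m. S $$ (l, a) * p $$ (k, a)) = S $$ (l, k)"
    if p: "p \<in> ?P" and l: "n \<le> l" "l < m" for p l
  proof -
    have "S $$ (l, a) * p $$ (k, a) = (if a = k then S $$ (l, k) else 0)" if a: "a < m" for a
    proof -
      consider "a = k" | "a < k" | "k < a" "a < n + mid ty" | "k < a" "m \<le> Suc (l + a)"
        using l b by linarith
      then show ?thesis
      proof cases
        case 1
        then show ?thesis using pu(1)[OF p] b by (simp add: unitri_diag)
      next
        case 2
        then show ?thesis using unitri_lower[OF pu(1)[OF p]] b by simp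
      next
        case 3
        then show ?thesis using p unfolding polar_group_def polar_rows_def m_def[symmetric] by auto
      next
        case 4
        then show ?thesis using staircase_zero[OF S l(2) a] by simp
      qed
    qed
    then show ?thesis using b by simp
  qed
  have sym: "S $$ (c, d) = form_sign ty * S $$ (d, c)" if "c < m" "d < m" for c d
    using eps_symmetricD[OF staircase_eps[OF S] that(2,1)] .
  have first: "(\<Sum>p\<in>?P. \<theta> (s * ?V p)) = 0"
    if l: "k < l" "l < m - Suc i" "n + mid ty \<le> l" "S $$ (i, l) \<noteq> 0" for l
  \<comment> \<open>For \<open>i = k\<close> the shifted row occurs on both sides of
    \<open>S\<close>, which doubles the coefficient; the quadratic term disappears because
    \<open>S $$ (l, l)\<close> lies below the antidiagonal.\<close>
  proof (rule polar_sum_shift[OF \<theta> s, where r = k and b = l and C = "if i = k then 2 * S $$ (i, l) else S $$ (i, l)"])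
    have lm: "l < m" using l b by linarith
    show "k < l" "l < m" using l lm by auto
    show "(if i = k then 2 * S $$ (i, l) else S $$ (i, l)) \<noteq> 0" using l two by auto
    fix p t assume p: "p \<in> ?P"
    show "mat m m (\<lambda>(x, y). p $$ (x, y) + (if x = k \<and> y = l then t else 0)) \<in> ?P"
      by (rule closed[OF p]) (use l lm in auto)
    have "S $$ (l, l) = 0" using staircase_zero[OF S lm lm] l b by simp
    moreover have "i = k \<Longrightarrow> S $$ (l, k) = S $$ (i, l)"
      using sym[of l k] lm b diag by (simp add: form_sign_def)
    ultimately show "?V (mat m m (\<lambda>(x, y). p $$ (x, y) + (if x = k \<and> y = l then t else 0))) =
        ?V p + t * (if i = k then 2 * S $$ (i, l) else S $$ (i, l))"
      unfolding congruence_shift[OF pu(2)[OF p] Sc b(2) lm]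
      using rowi[OF p l(1) lm l(3)] rowk[OF p _ lm] l by (simp add: algebra_simps)
  qed
  have second: "(\<Sum>p\<in>?P. \<theta> (s * ?V p)) = 0"
    if l: "n \<le> l" "l < m - Suc k" "S $$ (k, l) \<noteq> 0" and ik': "i \<noteq> k" for l
  proof (rule polar_sum_shift[OF \<theta> s, where r = i and b = l and C = "S $$ (l, k)"])
    have lm: "l < m" using l b by linarith
    show "i < l" "l < m" using l lm b by auto
    show "S $$ (l, k) \<noteq> 0" using sym[of k l] lm b l by auto
    fix p t assume p: "p \<in> ?P"
    show "mat m m (\<lambda>(x, y). p $$ (x, y) + (if x = i \<and> y = l then t else 0)) \<in> ?P"
      by (rule closed[OF p]) (use l lm b ik' in auto)
    show "?V (mat m m (\<lambda>(x, y). p $$ (x, y) + (if x = i \<and> y = l then t else 0))) = ?V p + t * S $$ (l, k)"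
      unfolding congruence_shift[OF pu(2)[OF p] Sc b(3) lm]
      using rowk[OF p l(1) lm] ik' by simp
  qed
  have "(\<Sum>p\<in>?P. \<theta> (s * ?V p)) = 0"
  proof (cases "\<exists>l. k < l \<and> l < m - Suc i \<and> n + mid ty \<le> l \<and> S $$ (i, l) \<noteq> 0")
    case True
    then show ?thesis using first by blast
  next
    case no: False
    then obtain l where l: "n \<le> l" "l < m - Suc k" "S $$ (k, l) \<noteq> 0"
      using False unfolding polar_coords_def m_def[symmetric] by blast
    \<comment> \<open>On the diagonal there is no middle column, so the two kinds of violation
      coincide and one of the first kind would exist.\<close>
    have "i \<noteq> k"
    proof
      assume e: "i = k"
      then have "mid ty = 0" using diag by (simp add: mid_def)
      then have "n + mid ty \<le> l" "k < l" using l b e by auto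
      with no l e show False by blast
    qed
    then show ?thesis using second[OF l] by blast
  qed
  then show ?thesis using False by simp
qed

end

text \<open>z - 1 and its Cayley transform differ by an upper triangular factor on the right, in
  either direction. Such a factor preserves a stretch of zeros that starts right after the
  diagonal.\<close>

lemma cayley_row_zero_iff:
  fixes z :: "'a::{field,finite} mat"
  assumes two: "(2 :: 'a) \<noteq> 0" and z: "z \<in> unitri m" and i: "i < m" and b: "b \<le> m"
  shows "(\<forall>c. i < c \<and> c < b \<longrightarrow> cayley m z $$ (i, c) = 0) \<longleftrightarrow> (\<forall>c. i < c \<and> c < b \<longrightarrow> z $$ (i, c) = 0)"
proof -
  let ?a = "cayley m z" and ?h = "half_sum m z"
  note hu = half_sum_unitri[OF two z]
  have ent: "(z - 1\<^sub>m m) $$ (i, c) = z $$ (i, c)" if "i < c" "c < m" for c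
    using that i unitri_carrier[OF z] by simp
  have low: "(z - 1\<^sub>m m) $$ (i, c) = 0" if "c \<le> i" for c
    using that i z unitri_carrier[OF z] by (cases "c = i") (auto simp: unitri_diag unitri_lower)
  show ?thesis
  proof (intro iffI allI impI; elim conjE)
    fix c assume H: "\<forall>c. i < c \<and> c < b \<longrightarrow> ?a $$ (i, c) = 0" and c: "i < c" "c < b"
    have "?a $$ (i, l) * ?h $$ (l, c) = 0" if "l < m" for l
      using H c that b i cayley_strict_upper[OF two z i, of l] unitri_lower[OF hu, of c l]
      by (cases "l \<le> i"; cases "l \<le> c") auto
    then have "(?a * ?h) $$ (i, c) = 0"
      using index_mult_mat_sum[OF cayley_carrier[OF two z] unitri_carrier[OF hu] i, of c] c b
      by (simp add: sum.neutral del: mult_eq_0_iff index_mult_mat(1))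
    then show "z $$ (i, c) = 0" using ent[of c] c b unfolding cayley_half_sum[OF two z] by simp
  next
    fix c assume H: "\<forall>c. i < c \<and> c < b \<longrightarrow> z $$ (i, c) = 0" and c: "i < c" "c < b"
    have "(z - 1\<^sub>m m) $$ (i, l) * uinv m ?h $$ (l, c) = 0" if "l < m" for l
      using H c that b i low[of l] ent[of l] unitri_lower[OF uinv(1)[OF hu], of c l]
      by (cases "l \<le> i"; cases "l \<le> c") auto
    then show "?a $$ (i, c) = 0"
      unfolding cayley_def
      using index_mult_mat_sum[OF minus_one_carrier[OF two z] unitri_carrier[OF uinv(1)[OF hu]] i, of c] c b
      by (simp add: sum.neutral del: mult_eq_0_iff index_mult_mat(1))
  qed
qed

lemma staircase_coord_index:
  assumes two: "(2 :: 'a::{field,finite}) \<noteq> 0" and z: "z \<in> (unitri (msize ty n) :: 'a mat set)"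
    and "i < msize ty n" "l < msize ty n"
  shows "staircase_coord ty n z $$ (i, l) = cayley (msize ty n) z $$ (i, msize ty n - Suc l) * column_sign ty n l"
  unfolding staircase_coord_def by (rule mult_form_matrix_index[OF cayley_carrier[OF two z] assms(3,4)])

context
  fixes ty :: gtype and n i k m :: nat
  assumes m_def: "m = msize ty n" and ik: "i \<le> k" "Suc (i + k) < m" and diag: "i = k \<Longrightarrow> ty = Symplectic"
begin

lemmas pb = polar_bounds[OF m_def ik diag]

text \<open>Both conditions concern initial stretches of rows, so \<open>cayley_row_zero_iff\<close>
  passes from \<open>z\<close> to its transform; multiplication by \<Omega> then reflects column
  \<open>c\<close> to \<open>m - Suc c\<close>, which mirrors the bounds.\<close>

lemma polar_rows_iff_coords:
  fixes z :: "'a::{field,finite} mat"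
  assumes two: "(2 :: 'a) \<noteq> 0" and z: "z \<in> unitri m"
  shows "polar_rows ty n i k z \<longleftrightarrow> polar_coords ty n i k (staircase_coord ty n z)"
proof -
  let ?a = "cayley m z" and ?S = "staircase_coord ty n z"
  have S0: "?S $$ (x, l) = 0 \<longleftrightarrow> ?a $$ (x, m - Suc l) = 0" if "x < m" "l < m" for x l
    using staircase_coord_index[OF two z[unfolded m_def], of x l] that by (simp add: m_def)
  have 1: "(\<forall>c. i < c \<and> c < n \<and> c < m - Suc k \<longrightarrow> z $$ (i, c) = 0) \<longleftrightarrow>
      (\<forall>c. i < c \<and> c < n \<and> c < m - Suc k \<longrightarrow> ?a $$ (i, c) = 0)"
    using cayley_row_zero_iff[OF two z pb(3), of "min n (m - Suc k)"] by auto
  have 2: "(\<forall>c. k < c \<and> c < n + mid ty \<longrightarrow> z $$ (k, c) = 0) \<longleftrightarrow> (\<forall>c. k < c \<and> c < n + mid ty \<longrightarrow> ?a $$ (k, c) = 0)"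
    using cayley_row_zero_iff[OF two z pb(2,5)] by auto
  have 3: "(\<forall>c. i < c \<and> c < n \<and> c < m - Suc k \<longrightarrow> ?a $$ (i, c) = 0) \<longleftrightarrow>
      (\<forall>l. k < l \<and> l < m - Suc i \<and> n + mid ty \<le> l \<longrightarrow> ?S $$ (i, l) = 0)"
  proof (intro iffI allI impI)
    fix l assume H: "\<forall>c. i < c \<and> c < n \<and> c < m - Suc k \<longrightarrow> ?a $$ (i, c) = 0"
      and l: "k < l \<and> l < m - Suc i \<and> n + mid ty \<le> l"
    then have "i < m - Suc l" "m - Suc l < n" "m - Suc l < m - Suc k" "l < m" using pb by auto
    then show "?S $$ (i, l) = 0" using H S0[OF pb(3), of l] by auto
  next
    fix c assume H: "\<forall>l. k < l \<and> l < m - Suc i \<and> n + mid ty \<le> l \<longrightarrow> ?S $$ (i, l) = 0"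
      and c: "i < c \<and> c < n \<and> c < m - Suc k"
    then have l: "k < m - Suc c" "m - Suc c < m - Suc i" "n + mid ty \<le> m - Suc c" "m - Suc c < m"
      "m - Suc (m - Suc c) = c" using pb by auto
    then show "?a $$ (i, c) = 0" using H S0[OF pb(3) l(4)] by auto
  qed
  have 4: "(\<forall>c. k < c \<and> c < n + mid ty \<longrightarrow> ?a $$ (k, c) = 0) \<longleftrightarrow>
      (\<forall>l. n \<le> l \<and> l < m - Suc k \<longrightarrow> ?S $$ (k, l) = 0)"
  proof (intro iffI allI impI)
    fix l assume H: "\<forall>c. k < c \<and> c < n + mid ty \<longrightarrow> ?a $$ (k, c) = 0" and l: "n \<le> l \<and> l < m - Suc k"
    then have "k < m - Suc l" "m - Suc l < n + mid ty" "l < m" using pb by auto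
    then show "?S $$ (k, l) = 0" using H S0[OF pb(2), of l] by auto
  next
    fix c assume H: "\<forall>l. n \<le> l \<and> l < m - Suc k \<longrightarrow> ?S $$ (k, l) = 0" and c: "k < c \<and> c < n + mid ty"
    then have l: "n \<le> m - Suc c" "m - Suc c < m - Suc k" "m - Suc c < m" "m - Suc (m - Suc c) = c"
      using pb by auto
    then show "?a $$ (k, c) = 0" using H S0[OF pb(2) l(3)] by auto
  qed
  show ?thesis
    unfolding polar_rows_def polar_coords_def m_def[symmetric] 1 2 3 4 ..
qed

text \<open>In the product a h = z - 1 at the positive entry, the row of a vanishes for left columns
  and the column of h vanishes for middle and right rows above the diagonal, so only the diagonal
  term of h survives.\<close>

lemma polar_entry:
  fixes z :: "'a::{field,finite} mat"
  assumes two: "(2 :: 'a) \<noteq> 0" and z: "z \<in> isometries ty n"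
    and cond: "polar_coords ty n i k (staircase_coord ty n z)"
  shows "z $$ (i, m - Suc k) = column_sign ty n k * staircase_coord ty n z $$ (i, k)"
proof -
  let ?a = "cayley m z" and ?S = "staircase_coord ty n z" and ?h = "half_sum m z" and ?d = "m - Suc k"
  have zu: "z \<in> unitri m" using z by (simp add: isometries_unitri m_def)
  note hu = half_sum_unitri[OF two zu]
  have st: "?S \<in> staircase (form_sign ty) m"
    using isometry_cayley_staircase[OF two z] by (simp add: staircase_coord_def m_def)
  have Sa: "?S $$ (x, l) = ?a $$ (x, m - Suc l) * column_sign ty n l" if "x < m" "l < m" for x l
    using staircase_coord_index[OF two zu[unfolded m_def], of x l] that by (simp add: m_def)
  have d: "?d < m" "i < ?d" using pb ik by auto
  have rowz: "z $$ (i, c) = 0" if "i < c" "c < n" "c < ?d" for c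
    using cond that unfolding polar_rows_iff_coords[OF two zu, symmetric] polar_rows_def m_def[symmetric] by blast
  have rowa: "?a $$ (i, c) = 0" if "i < c" "c < n" "c < ?d" for c
    using cayley_row_zero_iff[OF two zu pb(3), of "min n ?d"] rowz that d by auto
  \<comment> \<open>\<open>polar_coords\<close> speaks of row \<open>k\<close> of \<open>?S\<close>;
    by symmetry this is its column \<open>k\<close>, which is column \<open>?d\<close> of the
    transform.\<close>
  have cola: "?a $$ (b, ?d) = 0" if b: "n \<le> b" "b < ?d" for b
  proof -
    have bm: "b < m" using b by simp
    have "?S $$ (k, b) = 0" using cond b unfolding polar_coords_def m_def[symmetric] by blast
    then have "?S $$ (b, k) = 0" using eps_symmetricD[OF staircase_eps[OF st] pb(2) bm] by simp
    then show ?thesis using Sa[OF bm pb(2)] by simp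
  qed
  have colz: "z $$ (l, ?d) = 0" if l: "n \<le> l" "l < ?d" for l
  proof -
    have lm: "l < m" using l by simp
    have "?h $$ (l, b) * ?a $$ (b, ?d) = 0" if "b < m" for b
      using l that lm d cola[of b] unitri_lower[OF hu, of b l] cayley_strict_upper[OF two zu, of b ?d]
      by (cases "b < l"; cases "b < ?d") auto
    then have "(?h * ?a) $$ (l, ?d) = 0"
      using index_mult_mat_sum[OF unitri_carrier[OF hu] cayley_carrier[OF two zu] lm d(1)]
      by (simp add: sum.neutral del: mult_eq_0_iff index_mult_mat(1))
    then show ?thesis
      unfolding half_sum_cayley[OF two zu] using lm d l unitri_carrier[OF zu] by simp
  qed
  have trm: "?a $$ (i, l) * ?h $$ (l, ?d) = (if l = ?d then ?a $$ (i, ?d) else 0)" if l: "l < m" for l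
  proof -
    consider "l \<le> i" | "i < l" "l < n" "l < ?d" | "n \<le> l" "l < ?d" | "l = ?d" | "?d < l" by linarith
    then show ?thesis
    proof cases
      case 1
      then show ?thesis using cayley_strict_upper[OF two zu pb(3)] d by auto
    next
      case 2
      then show ?thesis using rowa by simp
    next
      case 3
      then have "?h $$ (l, ?d) = 0"
        using colz[of l] l d unitri_carrier[OF zu] by (simp add: half_sum_def)
      then show ?thesis using 3 by simp
    next
      case 4
      then show ?thesis using unitri_diag[OF hu d(1)] by simp
    next
      case 5
      then show ?thesis using unitri_lower[OF hu 5 l] by simp
    qed
  qed
  have "(?a * ?h) $$ (i, ?d) = (\<Sum>l<m. ?a $$ (i, l) * ?h $$ (l, ?d))"
    by (rule index_mult_mat_sum[OF cayley_carrier[OF two zu] unitri_carrier[OF hu] pb(3) d(1)])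
  also have "\<dots> = (\<Sum>l<m. if l = ?d then ?a $$ (i, ?d) else 0)"
    by (rule sum.cong[OF refl]) (simp only: trm lessThan_iff)
  finally have "(?a * ?h) $$ (i, ?d) = (\<Sum>l<m. if l = ?d then ?a $$ (i, ?d) else 0)" .
  then have "(z - 1\<^sub>m m) $$ (i, ?d) = ?a $$ (i, ?d)"
    unfolding cayley_half_sum[OF two zu] using d by simp
  moreover have "(z - 1\<^sub>m m) $$ (i, ?d) = z $$ (i, ?d)"
    using d pb unitri_carrier[OF zu] by simp
  ultimately have "z $$ (i, ?d) = ?a $$ (i, ?d)" by simp
  also have "\<dots> = column_sign ty n k * ?S $$ (i, k)"
    using Sa[OF pb(3,2)] by (simp add: mult_ac)
  finally show ?thesis .
qed

end

subsection \<open>The complement of the polar groups\<close>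

lemma U_data_ex:
  assumes two: "(2 :: 'a::{field,finite}) \<noteq> 0" and x: "x \<in> unitri n" and v: "v \<in> (carrier_mat n (mid ty) :: 'a mat set)"
  shows "\<exists>w. (x, v, w) \<in> U_data ty n"
proof -
  \<comment> \<open>A particular solution: minus one half of the middle contribution at each of two
    mirror entries.\<close>
  define w where "w = mat n n (\<lambda>(i, j). - (1 / 2) * (\<Sum>k<mid ty. v $$ (i, k) * v $$ (n - Suc j, k)))"
  have "(x, v, w) \<in> U_data ty n"
    unfolding U_data_iff
  proof (intro conjI allI impI x v)
    show "w \<in> carrier_mat n n" by (simp add: w_def)
    fix i j assume ij: "i < n" "j < n"
    define s where "s = (\<Sum>k<mid ty. v $$ (i, k) * v $$ (j, k))"
    have w1: "w $$ (j, n - Suc i) = - (1 / 2) * s" "w $$ (i, n - Suc j) = - (1 / 2) * s"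
      using ij by (simp_all add: w_def s_def mult.commute)
    show "w $$ (j, n - Suc i) - form_sign ty * w $$ (i, n - Suc j) = - (\<Sum>k<mid ty. v $$ (i, k) * v $$ (j, k))"
      unfolding w1 s_def[symmetric]
    proof (cases "ty = Symplectic")
      case True
      then have "s = 0" by (simp add: s_def mid_def)
      then show "- (1 / 2) * s - form_sign ty * (- (1 / 2) * s) = - s" by simp
    next
      case False
      then show "- (1 / 2) * s - form_sign ty * (- (1 / 2) * s) = - s"
        using two by (simp add: form_sign_def field_simps)
    qed
  qed
  then show ?thesis by blast
qed

text \<open>\<open>y\<close> is built to agree with \<open>g\<close> on the first \<open>n\<close>
  rows and \<open>n + mid ty\<close> columns, a part on which elements of \<open>U\<close> are
  unrestricted. There g y^{-1} coincides with the identity, since y^{-1} is upper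
  triangular.\<close>

lemma unitri_factorization:
  fixes g :: "'a::{field,finite} mat"
  assumes two: "(2 :: 'a) \<noteq> 0" and g: "g \<in> unitri (msize ty n)"
  obtains p y where "p \<in> unitri (msize ty n)" "y \<in> U_set ty n" "g = p * y"
    "\<And>i c. i < n \<Longrightarrow> i < c \<Longrightarrow> c < n + mid ty \<Longrightarrow> p $$ (i, c) = 0"
proof -
  let ?m = "msize ty n"
  have gc: "g \<in> carrier_mat ?m ?m" using unitri_carrier[OF g] .
  define x where "x = mat n n (\<lambda>(i, j). g $$ (i, j))"
  define B where "B = mat n (mid ty) (\<lambda>(i, j). g $$ (i, n + j))"
  have x: "x \<in> unitri n" using g by (auto simp: unitri_iff x_def msize_eq)
  have Bc: "B \<in> carrier_mat n (mid ty)" by (simp add: B_def)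
  note xc = unitri_carrier[OF x] unitri_carrier[OF uinv(1)[OF x]]
  define v where "v = uinv n x * B"
  have v: "v \<in> carrier_mat n (mid ty)" unfolding v_def by (rule mult_carrier_mat[OF xc(2) Bc])
  have xv: "x * v = B"
    unfolding v_def assoc_mult_mat[OF xc Bc, symmetric] uinv(2)[OF x] by (rule left_mult_one_mat[OF Bc])
  obtain w where d: "(x, v, w) \<in> U_data ty n" using U_data_ex[OF two x v] by blast
  define y where "y = U_mat ty n (x, v, w)"
  have yU: "y \<in> U_set ty n" using d by (auto simp: y_def U_set_def)
  have yu: "y \<in> unitri ?m" unfolding y_def by (rule U_mat_unitri[OF d])
  note yc = unitri_carrier[OF yu] unitri_carrier[OF uinv(1)[OF yu]]
  have agree: "g $$ (i, l) = y $$ (i, l)" if "i < n" "l < n + mid ty" for i l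
  proof (cases "l < n")
    case True
    then show ?thesis using that U_mat_index(1)[OF d] by (simp add: y_def x_def)
  next
    case False
    define j where "j = l - n"
    have j: "l = n + j" "j < mid ty" using False that by (auto simp: j_def)
    show ?thesis using that j U_mat_index(2)[OF d that(1) j(2)] by (simp add: y_def xv B_def)
  qed
  let ?p = "g * uinv ?m y"
  have pu: "?p \<in> unitri ?m" by (rule mult_unitri[OF g uinv(1)[OF yu]])
  have gp: "g = ?p * y"
    unfolding assoc_mult_mat[OF gc yc(2,1)] uinv(3)[OF yu] by (rule right_mult_one_mat[OF gc, symmetric])
  have "?p $$ (i, c) = 0" if ic: "i < n" "i < c" "c < n + mid ty" for i c
  proof -
    have im: "i < ?m" "c < ?m" using ic by (auto simp: msize_eq)
    have "?p $$ (i, c) = (\<Sum>l<?m. g $$ (i, l) * uinv ?m y $$ (l, c))"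
      by (rule index_mult_mat_sum[OF gc yc(2) im])
    also have "\<dots> = (\<Sum>l<?m. y $$ (i, l) * uinv ?m y $$ (l, c))"
    proof (intro sum.cong refl)
      fix l assume l: "l \<in> {..<?m}"
      show "g $$ (i, l) * uinv ?m y $$ (l, c) = y $$ (i, l) * uinv ?m y $$ (l, c)"
      proof (cases "c < l")
        case True
        then show ?thesis using l by (simp add: unitri_lower[OF uinv(1)[OF yu]])
      next
        case False
        then show ?thesis using agree[OF ic(1), of l] ic by simp
      qed
    qed
    also have "\<dots> = (y * uinv ?m y) $$ (i, c)" by (rule index_mult_mat_sum[OF yc im, symmetric])
    also have "\<dots> = 0" unfolding uinv(2)[OF yu] using im ic by simp
    finally show ?thesis .
  qed
  then show ?thesis using that[OF pu yU gp] by blast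
qed

context
  fixes ty :: gtype and n i k m :: nat
  assumes m_def: "m = msize ty n" and ik: "i \<le> k" "Suc (i + k) < m" and diag: "i = k \<Longrightarrow> ty = Symplectic"
begin

lemmas pb2 = polar_bounds[OF m_def ik diag]

text \<open>The polar average turns each summand of the induction formula into a sum over P, and P U
  is the whole unitriangular group. The multiplicity of the factorisation is the order of the
  intersection of P and U, which is the inducing subgroup, so it cancels the denominator of the
  induced character.\<close>

lemma polar_induced:
  fixes z :: "'a::{field,finite} mat" and \<theta> :: "'a \<Rightarrow> complex"
  assumes two: "(2 :: 'a) \<noteq> 0" and \<theta>: "nontrivial_additive_character \<theta>" and r: "r \<noteq> 0"
    and z: "z \<in> U_set ty n"
  shows "induced (U_group ty n) {x \<in> U_set ty n. polar_rows ty n i k x} (\<lambda>x. \<theta> (r * x $$ (i, m - Suc k))) z =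
    (\<Sum>g\<in>unitri m. \<theta> (r * column_sign ty n k * (g * staircase_coord ty n z * g\<^sup>T) $$ (i, k))) /
      of_nat (card (polar_group ty n i k :: 'a mat set))"
proof -
  let ?U = "U_set ty n :: 'a mat set" and ?S = "staircase_coord ty n z" and ?s = "column_sign ty n k :: 'a"
  let ?P = "polar_group ty n i k :: 'a mat set"
  let ?H = "{x \<in> ?U. polar_rows ty n i k x}"
  define F where "F g = \<theta> (r * ?s * (g * ?S * g\<^sup>T) $$ (i, k))" for g
  have Uiso: "?U = isometries ty n" by (rule U_set_eq[OF two])
  have Pu: "?P \<subseteq> unitri m" by (auto simp: polar_group_def m_def)
  have Uu: "?U \<subseteq> unitri m" by (auto simp: Uiso m_def isometries_unitri)
  have St: "?S \<in> staircase (form_sign ty) m"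
    using isometry_cayley_staircase[OF two] z by (simp add: staircase_coord_def m_def Uiso)
  have HP: "?H = ?P \<inter> ?U" using Uu by (auto simp: polar_group_def m_def)
  note P1 = one_polar_group[OF m_def ik diag, where 'a = 'a] and P2 = mult_polar_group[OF m_def ik diag]
  have one: "1\<^sub>m m \<in> ?P \<inter> ?U" using P1 isometries_one[of ty n] by (simp add: Uiso m_def)
  have finPU: "finite (?P \<inter> ?U)" "finite ?P" using finite_subset[OF Pu finite_unitri] by auto
  have nz: "of_nat (card ?P) \<noteq> (0 :: complex)" "of_nat (card (?P \<inter> ?U)) \<noteq> (0 :: complex)"
    using one finPU by (auto simp: card_eq_0_iff)
  have conj: "y * z * uinv m y \<in> ?U" if "y \<in> ?U" for y
    using that z isometries_uinv[of y ty n] by (auto simp: Uiso m_def intro!: isometries_mult)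
  \<comment> \<open>Indicator and linear character at the conjugate by \<open>y\<close>, written as
    one average over the polar group: conjugation acts on \<open>?S\<close> by congruence, and
    \<open>polar_group_sum\<close> applies to the result.\<close>
  have term1: "(if polar_rows ty n i k (y * z * uinv m y) then \<theta> (r * (y * z * uinv m y) $$ (i, m - Suc k)) else 0) =
      (\<Sum>p\<in>?P. F (p * y)) / of_nat (card ?P)" if y: "y \<in> ?U" for y
  proof -
    let ?z = "y * z * uinv m y" and ?T = "y * ?S * y\<^sup>T"
    have zi: "?z \<in> isometries ty n" using conj[OF y] by (simp add: Uiso)
    have zu: "?z \<in> unitri m" using conj[OF y] Uu by blast
    have yu: "y \<in> unitri m" using y Uu by blast
    have T: "staircase_coord ty n ?z = ?T"
      using staircase_coord_conjugate[OF two, of y ty n z] y z by (simp add: Uiso m_def)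
    have Tst: "?T \<in> staircase (form_sign ty) m" by (rule staircase_congruence[OF yu St])
    have "(\<Sum>p\<in>?P. F (p * y)) = (\<Sum>p\<in>?P. \<theta> (r * ?s * (p * ?T * p\<^sup>T) $$ (i, k)))"
    proof (intro sum.cong refl)
      fix p assume "p \<in> ?P"
      then have "p \<in> unitri m" using Pu by blast
      then show "F (p * y) = \<theta> (r * ?s * (p * ?T * p\<^sup>T) $$ (i, k))"
        unfolding F_def by (simp only: congruence_mult[OF unitri_carrier unitri_carrier[OF yu] staircase_carrier[OF St]])
    qed
    also have "\<dots> = (if polar_coords ty n i k ?T then of_nat (card ?P) * \<theta> (r * ?s * ?T $$ (i, k)) else 0)"
      by (rule polar_group_sum[OF m_def ik diag two \<theta> _ Tst]) (use r in simp_all)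
    finally have sum: "(\<Sum>p\<in>?P. F (p * y)) / of_nat (card ?P) =
        (if polar_coords ty n i k ?T then \<theta> (r * ?s * ?T $$ (i, k)) else 0)" using nz by simp
    have iff: "polar_rows ty n i k ?z \<longleftrightarrow> polar_coords ty n i k ?T"
      using polar_rows_iff_coords[OF m_def ik diag two zu] unfolding T .
    have val: "polar_coords ty n i k ?T \<Longrightarrow> ?z $$ (i, m - Suc k) = ?s * ?T $$ (i, k)"
      using polar_entry[OF m_def ik diag two zi] unfolding T .
    show ?thesis unfolding sum iff using val by (auto simp only: mult.assoc if_True if_False split: if_splits)
  qed
  have "(\<Sum>y\<in>{y \<in> carrier (U_group ty n). y \<otimes>\<^bsub>U_group ty n\<^esub> z \<otimes>\<^bsub>U_group ty n\<^esub> inv\<^bsub>U_group ty n\<^esub> y \<in> ?H}.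
        \<theta> (r * (y \<otimes>\<^bsub>U_group ty n\<^esub> z \<otimes>\<^bsub>U_group ty n\<^esub> inv\<^bsub>U_group ty n\<^esub> y) $$ (i, m - Suc k))) =
      (\<Sum>y\<in>{y \<in> ?U. polar_rows ty n i k (y * z * uinv m y)}. \<theta> (r * (y * z * uinv m y) $$ (i, m - Suc k)))"
    by (rule sum.cong) (use conj in \<open>auto simp: inv_U_group[OF two] m_def\<close>)
  also have "\<dots> = (\<Sum>y\<in>?U. if polar_rows ty n i k (y * z * uinv m y) then \<theta> (r * (y * z * uinv m y) $$ (i, m - Suc k)) else 0)"
    by (rule sum.inter_filter) simp
  also have "\<dots> = (\<Sum>y\<in>?U. (\<Sum>p\<in>?P. F (p * y)) / of_nat (card ?P))"
    by (intro sum.cong refl) (rule term1)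
  also have "\<dots> = (\<Sum>p\<in>?P. \<Sum>y\<in>?U. F (p * y)) / of_nat (card ?P)"
    unfolding sum_divide_distrib[symmetric] by (subst sum.swap) (rule refl)
  also have "(\<Sum>p\<in>?P. \<Sum>y\<in>?U. F (p * y)) = of_nat (card (?P \<inter> ?U)) * (\<Sum>g\<in>unitri m. F g)"
  proof (rule sum_product_of_subgroups[OF Pu P1 P2 Uu])
    show "1\<^sub>m m \<in> ?U" using one by blast
    show "y * y' \<in> ?U" if "y \<in> ?U" "y' \<in> ?U" for y y' using that isometries_mult by (simp add: Uiso)
    fix g :: "'a mat" assume g: "g \<in> unitri m"
    obtain p y where py: "p \<in> unitri m" "y \<in> ?U" "g = p * y"
      "\<And>i c. i < n \<Longrightarrow> i < c \<Longrightarrow> c < n + mid ty \<Longrightarrow> p $$ (i, c) = 0"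
      using unitri_factorization[OF two g[unfolded m_def]] unfolding m_def by metis
    have "polar_rows ty n i k p"
      unfolding polar_rows_def
    proof (intro conjI allI impI)
      fix c assume "i < c \<and> c < n \<and> c < msize ty n - Suc k"
      then show "p $$ (i, c) = 0" using py(4)[OF pb2(1), of c] by simp
    next
      fix c assume c: "k < c \<and> c < n + mid ty"
      then have "k < n" using mid_le[of ty] by auto
      then show "p $$ (k, c) = 0" using py(4)[of k c] c by simp
    qed
    then have "p \<in> ?P" using py(1) by (simp add: polar_group_def m_def)
    with py show "\<exists>p\<in>?P. \<exists>y\<in>?U. g = p * y" by blast
  qed
  finally show ?thesis
    unfolding induced_def HP using nz by (simp add: F_def)
qed

end

subsection \<open>Products of functions of disjoint sets of rows\<close>

text \<open>Rows of a unitriangular matrix can be chosen independently. Exchanging the rows outside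
  \<open>R\<close> between two matrices is an involution on pairs, and it brings both functions to
  the same argument.\<close>

lemma sum_unitri_times_sum:
  fixes F G :: "'a::{field,finite} mat \<Rightarrow> complex"
  assumes F: "\<And>g h. g \<in> unitri m \<Longrightarrow> h \<in> unitri m \<Longrightarrow> (\<And>i c. i \<in> R \<Longrightarrow> i < m \<Longrightarrow> c < m \<Longrightarrow> g $$ (i, c) = h $$ (i, c)) \<Longrightarrow> F g = F h"
    and G: "\<And>g h. g \<in> unitri m \<Longrightarrow> h \<in> unitri m \<Longrightarrow> (\<And>i c. i \<notin> R \<Longrightarrow> i < m \<Longrightarrow> c < m \<Longrightarrow> g $$ (i, c) = h $$ (i, c)) \<Longrightarrow> G g = G h"
  shows "(\<Sum>g\<in>unitri m. F g) * (\<Sum>g\<in>unitri m. G g) =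
    of_nat (card (unitri m :: 'a mat set)) * (\<Sum>g\<in>unitri m. F g * G g)"
proof -
  define mix where "mix g h = mat m m (\<lambda>(i, c). if i \<in> R then g $$ (i, c) else h $$ (i, c))" for g h :: "'a mat"
  have mixu: "mix g h \<in> unitri m" if "g \<in> unitri m" "h \<in> unitri m" for g h
    using that by (auto simp: unitri_iff mix_def)
  have mixmix: "mix (mix g h) (mix h g) = g" if "g \<in> unitri m" for g h
    using unitri_carrier[OF that] by (intro eq_matI) (auto simp: mix_def)
  have "(\<Sum>g\<in>unitri m. F g) * (\<Sum>g\<in>unitri m. G g) = (\<Sum>(g, h)\<in>unitri m \<times> unitri m. F g * G h)"
    by (simp add: sum_product sum.cartesian_product)
  also have "\<dots> = (\<Sum>(g, h)\<in>unitri m \<times> unitri m. F (mix g h) * G (mix g h))"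
  proof (intro sum.cong refl, clarify)
    fix g h :: "'a mat" assume u: "g \<in> unitri m" "h \<in> unitri m"
    have "F g = F (mix g h)" by (rule F[OF u(1) mixu[OF u]]) (simp add: mix_def)
    moreover have "G h = G (mix g h)" by (rule G[OF u(2) mixu[OF u]]) (simp add: mix_def)
    ultimately show "F g * G h = F (mix g h) * G (mix g h)" by simp
  qed
  also have "\<dots> = (\<Sum>(g, h)\<in>unitri m \<times> (unitri m :: 'a mat set). F g * G g)"
  proof -
    define w where "w = (\<lambda>(g, h). (mix g h, mix h g))"
    have w: "w (w a) = a" "w a \<in> unitri m \<times> unitri m" if "a \<in> unitri m \<times> unitri m" for a
      using that by (auto simp: w_def mixmix mixu)
    show ?thesis
      by (rule sum.reindex_bij_witness[where i = w and j = w]) (use w in \<open>auto simp: w_def\<close>)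
  qed
  also have "\<dots> = (\<Sum>g\<in>unitri m. \<Sum>h\<in>(unitri m :: 'a mat set). F g * G g)"
    by (rule sum.cartesian_product[symmetric])
  finally show ?thesis by (simp add: sum_distrib_left)
qed

text \<open>The extra group order on the left avoids the exponent \<open>card D - 1\<close>, so the
  formula also holds for empty \<open>D\<close>.\<close>

lemma prod_sum_unitri:
  fixes F :: "'b \<Rightarrow> 'a::{field,finite} mat \<Rightarrow> complex"
  assumes fin: "finite D"
    and F: "\<And>\<alpha> g h. \<alpha> \<in> D \<Longrightarrow> g \<in> unitri m \<Longrightarrow> h \<in> unitri m \<Longrightarrow>
      (\<And>i c. i \<in> R \<alpha> \<Longrightarrow> i < m \<Longrightarrow> c < m \<Longrightarrow> g $$ (i, c) = h $$ (i, c)) \<Longrightarrow> F \<alpha> g = F \<alpha> h"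
    and disj: "\<And>\<alpha> \<beta>. \<alpha> \<in> D \<Longrightarrow> \<beta> \<in> D \<Longrightarrow> \<alpha> \<noteq> \<beta> \<Longrightarrow> R \<alpha> \<inter> R \<beta> = {}"
  shows "of_nat (card (unitri m :: 'a mat set)) * (\<Prod>\<alpha>\<in>D. \<Sum>g\<in>unitri m. F \<alpha> g) =
    of_nat (card (unitri m :: 'a mat set)) ^ card D * (\<Sum>g\<in>unitri m. \<Prod>\<alpha>\<in>D. F \<alpha> g)"
  using fin F disj
proof (induction D rule: finite_induct)
  case empty
  then show ?case by simp
next
  case (insert \<alpha> D)
  let ?N = "of_nat (card (unitri m :: 'a mat set)) :: complex"
  have IH: "?N * (\<Prod>\<beta>\<in>D. \<Sum>g\<in>unitri m. F \<beta> g) = ?N ^ card D * (\<Sum>g\<in>unitri m. \<Prod>\<beta>\<in>D. F \<beta> g)"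
    using insert.prems by (intro insert.IH) blast+
  have two: "(\<Sum>g\<in>unitri m. F \<alpha> g) * (\<Sum>g\<in>unitri m. \<Prod>\<beta>\<in>D. F \<beta> g) =
      ?N * (\<Sum>g\<in>unitri m. F \<alpha> g * (\<Prod>\<beta>\<in>D. F \<beta> g))"
  proof (rule sum_unitri_times_sum[where R = "R \<alpha>"])
    show "F \<alpha> g = F \<alpha> h" if "g \<in> unitri m" "h \<in> unitri m"
      "\<And>i c. i \<in> R \<alpha> \<Longrightarrow> i < m \<Longrightarrow> c < m \<Longrightarrow> g $$ (i, c) = h $$ (i, c)" for g h
      by (rule insert.prems(1)) (use that in auto)
    show "(\<Prod>\<beta>\<in>D. F \<beta> g) = (\<Prod>\<beta>\<in>D. F \<beta> h)" if u: "g \<in> unitri m" "h \<in> unitri m"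
      "\<And>i c. i \<notin> R \<alpha> \<Longrightarrow> i < m \<Longrightarrow> c < m \<Longrightarrow> g $$ (i, c) = h $$ (i, c)" for g h
    proof (intro prod.cong refl)
      fix \<beta> assume b: "\<beta> \<in> D"
      then have "R \<alpha> \<inter> R \<beta> = {}" using insert.prems(2)[of \<alpha> \<beta>] insert.hyps by auto
      then show "F \<beta> g = F \<beta> h" using b u by (intro insert.prems(1)) auto
    qed
  qed
  have "?N * (\<Prod>\<beta>\<in>insert \<alpha> D. \<Sum>g\<in>unitri m. F \<beta> g) =
      (\<Sum>g\<in>unitri m. F \<alpha> g) * (?N * (\<Prod>\<beta>\<in>D. \<Sum>g\<in>unitri m. F \<beta> g))"
    using insert.hyps by (simp add: mult_ac)
  also have "\<dots> = ?N ^ card D * ((\<Sum>g\<in>unitri m. F \<alpha> g) * (\<Sum>g\<in>unitri m. \<Prod>\<beta>\<in>D. F \<beta> g))"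
    unfolding IH by (simp only: mult_ac)
  also have "\<dots> = ?N ^ card (insert \<alpha> D) * (\<Sum>g\<in>unitri m. \<Prod>\<beta>\<in>insert \<alpha> D. F \<beta> g)"
    unfolding two using insert.hyps by (simp add: mult_ac)
  finally show ?case .
qed

subsection \<open>Roots as positions in a staircase matrix\<close>

text \<open>The positive entry of \<open>\<alpha>\<close> has the 0-based coordinates \<open>root_row \<alpha>\<close> and
  \<open>msize ty n - Suc (root_col ty n \<alpha>)\<close>; multiplication by the antidiagonal form matrix moves it to
  column \<open>root_col ty n \<alpha>\<close>.\<close>

fun root_row :: "root \<Rightarrow> nat" where
  "root_row (Diff i j) = nat (i - 1)"
| "root_row (Plus i j) = nat (i - 1)"
| "root_row (Double i) = nat (i - 1)"
| "root_row (Single i) = nat (i - 1)"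

fun root_col :: "gtype \<Rightarrow> nat \<Rightarrow> root \<Rightarrow> nat" where
  "root_col ty n (Diff i j) = msize ty n - nat j"
| "root_col ty n (Plus i j) = nat (j - 1)"
| "root_col ty n (Double i) = nat (i - 1)"
| "root_col ty n (Single i) = n"

lemma roots_cases:
  assumes "\<alpha> \<in> roots ty n"
  obtains (Diff) a b where "\<alpha> = Diff (int a + 1) (int b + 1)" "a < b" "b < n"
  | (Plus) a b where "\<alpha> = Plus (int a + 1) (int b + 1)" "a < b" "b < n"
  | (Double) a where "\<alpha> = Double (int a + 1)" "a < n" "ty = Symplectic"
  | (Single) a where "\<alpha> = Single (int a + 1)" "a < n" "ty = OddOrth"
proof -
  have nn: "\<exists>a. i = int a + 1 \<and> a < n" if "1 \<le> i" "i \<le> int n" for i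
    using that by (intro exI[of _ "nat (i - 1)"]) auto
  consider (1) i j where "\<alpha> = Diff i j" "1 \<le> i" "i < j" "j \<le> int n"
    | (2) i j where "\<alpha> = Plus i j" "1 \<le> i" "i < j" "j \<le> int n"
    | (3) i where "\<alpha> = Double i" "1 \<le> i" "i \<le> int n" "ty = Symplectic"
    | (4) i where "\<alpha> = Single i" "1 \<le> i" "i \<le> int n" "ty = OddOrth"
    using assms unfolding roots_def by (auto split: gtype.splits)
  then show ?thesis
  proof cases
    case 1
    then obtain a b where "i = int a + 1" "j = int b + 1" "b < n" using nn[of i] nn[of j] by auto
    then show ?thesis using 1 that(1)[of a b] by auto
  next
    case 2
    then obtain a b where "i = int a + 1" "j = int b + 1" "b < n" using nn[of i] nn[of j] by auto
    then show ?thesis using 2 that(2)[of a b] by auto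
  next
    case 3
    then obtain a where "i = int a + 1" "a < n" using nn[of i] by auto
    then show ?thesis using 3 that(3)[of a] by auto
  next
    case 4
    then obtain a where "i = int a + 1" "a < n" using nn[of i] by auto
    then show ?thesis using 4 that(4)[of a] by auto
  qed
qed

lemma roots_intros:
  "a < b \<Longrightarrow> b < n \<Longrightarrow> Diff (int a + 1) (int b + 1) \<in> roots ty n"
  "a < b \<Longrightarrow> b < n \<Longrightarrow> Plus (int a + 1) (int b + 1) \<in> roots ty n"
  "a < n \<Longrightarrow> Double (int a + 1) \<in> roots Symplectic n"
  "a < n \<Longrightarrow> Single (int a + 1) \<in> roots OddOrth n"
  unfolding roots_def by auto

lemma root_coords [simp]:
  "root_row (Diff (int a + 1) (int b + 1)) = a" "root_col ty n (Diff (int a + 1) (int b + 1)) = msize ty n - Suc b"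
  "root_row (Plus (int a + 1) (int b + 1)) = a" "root_col ty n (Plus (int a + 1) (int b + 1)) = b"
  "root_row (Double (int a + 1)) = a" "root_col ty n (Double (int a + 1)) = a"
  "root_row (Single (int a + 1)) = a" "root_col ty n (Single (int a + 1)) = n"
  by (auto simp: nat_add_distrib)

declare root_row.simps [simp del] root_col.simps [simp del]

lemma mid_values: "mid Symplectic = 0" "mid EvenOrth = 0" "mid OddOrth = 1"
  by (simp_all add: mid_def)

lemma root_bounds:
  assumes "\<alpha> \<in> roots ty n"
  shows "root_row \<alpha> \<le> root_col ty n \<alpha>" "Suc (root_row \<alpha> + root_col ty n \<alpha>) < msize ty n"
    "root_row \<alpha> = root_col ty n \<alpha> \<Longrightarrow> ty = Symplectic"
    "root_row \<alpha> < msize ty n" "root_col ty n \<alpha> < msize ty n"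
  using assms by (cases rule: roots_cases; auto simp: msize_eq mid_values)+

lemma root_coords_inj:
  assumes "\<alpha> \<in> roots ty n" "\<beta> \<in> roots ty n"
    and "root_row \<alpha> = root_row \<beta>" "root_col ty n \<alpha> = root_col ty n \<beta>"
  shows "\<alpha> = \<beta>"
  using assms(1)
  by (cases rule: roots_cases; use assms(2) in \<open>cases rule: roots_cases\<close>; use assms(3,4) in \<open>auto simp: msize_eq mid_values\<close>)

lemma root_coords_surj:
  assumes "a \<le> b" "Suc (a + b) < msize ty n" "a = b \<Longrightarrow> ty = Symplectic"
  obtains \<alpha> where "\<alpha> \<in> roots ty n" "root_row \<alpha> = a" "root_col ty n \<alpha> = b"
proof -
  have an: "a < n" using assms mid_le[of ty] by (auto simp: msize_eq)
  consider "a = b" | "a < b" "b < n" | "n + mid ty \<le> b" | "n \<le> b" "b < n + mid ty" using assms by linarith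
  then show ?thesis
  proof cases
    case 1
    then show ?thesis using assms(3) roots_intros(3)[OF an] that[of "Double (int a + 1)"] by auto
  next
    case 2
    then show ?thesis using roots_intros(2)[OF 2] that[of "Plus (int a + 1) (int b + 1)"] by auto
  next
    case 3
    define c where "c = msize ty n - Suc b"
    have "a < c" "c < n" "msize ty n - Suc c = b" using assms 3 by (auto simp: c_def msize_eq)
    then show ?thesis using roots_intros(1)[of a c] that[of "Diff (int a + 1) (int c + 1)"] by auto
  next
    case 4
    then have "ty = OddOrth" "b = n" by (auto simp: mid_def split: if_splits)
    then show ?thesis using roots_intros(4)[OF an] that[of "Single (int a + 1)"] by auto
  qed
qed

lemma finite_roots: "finite (roots ty n)"
proof -
  have "inj_on (\<lambda>\<alpha>. (root_row \<alpha>, root_col ty n \<alpha>)) (roots ty n)"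
    by (rule inj_onI) (auto intro: root_coords_inj)
  moreover have "(\<lambda>\<alpha>. (root_row \<alpha>, root_col ty n \<alpha>)) ` roots ty n \<subseteq> {..<msize ty n} \<times> {..<msize ty n}"
    using root_bounds by auto
  ultimately show ?thesis by (meson finite_SigmaI finite_imageD finite_lessThan finite_subset)
qed

lemma pos_simps [simp]:
  "pos ty n (int a + 1) = a" "pos ty n 0 = n" "pos ty n (- (int a + 1)) = msize ty n - Suc a"
  "pos ty n (- int a - 1) = msize ty n - Suc a"
  by (auto simp: pos_def nat_diff_distrib)

lemma all_labels:
  "(\<forall>k. int a + 1 < k \<and> k < int b + 1 \<longrightarrow> P (pos ty n k)) \<longleftrightarrow> (\<forall>c. a < c \<and> c < b \<longrightarrow> P c)"
  "(\<forall>k. int a + 1 < k \<and> k \<le> int n' \<longrightarrow> P (pos ty n k)) \<longleftrightarrow> (\<forall>c. a < c \<and> c < n' \<longrightarrow> P c)"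
proof -
  have 1: "pos ty n k = nat (k - 1)" if "int a + 1 < k" for k using that by (simp add: pos_def)
  show "(\<forall>k. int a + 1 < k \<and> k < int b + 1 \<longrightarrow> P (pos ty n k)) \<longleftrightarrow> (\<forall>c. a < c \<and> c < b \<longrightarrow> P c)"
  proof (intro iffI allI impI)
    fix c assume "\<forall>k. int a + 1 < k \<and> k < int b + 1 \<longrightarrow> P (pos ty n k)" "a < c \<and> c < b"
    then show "P c" by (auto dest: spec[of _ "int c + 1"])
  next
    fix k assume H: "\<forall>c. a < c \<and> c < b \<longrightarrow> P c" and k: "int a + 1 < k \<and> k < int b + 1"
    then have "a < nat (k - 1)" "nat (k - 1) < b" by auto
    then show "P (pos ty n k)" using H 1 k by simp
  qed
  show "(\<forall>k. int a + 1 < k \<and> k \<le> int n' \<longrightarrow> P (pos ty n k)) \<longleftrightarrow> (\<forall>c. a < c \<and> c < n' \<longrightarrow> P c)"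
  proof (intro iffI allI impI)
    fix c assume "\<forall>k. int a + 1 < k \<and> k \<le> int n' \<longrightarrow> P (pos ty n k)" "a < c \<and> c < n'"
    then show "P c" by (auto dest: spec[of _ "int c + 1"])
  next
    fix k assume H: "\<forall>c. a < c \<and> c < n' \<longrightarrow> P c" and k: "int a + 1 < k \<and> k \<le> int n'"
    then have "a < nat (k - 1)" "nat (k - 1) < n'" by auto
    then show "P (pos ty n k)" using H 1 k by simp
  qed
qed

text \<open>The two clauses of \<open>polar_rows\<close> specialise as follows. For a difference
  root the second is vacuous and the first stops at the column of the root; for a sum both are
  active and the second includes the middle column; for 2\<epsilon>_i they coincide; for a single
  \<epsilon>_i the second is vacuous.\<close>

lemma U_root_eq:
  assumes "\<alpha> \<in> roots ty n"
  shows "U_root ty n \<alpha> = {z \<in> U_set ty n. polar_rows ty n (root_row \<alpha>) (root_col ty n \<alpha>) z}"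
  using assms
proof (cases rule: roots_cases)
  case (Diff a b)
  have l: "(\<forall>k. int a + 1 < k \<and> k < int b + 1 \<longrightarrow> z $$ (a, pos ty n k) = 0) \<longleftrightarrow>
      (\<forall>c. a < c \<and> c < b \<longrightarrow> z $$ (a, c) = 0)" for z :: "'a mat"
    by (rule all_labels(1))
  have e: "msize ty n - Suc (msize ty n - Suc b) = b" "n + mid ty \<le> Suc (msize ty n - Suc b)"
    using Diff by (auto simp: msize_eq)
  show ?thesis
    unfolding Diff(1) U_root.simps entry_def pos_simps l polar_rows_def root_coords e(1)
    using Diff e(2) by (intro Collect_cong) auto
next
  case (Plus a b)
  have l1: "(\<forall>k. int a + 1 < k \<and> k \<le> int n \<longrightarrow> z $$ (a, pos ty n k) = 0) \<longleftrightarrow>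
      (\<forall>c. a < c \<and> c < n \<longrightarrow> z $$ (a, c) = 0)" for z :: "'a mat"
    by (rule all_labels(2))
  have l2: "(\<forall>l. int b + 1 < l \<and> l \<le> int n \<or> l = 0 \<and> ty = OddOrth \<longrightarrow> z $$ (b, pos ty n l) = 0) \<longleftrightarrow>
      (\<forall>c. b < c \<and> c < n + mid ty \<longrightarrow> z $$ (b, c) = 0)" for z :: "'a mat"
  proof -
    have "(\<forall>l. int b + 1 < l \<and> l \<le> int n \<or> l = 0 \<and> ty = OddOrth \<longrightarrow> z $$ (b, pos ty n l) = 0) \<longleftrightarrow>
        (\<forall>l. int b + 1 < l \<and> l \<le> int n \<longrightarrow> z $$ (b, pos ty n l) = 0) \<and> (ty = OddOrth \<longrightarrow> z $$ (b, n) = 0)"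
      by (auto dest: spec[of _ 0])
    also have "\<dots> \<longleftrightarrow> (\<forall>c. b < c \<and> c < n \<longrightarrow> z $$ (b, c) = 0) \<and> (ty = OddOrth \<longrightarrow> z $$ (b, n) = 0)"
      by (subst all_labels(2)) (rule refl)
    also have "\<dots> \<longleftrightarrow> (\<forall>c. b < c \<and> c < n + mid ty \<longrightarrow> z $$ (b, c) = 0)"
      using Plus by (auto simp: mid_def less_Suc_eq)
    finally show ?thesis .
  qed
  have e: "n \<le> msize ty n - Suc b" using Plus by (auto simp: msize_eq)
  show ?thesis
    unfolding Plus(1) U_root.simps entry_def pos_simps l1 l2 polar_rows_def root_coords
    using e by (intro Collect_cong) auto
next
  case (Double a)
  have l: "(\<forall>k. int a + 1 < k \<and> k \<le> int n \<longrightarrow> z $$ (a, pos ty n k) = 0) \<longleftrightarrow>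
      (\<forall>c. a < c \<and> c < n \<longrightarrow> z $$ (a, c) = 0)" for z :: "'a mat"
    by (rule all_labels(2))
  have e: "n \<le> msize ty n - Suc a" using Double by (auto simp: msize_eq)
  show ?thesis
    unfolding Double(1) U_root.simps entry_def pos_simps l polar_rows_def root_coords
    using e Double by (intro Collect_cong) (auto simp: mid_def)
next
  case (Single a)
  have l: "(\<forall>k. int a + 1 < k \<and> k \<le> int n \<longrightarrow> z $$ (a, pos ty n k) = 0) \<longleftrightarrow>
      (\<forall>c. a < c \<and> c < n \<longrightarrow> z $$ (a, c) = 0)" for z :: "'a mat"
    by (rule all_labels(2))
  have e: "msize ty n - Suc n = n" "n + mid ty = Suc n" using Single by (auto simp: msize_eq mid_def)
  show ?thesis
    unfolding Single(1) U_root.simps entry_def pos_simps l polar_rows_def root_coords e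
    by (intro Collect_cong) auto
qed

lemma pos_entry_eqI:
  assumes "(i, j) \<in> entries \<alpha>" "1 \<le> i" "i \<le> int n" "prec i j" "prec j (- i) \<or> j = - i"
    and "\<And>i' j'. (i', j') \<in> entries \<alpha> \<Longrightarrow> 1 \<le> i' \<Longrightarrow> prec j' (- i') \<or> j' = - i' \<Longrightarrow> i' = i \<and> j' = j"
  shows "pos_entry n \<alpha> = (i, j)"
  unfolding pos_entry_def
proof (rule the_equality)
  show "case (i, j) of (i, j) \<Rightarrow> (i, j) \<in> entries \<alpha> \<and> 1 \<le> i \<and> i \<le> int n \<and> prec i j \<and> (prec j (- i) \<or> j = - i)"
    using assms(1-5) by simp
next
  fix q :: "int \<times> int"
  assume q: "case q of (i, j) \<Rightarrow> (i, j) \<in> entries \<alpha> \<and> 1 \<le> i \<and> i \<le> int n \<and> prec i j \<and> (prec j (- i) \<or> j = - i)"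
  obtain i' j' where ij: "q = (i', j')" by (cases q)
  have "i' = i \<and> j' = j" by (rule assms(6)) (use q[unfolded ij split_conv] in blast)+
  then show "q = (i, j)" using ij by simp
qed

lemma elem_linear_eq:
  assumes "\<alpha> \<in> roots ty n"
  shows "elem_linear ty n \<theta> \<alpha> r x = \<theta> (r * x $$ (root_row \<alpha>, msize ty n - Suc (root_col ty n \<alpha>)))"
  using assms
proof (cases rule: roots_cases)
  case (Diff a b)
  have "pos_entry n \<alpha> = (int a + 1, int b + 1)"
    unfolding Diff(1) by (rule pos_entry_eqI) (use Diff in \<open>auto simp: prec_def\<close>)
  moreover have "msize ty n - Suc (msize ty n - Suc b) = b" using Diff by (auto simp: msize_eq)
  ultimately show ?thesis by (simp add: elem_linear_def entry_def Diff(1))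
next
  case (Plus a b)
  have "pos_entry n \<alpha> = (int a + 1, - (int b + 1))"
    unfolding Plus(1) by (rule pos_entry_eqI) (use Plus in \<open>auto simp: prec_def\<close>)
  then show ?thesis by (simp add: elem_linear_def entry_def Plus(1))
next
  case (Double a)
  have "pos_entry n \<alpha> = (int a + 1, - (int a + 1))"
    unfolding Double(1) by (rule pos_entry_eqI) (use Double in \<open>auto simp: prec_def\<close>)
  then show ?thesis by (simp add: elem_linear_def entry_def Double(1))
next
  case (Single a)
  have "pos_entry n \<alpha> = (int a + 1, 0)"
    unfolding Single(1) by (rule pos_entry_eqI) (use Single in \<open>auto simp: prec_def\<close>)
  moreover have "msize ty n - Suc n = n" using Single by (auto simp: msize_eq mid_def)
  ultimately show ?thesis by (simp add: elem_linear_def entry_def Single(1))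
qed

text \<open>The support of a root vector after multiplication by \<Omega>: two mirror positions,
  which coincide for the roots 2\<epsilon>_i.\<close>

definition root_positions :: "gtype \<Rightarrow> nat \<Rightarrow> root \<Rightarrow> (nat \<times> nat) set" where
  "root_positions ty n \<alpha> = {(root_row \<alpha>, root_col ty n \<alpha>), (root_col ty n \<alpha>, root_row \<alpha>)}"

lemma root_positions_overlap:
  assumes "\<alpha> \<in> roots ty n" "\<beta> \<in> roots ty n"
    and "(t, c) \<in> root_positions ty n \<alpha>" "(t, c) \<in> root_positions ty n \<beta>"
  shows "\<alpha> = \<beta>"
proof -
  have "root_row \<alpha> = root_row \<beta> \<and> root_col ty n \<alpha> = root_col ty n \<beta>"
    using root_bounds(1)[OF assms(1)] root_bounds(1)[OF assms(2)] assms(3,4)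
    unfolding root_positions_def by auto
  then show ?thesis using root_coords_inj[OF assms(1,2)] by blast
qed

definition labels :: "gtype \<Rightarrow> nat \<Rightarrow> int set" where
  "labels ty n = {x. - int n \<le> x \<and> x \<le> int n \<and> (x = 0 \<longrightarrow> ty = OddOrth)}"

lemma pos_inj:
  assumes "x \<in> labels ty n" "y \<in> labels ty n" "pos ty n x = pos ty n y"
  shows "x = y"
  using assms by (auto simp: labels_def pos_def msize_eq mid_def split: if_splits)

lemma pos_less: "x \<in> labels ty n \<Longrightarrow> pos ty n x < msize ty n"
  by (auto simp: labels_def pos_def msize_eq mid_def split: if_splits)

lemma entries_positions:
  assumes "\<alpha> \<in> roots ty n"
  shows "(\<lambda>(x, y). (pos ty n x, msize ty n - Suc (pos ty n y))) ` entries \<alpha> = root_positions ty n \<alpha>"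
    and "entries \<alpha> \<subseteq> labels ty n \<times> labels ty n"
proof -
  show "(\<lambda>(x, y). (pos ty n x, msize ty n - Suc (pos ty n y))) ` entries \<alpha> = root_positions ty n \<alpha>"
    using assms
  proof (cases rule: roots_cases)
    case (Diff a b)
    have "msize ty n - Suc (msize ty n - Suc a) = a" using Diff by (auto simp: msize_eq)
    then show ?thesis by (simp add: Diff(1) root_positions_def)
  next
    case (Plus a b)
    have "msize ty n - Suc (msize ty n - Suc a) = a" "msize ty n - Suc (msize ty n - Suc b) = b"
      using Plus by (auto simp: msize_eq)
    then show ?thesis by (simp add: Plus(1) root_positions_def)
  next
    case (Double a)
    have "msize ty n - Suc (msize ty n - Suc a) = a" using Double by (auto simp: msize_eq)
    then show ?thesis by (simp add: Double(1) root_positions_def)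
  next
    case (Single a)
    have "msize ty n - Suc (msize ty n - Suc a) = a" "msize ty n - Suc n = n"
      using Single by (auto simp: msize_eq mid_def)
    then show ?thesis by (simp add: Single(1) root_positions_def)
  qed
  show "entries \<alpha> \<subseteq> labels ty n \<times> labels ty n"
    using assms by (cases rule: roots_cases) (auto simp: labels_def)
qed

text \<open>Reflecting the columns turns the entries of a root into a symmetric pair of positions.
  Row and column conditions then become the same one: the index sets of distinct roots are
  disjoint.\<close>

lemma basic_iff:
  "basic ty n D \<longleftrightarrow> D \<subseteq> roots ty n \<and>
    (\<forall>\<alpha>\<in>D. \<forall>\<beta>\<in>D. \<alpha> \<noteq> \<beta> \<longrightarrow> {root_row \<alpha>, root_col ty n \<alpha>} \<inter> {root_row \<beta>, root_col ty n \<beta>} = {})"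
    (is "_ \<longleftrightarrow> _ \<and> ?disj")
proof (cases "D \<subseteq> roots ty n")
  case sub: True
  let ?m = "msize ty n"
  let ?f = "\<lambda>(x, y). (pos ty n x, ?m - Suc (pos ty n y))"
  have img: "?f ` entries \<alpha> = root_positions ty n \<alpha>" and lab: "entries \<alpha> \<subseteq> labels ty n \<times> labels ty n"
    if "\<alpha> \<in> D" for \<alpha> using entries_positions[OF subsetD[OF sub that]] by auto
  have fwd: "(pos ty n x, ?m - Suc (pos ty n y)) \<in> root_positions ty n \<alpha>" "x \<in> labels ty n" "y \<in> labels ty n"
    if "\<alpha> \<in> D" "(x, y) \<in> entries \<alpha>" for \<alpha> x y
    using img[OF that(1)] lab[OF that(1)] that(2) by force+
  have mirror: "y = z" if "y \<in> labels ty n" "z \<in> labels ty n" "?m - Suc (pos ty n y) = ?m - Suc (pos ty n z)" for y z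
    using that pos_less[OF that(1)] pos_less[OF that(2)] by (intro pos_inj[OF that(1,2)]) linarith
  have disj: ?disj if b: "basic ty n D"
  proof (intro ballI impI, rule ccontr)
    fix \<alpha> \<beta> assume ab: "\<alpha> \<in> D" "\<beta> \<in> D" "\<alpha> \<noteq> \<beta>"
      and "{root_row \<alpha>, root_col ty n \<alpha>} \<inter> {root_row \<beta>, root_col ty n \<beta>} \<noteq> {}"
    then obtain t c d where t: "(t, c) \<in> root_positions ty n \<alpha>" "(t, d) \<in> root_positions ty n \<beta>"
      unfolding root_positions_def by blast
    obtain x y where xy: "(x, y) \<in> entries \<alpha>" "pos ty n x = t" "?m - Suc (pos ty n y) = c"
      using t(1) unfolding img[OF ab(1), symmetric] by auto
    obtain x' z where xz: "(x', z) \<in> entries \<beta>" "pos ty n x' = t" "?m - Suc (pos ty n z) = d"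
      using t(2) unfolding img[OF ab(2), symmetric] by auto
    have "x' = x" using pos_inj[of x' ty n x] fwd[OF ab(1) xy(1)] fwd[OF ab(2) xz(1)] xy xz by simp
    then have "y = z" using b xy xz ab unfolding basic_def by blast
    then have "c = d" using xy xz by simp
    then show False using root_positions_overlap[of \<alpha> ty n \<beta> t c] t ab sub by blast
  qed
  have bas: "basic ty n D" if ?disj
    unfolding basic_def
  proof (intro conjI sub allI impI)
    fix x y z assume "(x, y) \<in> \<Union> (entries ` D)" "(x, z) \<in> \<Union> (entries ` D)"
    then obtain \<alpha> \<beta> where ab: "\<alpha> \<in> D" "(x, y) \<in> entries \<alpha>" "\<beta> \<in> D" "(x, z) \<in> entries \<beta>" by blast
    note f = fwd[OF ab(1,2)] fwd[OF ab(3,4)]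
    have "\<alpha> = \<beta>" using that f(1,4) ab unfolding root_positions_def by blast
    then have "?m - Suc (pos ty n y) = ?m - Suc (pos ty n z)" using f(1,4) unfolding root_positions_def by auto
    then show "y = z" using mirror f by blast
  next
    fix x y z assume "(x, z) \<in> \<Union> (entries ` D)" "(y, z) \<in> \<Union> (entries ` D)"
    then obtain \<alpha> \<beta> where ab: "\<alpha> \<in> D" "(x, z) \<in> entries \<alpha>" "\<beta> \<in> D" "(y, z) \<in> entries \<beta>" by blast
    note f = fwd[OF ab(1,2)] fwd[OF ab(3,4)]
    have "\<alpha> = \<beta>" using that f(1,4) ab unfolding root_positions_def by blast
    then have "pos ty n x = pos ty n y" using f(1,4) unfolding root_positions_def by auto
    then show "x = y" using pos_inj f by blast
  qed
  show ?thesis using disj bas sub by blast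
qed (auto simp: basic_def)

subsection \<open>Basic pairs as monomial staircase matrices\<close>

lemma unit_mat_index:
  "x < msize ty n \<Longrightarrow> y < msize ty n \<Longrightarrow>
    unit_mat ty n i j $$ (x, y) = (if x = pos ty n i \<and> y = pos ty n j then 1 else 0)"
  by (simp add: unit_mat_def)

lemma unit_mat_dim [simp]: "dim_row (unit_mat ty n i j) = msize ty n" "dim_col (unit_mat ty n i j) = msize ty n"
  by (simp_all add: unit_mat_def)

text \<open>Accounts for the signs in \<open>e_root\<close>: they are exactly those for which the
  two entries, after multiplication by \<Omega>, differ by \<open>form_sign\<close>.\<close>

lemma e_root_form_index:
  assumes "\<alpha> \<in> roots ty n" and xy: "x < msize ty n" "y < msize ty n"
  shows "e_root ty n \<alpha> $$ (x, msize ty n - Suc y) * column_sign ty n y =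
    column_sign ty n (root_col ty n \<alpha>) *
      (if x = root_row \<alpha> \<and> y = root_col ty n \<alpha> then 1
       else if x = root_col ty n \<alpha> \<and> y = root_row \<alpha> then form_sign ty else 0 :: 'a::field)"
proof -
  let ?m = "msize ty n"
  have y': "?m - Suc y < ?m" using xy by simp
  have mir: "?m - Suc y = c \<longleftrightarrow> y = ?m - Suc c" if "c < ?m" for c using xy that by auto
  have mir': "?m - Suc y = ?m - Suc c \<longleftrightarrow> y = c" if "c < ?m" for c using xy that by auto
  from assms(1) show ?thesis
  proof (cases rule: roots_cases)
    case (Diff a b)
    have ab: "a < ?m" "b < ?m" "a < n" "?m - Suc b \<ge> n" "a \<noteq> ?m - Suc b" using Diff by (auto simp: msize_eq)
    have s: "column_sign ty n a = (- form_sign ty :: 'a)" "column_sign ty n (?m - Suc b) = (1 :: 'a)"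
      using ab by (auto simp: column_sign_def form_sign_def)
    show ?thesis
      unfolding Diff(1) using xy y' ab mir[OF ab(2)] mir'[OF ab(1)] s by (auto simp: unit_mat_index)
  next
    case (Plus a b)
    have ab: "a < ?m" "b < ?m" "a < n" "b < n" "a \<noteq> b" using Plus by (auto simp: msize_eq)
    have s: "column_sign ty n a = (- form_sign ty :: 'a)" "column_sign ty n b = (- form_sign ty :: 'a)"
      using ab by (auto simp: column_sign_def form_sign_def)
    show ?thesis
    proof (cases "ty = Symplectic")
      case True
      then show ?thesis
        unfolding Plus(1) using xy y' ab mir'[OF ab(1)] mir'[OF ab(2)] s by (auto simp: unit_mat_index form_sign_def)
    next
      case False
      then show ?thesis
        unfolding Plus(1) using xy y' ab mir'[OF ab(1)] mir'[OF ab(2)] s by (auto simp: unit_mat_index form_sign_def)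
    qed
  next
    case (Double a)
    have ab: "a < ?m" using Double by (auto simp: msize_eq)
    show ?thesis
      unfolding Double(1) using xy y' ab mir'[OF ab] by (auto simp: unit_mat_index)
  next
    case (Single a)
    have ab: "a < ?m" "n < ?m" "?m - Suc n = n" "a < n" using Single by (auto simp: msize_eq mid_def)
    have s: "column_sign ty n a = (1 :: 'a)" "column_sign ty n n = (1 :: 'a)" "form_sign ty = (- 1 :: 'a)"
      using Single by (auto simp: column_sign_def form_sign_def)
    show ?thesis
      unfolding Single(1) using xy y' ab mir[OF ab(2)] mir'[OF ab(1)] s by (auto simp: unit_mat_index)
  qed
qed

lemma e_pair_carrier [simp]: "e_pair ty n D \<phi> \<in> carrier_mat (msize ty n) (msize ty n)"
  by (simp add: e_pair_def)

text \<open>This is \<open>e_pair\<close> in staircase form. The Cayley coordinate of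
  \<open>z_rep\<close> is in general only congruent to it, since \<open>a_mat\<close> and the Cayley
  transform are different parametrisations.\<close>

definition pair_matrix :: "gtype \<Rightarrow> nat \<Rightarrow> root set \<times> (root \<Rightarrow> 'a) \<Rightarrow> 'a::field mat" where
  "pair_matrix ty n = (\<lambda>(D, \<phi>). e_pair ty n D \<phi> * form_matrix ty n)"

lemma pair_matrix_carrier: "pair_matrix ty n P \<in> carrier_mat (msize ty n) (msize ty n)"
  unfolding pair_matrix_def by (cases P) (simp add: mult_carrier_mat[OF e_pair_carrier form_matrix_carrier])

lemma pair_matrix_index:
  assumes "D \<subseteq> roots ty n" and xy: "x < msize ty n" "y < msize ty n"
  shows "pair_matrix ty n (D, \<phi>) $$ (x, y) = (\<Sum>\<alpha>\<in>D. \<phi> \<alpha> * (column_sign ty n (root_col ty n \<alpha>) *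
      (if x = root_row \<alpha> \<and> y = root_col ty n \<alpha> then 1
       else if x = root_col ty n \<alpha> \<and> y = root_row \<alpha> then form_sign ty else 0 :: 'a::field)))"
proof -
  have "pair_matrix ty n (D, \<phi>) $$ (x, y) = e_pair ty n D \<phi> $$ (x, msize ty n - Suc y) * column_sign ty n y"
    unfolding pair_matrix_def using mult_form_matrix_index[OF e_pair_carrier xy] by simp
  also have "\<dots> = (\<Sum>\<alpha>\<in>D. \<phi> \<alpha> * (e_root ty n \<alpha> $$ (x, msize ty n - Suc y) * column_sign ty n y))"
    using xy by (simp add: e_pair_def sum_distrib_right mult.assoc)
  also have "\<dots> = (\<Sum>\<alpha>\<in>D. \<phi> \<alpha> * (column_sign ty n (root_col ty n \<alpha>) *
      (if x = root_row \<alpha> \<and> y = root_col ty n \<alpha> then 1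
       else if x = root_col ty n \<alpha> \<and> y = root_row \<alpha> then form_sign ty else 0 :: 'a::field)))"
    using assms(1) by (intro sum.cong refl) (subst e_root_form_index[OF _ xy], auto)
  finally show ?thesis .
qed

lemma basic_finite: "basic ty n D \<Longrightarrow> finite D"
  using finite_subset[OF _ finite_roots] by (auto simp: basic_def)

lemma pair_matrix_at:
  assumes D: "basic ty n D" and \<alpha>: "\<alpha> \<in> D" and xy: "(x, y) \<in> root_positions ty n \<alpha>"
  shows "pair_matrix ty n (D, \<phi>) $$ (x, y) = \<phi> \<alpha> * (column_sign ty n (root_col ty n \<alpha>) *
      (if x = root_row \<alpha> \<and> y = root_col ty n \<alpha> then 1 else form_sign ty :: 'a::field))"
proof -
  have sub: "D \<subseteq> roots ty n" and disj: "\<And>\<beta>. \<beta> \<in> D \<Longrightarrow> \<beta> \<noteq> \<alpha> \<Longrightarrow>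
      {root_row \<alpha>, root_col ty n \<alpha>} \<inter> {root_row \<beta>, root_col ty n \<beta>} = {}"
    using D \<alpha> unfolding basic_iff by blast+
  have xym: "x < msize ty n" "y < msize ty n"
    using xy root_bounds(4,5)[of \<alpha> ty n] sub \<alpha> by (auto simp: root_positions_def)
  let ?g = "\<lambda>\<beta>. \<phi> \<beta> * (column_sign ty n (root_col ty n \<beta>) *
      (if x = root_row \<beta> \<and> y = root_col ty n \<beta> then 1
       else if x = root_col ty n \<beta> \<and> y = root_row \<beta> then form_sign ty else 0 :: 'a))"
  have zero: "?g \<beta> = 0" if "\<beta> \<in> D - {\<alpha>}" for \<beta>
  proof -
    have "x \<in> {root_row \<alpha>, root_col ty n \<alpha>}" using xy by (auto simp: root_positions_def)
    then have "x \<noteq> root_row \<beta>" "x \<noteq> root_col ty n \<beta>" using disj[of \<beta>] that by auto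
    then show ?thesis by simp
  qed
  have "pair_matrix ty n (D, \<phi>) $$ (x, y) = ?g \<alpha> + (\<Sum>\<beta>\<in>D - {\<alpha>}. ?g \<beta>)"
    unfolding pair_matrix_index[OF sub xym] by (rule sum.remove[OF basic_finite[OF D] \<alpha>])
  also have "(\<Sum>\<beta>\<in>D - {\<alpha>}. ?g \<beta>) = 0" using zero by (rule sum.neutral[rule_format])
  finally show ?thesis using xy by (auto simp: root_positions_def)
qed

lemma pair_matrix_zero:
  assumes D: "D \<subseteq> roots ty n" and xy: "x < msize ty n" "y < msize ty n"
    and none: "\<And>\<alpha>. \<alpha> \<in> D \<Longrightarrow> (x, y) \<notin> root_positions ty n \<alpha>"
  shows "pair_matrix ty n (D, \<phi>) $$ (x, y) = (0 :: 'a::field)"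
  unfolding pair_matrix_index[OF D xy]
  by (rule sum.neutral) (use none in \<open>auto simp: root_positions_def\<close>)

lemma form_sign_nz [simp]: "form_sign ty \<noteq> (0 :: 'a::field)"
  by (simp add: form_sign_def)

lemma pair_matrix_monomial:
  assumes D: "basic ty n D"
  shows "pair_matrix ty n (D, \<phi>) \<in> monomials (form_sign ty :: 'a::field) (msize ty n)"
proof -
  let ?m = "msize ty n" and ?M = "pair_matrix ty n (D, \<phi>)"
  have sub: "D \<subseteq> roots ty n" using D by (simp add: basic_def)
  have pos: "\<exists>\<alpha>\<in>D. (x, y) \<in> root_positions ty n \<alpha>" if "?M $$ (x, y) \<noteq> 0" "x < ?m" "y < ?m" for x y
    using that pair_matrix_zero[OF sub that(2,3)] by blast
  have swap: "(y, x) \<in> root_positions ty n \<alpha> \<longleftrightarrow> (x, y) \<in> root_positions ty n \<alpha>" for x y \<alpha>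
    by (auto simp: root_positions_def)
  have st: "?M \<in> staircase (form_sign ty) ?m"
  proof (rule staircaseI[OF pair_matrix_carrier])
    fix x y assume xy: "x < ?m" "y < ?m"
    show "?M $$ (y, x) = form_sign ty * ?M $$ (x, y)"
    proof (cases "\<exists>\<alpha>\<in>D. (x, y) \<in> root_positions ty n \<alpha>")
      case True
      then obtain \<alpha> where a: "\<alpha> \<in> D" "(x, y) \<in> root_positions ty n \<alpha>" by blast
      then have "(y, x) \<in> root_positions ty n \<alpha>" using swap by blast
      have diag: "root_row \<alpha> = root_col ty n \<alpha> \<Longrightarrow> form_sign ty = (1 :: 'a)"
        using root_bounds(3)[of \<alpha> ty n] a sub by (auto simp: form_sign_def)
      define s where "s = column_sign ty n (root_col ty n \<alpha>) * \<phi> \<alpha>"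
      have at: "?M $$ (x, y) = (if x = root_row \<alpha> \<and> y = root_col ty n \<alpha> then s else form_sign ty * s)"
        "?M $$ (y, x) = (if y = root_row \<alpha> \<and> x = root_col ty n \<alpha> then s else form_sign ty * s)"
        unfolding pair_matrix_at[OF D a] pair_matrix_at[OF D a(1) \<open>(y, x) \<in> root_positions ty n \<alpha>\<close>] s_def
        by (simp_all add: mult_ac)
      have ee: "form_sign ty * (form_sign ty * s) = s" by (simp add: mult.assoc[symmetric])
      show ?thesis
      proof (cases "root_row \<alpha> = root_col ty n \<alpha>")
        case True
        then show ?thesis using a(2) unfolding at by (simp add: root_positions_def diag)
      next
        case False
        then show ?thesis using a(2) unfolding at root_positions_def by (elim insertE) (simp_all add: ee)
      qed
    next
      case False
      have "?M $$ (x, y) = 0" by (rule pair_matrix_zero[OF sub xy]) (use False in blast)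
      moreover have "?M $$ (y, x) = 0" by (rule pair_matrix_zero[OF sub xy(2,1)]) (use False swap in blast)
      ultimately show ?thesis by simp
    qed
    show "?M $$ (x, y) = 0" if "?m \<le> Suc (x + y)"
    proof (rule pair_matrix_zero[OF sub xy])
      fix \<alpha> assume "\<alpha> \<in> D"
      then show "(x, y) \<notin> root_positions ty n \<alpha>"
        using root_bounds(2)[of \<alpha> ty n] sub that by (auto simp: root_positions_def)
    qed
  qed
  moreover have "monomial_rows ?m ?M"
    unfolding monomial_rows_def
  proof (intro allI impI)
    fix x y z assume xyz: "x < ?m" "y < ?m" "z < ?m" "?M $$ (x, y) \<noteq> 0" "?M $$ (x, z) \<noteq> 0"
    obtain \<alpha> \<beta> where ab: "\<alpha> \<in> D" "(x, y) \<in> root_positions ty n \<alpha>" "\<beta> \<in> D" "(x, z) \<in> root_positions ty n \<beta>"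
      using pos xyz by meson
    then have "\<alpha> = \<beta>" using D unfolding basic_iff root_positions_def by blast
    then show "y = z" using ab by (auto simp: root_positions_def)
  qed
  ultimately show ?thesis by (simp add: monomials_def)
qed

text \<open>The sign is its own inverse and undoes the one that \<Omega> introduces;
  \<open>restrict\<close> makes the map extensional, as \<open>basic_pairs\<close> requires.\<close>

definition matrix_pair :: "gtype \<Rightarrow> nat \<Rightarrow> 'a::field mat \<Rightarrow> root set \<times> (root \<Rightarrow> 'a)" where
  "matrix_pair ty n M = (let D = {\<alpha> \<in> roots ty n. M $$ (root_row \<alpha>, root_col ty n \<alpha>) \<noteq> 0} in
     (D, restrict (\<lambda>\<alpha>. column_sign ty n (root_col ty n \<alpha>) * M $$ (root_row \<alpha>, root_col ty n \<alpha>)) D))"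

lemma matrix_pair_basic:
  fixes M :: "'a::field mat"
  assumes M: "M \<in> monomials (form_sign ty) (msize ty n)"
  shows "matrix_pair ty n M \<in> basic_pairs ty n"
proof -
  let ?m = "msize ty n"
  define D where "D = {\<alpha> \<in> roots ty n. M $$ (root_row \<alpha>, root_col ty n \<alpha>) \<noteq> 0}"
  have Ms: "M \<in> eps_symmetric (form_sign ty) ?m" "monomial_rows ?m M"
    using M by (auto simp: monomials_def staircase_eps)
  have nz: "x < ?m" "y < ?m" "M $$ (x, y) \<noteq> 0" if "\<alpha> \<in> D" "(x, y) \<in> root_positions ty n \<alpha>" for \<alpha> x y
    using that root_bounds(4,5)[of \<alpha> ty n] eps_symmetricD[OF Ms(1), of "root_row \<alpha>" "root_col ty n \<alpha>"]
    by (auto simp: D_def root_positions_def)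
  have "basic ty n D"
    unfolding basic_iff
  proof (intro conjI ballI impI, goal_cases)
    case 1
    then show ?case by (auto simp: D_def)
  next
    case (2 \<alpha> \<beta>)
    show ?case
    proof (rule ccontr)
      assume "{root_row \<alpha>, root_col ty n \<alpha>} \<inter> {root_row \<beta>, root_col ty n \<beta>} \<noteq> {}"
      then obtain t c d where t: "(t, c) \<in> root_positions ty n \<alpha>" "(t, d) \<in> root_positions ty n \<beta>"
        unfolding root_positions_def by blast
      then have "c = d" using nz[OF 2(1) t(1)] nz[OF 2(2) t(2)] Ms(2) unfolding monomial_rows_def by blast
      then show False using root_positions_overlap[of \<alpha> ty n \<beta> t c] t 2 by (auto simp: D_def)
    qed
  qed
  then show ?thesis
    unfolding matrix_pair_def basic_pairs_def D_def[symmetric] Let_def by (auto simp: D_def)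
qed

lemma pair_matrix_matrix_pair:
  fixes M :: "'a::field mat"
  assumes two: "(2 :: 'a) \<noteq> 0" and M: "M \<in> monomials (form_sign ty) (msize ty n)"
  shows "pair_matrix ty n (matrix_pair ty n M) = M"
proof -
  let ?m = "msize ty n"
  define D where "D = {\<alpha> \<in> roots ty n. M $$ (root_row \<alpha>, root_col ty n \<alpha>) \<noteq> 0}"
  define \<phi> where "\<phi> = restrict (\<lambda>\<alpha>. column_sign ty n (root_col ty n \<alpha>) * M $$ (root_row \<alpha>, root_col ty n \<alpha>)) D"
  have mp: "matrix_pair ty n M = (D, \<phi>)" by (simp add: matrix_pair_def Let_def D_def \<phi>_def)
  have D: "basic ty n D" using matrix_pair_basic[OF M] by (simp add: mp basic_pairs_def)
  have sub: "D \<subseteq> roots ty n" by (auto simp: D_def)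
  have st: "M \<in> staircase (form_sign ty) ?m" using M by (simp add: monomials_def)
  let ?X = "pair_matrix ty n (D, \<phi>)"
  have upper: "?X $$ (x, y) = M $$ (x, y)" if xy: "x < ?m" "y < ?m" "x \<le> y" for x y
  proof (cases "M $$ (x, y) = 0")
    case False
    have "Suc (x + y) < ?m" using False staircase_zero[OF st xy(1,2)] by (meson not_le)
    \<comment> \<open>In the orthogonal case there is no root on the diagonal; antisymmetry and
      invertibility of 2 make the diagonal zero.\<close>
    moreover have "ty = Symplectic" if "x = y"
    proof (rule ccontr)
      assume "ty \<noteq> Symplectic"
      then have "M $$ (x, x) = - M $$ (x, x)"
        using eps_symmetricD[OF staircase_eps[OF st] xy(1) xy(1)] by (simp add: form_sign_def)
      then have "2 * M $$ (x, x) = 0" by (metis add_eq_0_iff mult_2)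
      then show False using two False that by simp
    qed
    ultimately obtain \<alpha> where a: "\<alpha> \<in> roots ty n" "root_row \<alpha> = x" "root_col ty n \<alpha> = y"
      using root_coords_surj[OF xy(3)] by blast
    then have aD: "\<alpha> \<in> D" using False by (simp add: D_def)
    have "(x, y) \<in> root_positions ty n \<alpha>" using a by (simp add: root_positions_def)
    from pair_matrix_at[OF D aD this, of \<phi>] show ?thesis
      using a aD by (simp add: \<phi>_def mult.commute[of _ "M $$ (x, y)"] mult.assoc)
  next
    case True
    show ?thesis
      unfolding True
    proof (rule pair_matrix_zero[OF sub xy(1,2)])
      fix \<alpha> assume "\<alpha> \<in> D"
      then show "(x, y) \<notin> root_positions ty n \<alpha>"
        using True xy root_bounds(1)[of \<alpha> ty n] by (auto simp: D_def root_positions_def)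
    qed
  qed
  have Xst: "?X \<in> eps_symmetric (form_sign ty) ?m"
    using pair_matrix_monomial[OF D, of \<phi>] by (simp add: monomials_def staircase_eps)
  have "?X $$ (x, y) = M $$ (x, y)" if xy: "x < ?m" "y < ?m" for x y
  proof (cases "x \<le> y")
    case True
    then show ?thesis using upper xy by blast
  next
    case False
    then have "?X $$ (y, x) = M $$ (y, x)" using upper[OF xy(2,1)] by simp
    then show ?thesis
      using eps_symmetricD[OF Xst xy(2,1)] eps_symmetricD[OF staircase_eps[OF st] xy(2,1)] by simp
  qed
  then show ?thesis
    unfolding mp using pair_matrix_carrier[of ty n "(D, \<phi>)"] staircase_carrier[OF st] by (intro eq_matI) auto
qed

lemma matrix_pair_pair_matrix:
  assumes "P \<in> basic_pairs ty n"
  shows "matrix_pair ty n (pair_matrix ty n P) = (P :: root set \<times> (root \<Rightarrow> 'a::field))"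
proof -
  obtain D \<phi> where P: "P = (D, \<phi>)" by (cases P)
  have D: "basic ty n D" and \<phi>: "\<phi> \<in> D \<rightarrow>\<^sub>E (UNIV - {0})" using assms by (auto simp: P basic_pairs_def)
  have sub: "D \<subseteq> roots ty n" using D by (simp add: basic_def)
  let ?M = "pair_matrix ty n (D, \<phi>)"
  have at: "?M $$ (root_row \<alpha>, root_col ty n \<alpha>) = \<phi> \<alpha> * column_sign ty n (root_col ty n \<alpha>)" if "\<alpha> \<in> D" for \<alpha>
    using pair_matrix_at[OF D that, of "root_row \<alpha>" "root_col ty n \<alpha>" \<phi>] by (simp add: root_positions_def)
  have "?M $$ (root_row \<alpha>, root_col ty n \<alpha>) = 0" if "\<alpha> \<in> roots ty n" "\<alpha> \<notin> D" for \<alpha>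
  proof (rule pair_matrix_zero[OF sub root_bounds(4,5)[OF that(1)]])
    fix \<beta> assume b: "\<beta> \<in> D"
    show "(root_row \<alpha>, root_col ty n \<alpha>) \<notin> root_positions ty n \<beta>"
    proof
      assume "(root_row \<alpha>, root_col ty n \<alpha>) \<in> root_positions ty n \<beta>"
      moreover have "(root_row \<alpha>, root_col ty n \<alpha>) \<in> root_positions ty n \<alpha>" by (simp add: root_positions_def)
      ultimately show False using root_positions_overlap[OF that(1)] b sub that(2) by blast
    qed
  qed
  moreover have "\<phi> \<alpha> \<noteq> 0" if "\<alpha> \<in> D" for \<alpha> using \<phi> that by auto
  ultimately have Deq: "{\<alpha> \<in> roots ty n. ?M $$ (root_row \<alpha>, root_col ty n \<alpha>) \<noteq> 0} = D"
    using at sub by fastforce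
  have "restrict (\<lambda>\<alpha>. column_sign ty n (root_col ty n \<alpha>) * ?M $$ (root_row \<alpha>, root_col ty n \<alpha>)) D = \<phi>"
  proof (rule ext)
    fix \<alpha>
    show "restrict (\<lambda>\<alpha>. column_sign ty n (root_col ty n \<alpha>) * ?M $$ (root_row \<alpha>, root_col ty n \<alpha>)) D \<alpha> = \<phi> \<alpha>"
    proof (cases "\<alpha> \<in> D")
      case True
      have "column_sign ty n (root_col ty n \<alpha>) * (\<phi> \<alpha> * column_sign ty n (root_col ty n \<alpha>)) =
          \<phi> \<alpha> * (column_sign ty n (root_col ty n \<alpha>) * column_sign ty n (root_col ty n \<alpha>))" by (simp only: mult_ac)
      then show ?thesis using True at by simp
    next
      case False
      then show ?thesis using \<phi> by (auto simp: PiE_def extensional_def)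
    qed
  qed
  then show ?thesis unfolding P matrix_pair_def Deq by (simp add: Let_def)
qed

subsection \<open>Supercharacters as orbit sums\<close>

text \<open>Since \<open>root_row\<close> never exceeds \<open>root_col\<close>, the half pairing
  picks one of the two positions of each root; the summands are the exponents of the elementary
  characters.\<close>

lemma upper_pairing_pair_matrix:
  assumes D: "D \<subseteq> roots ty n"
  shows "upper_pairing (msize ty n) (pair_matrix ty n (D, \<phi>)) S =
    (\<Sum>\<alpha>\<in>D. \<phi> \<alpha> * column_sign ty n (root_col ty n \<alpha>) * S $$ (root_row \<alpha>, root_col ty n \<alpha>) :: 'a::field)"
proof -
  let ?m = "msize ty n"
  let ?t = "\<lambda>\<alpha>. \<phi> \<alpha> * column_sign ty n (root_col ty n \<alpha>) * S $$ (root_row \<alpha>, root_col ty n \<alpha>)"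
  have "(if a \<le> b then pair_matrix ty n (D, \<phi>) $$ (a, b) * S $$ (a, b) else 0) =
      (\<Sum>\<alpha>\<in>D. if b = root_col ty n \<alpha> then if a = root_row \<alpha> then ?t \<alpha> else 0 else 0)"
    if ab: "a < ?m" "b < ?m" for a b
  proof (cases "a \<le> b")
    case True
    have "pair_matrix ty n (D, \<phi>) $$ (a, b) * S $$ (a, b) =
        (\<Sum>\<alpha>\<in>D. if b = root_col ty n \<alpha> then if a = root_row \<alpha> then ?t \<alpha> else 0 else 0)"
      unfolding pair_matrix_index[OF D ab] sum_distrib_right
    proof (intro sum.cong refl)
      fix \<alpha> assume "\<alpha> \<in> D"
      then have "root_row \<alpha> \<le> root_col ty n \<alpha>" using root_bounds(1) D by blast
      then show "\<phi> \<alpha> * (column_sign ty n (root_col ty n \<alpha>) *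
          (if a = root_row \<alpha> \<and> b = root_col ty n \<alpha> then 1
           else if a = root_col ty n \<alpha> \<and> b = root_row \<alpha> then form_sign ty else 0)) * S $$ (a, b) =
          (if b = root_col ty n \<alpha> then if a = root_row \<alpha> then ?t \<alpha> else 0 else 0)"
        using True by auto
    qed
    then show ?thesis using True by simp
  next
    case False
    have "(\<Sum>\<alpha>\<in>D. if b = root_col ty n \<alpha> then if a = root_row \<alpha> then ?t \<alpha> else 0 else 0) = 0"
    proof (rule sum.neutral, rule ballI)
      fix \<alpha> assume "\<alpha> \<in> D"
      then have "root_row \<alpha> \<le> root_col ty n \<alpha>" using root_bounds(1) D by blast
      then show "(if b = root_col ty n \<alpha> then if a = root_row \<alpha> then ?t \<alpha> else 0 else 0) = 0" using False by auto
    qed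
    then show ?thesis using False by simp
  qed
  then have "upper_pairing ?m (pair_matrix ty n (D, \<phi>)) S =
      (\<Sum>a<?m. \<Sum>b<?m. \<Sum>\<alpha>\<in>D. if b = root_col ty n \<alpha> then if a = root_row \<alpha> then ?t \<alpha> else 0 else 0)"
    unfolding upper_pairing_def by (intro sum.cong refl) simp
  also have "\<dots> = (\<Sum>a<?m. \<Sum>\<alpha>\<in>D. \<Sum>b<?m. if b = root_col ty n \<alpha> then if a = root_row \<alpha> then ?t \<alpha> else 0 else 0)"
    by (rule sum.cong[OF refl]) (rule sum.swap)
  also have "\<dots> = (\<Sum>\<alpha>\<in>D. \<Sum>a<?m. \<Sum>b<?m. if b = root_col ty n \<alpha> then if a = root_row \<alpha> then ?t \<alpha> else 0 else 0)"
    by (rule sum.swap)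
  also have "\<dots> = (\<Sum>\<alpha>\<in>D. ?t \<alpha>)"
  proof (intro sum.cong refl)
    fix \<alpha> assume "\<alpha> \<in> D"
    then have "root_row \<alpha> < ?m" "root_col ty n \<alpha> < ?m" using root_bounds(4,5) D by blast+
    then show "(\<Sum>a<?m. \<Sum>b<?m. if b = root_col ty n \<alpha> then if a = root_row \<alpha> then ?t \<alpha> else 0 else 0) = ?t \<alpha>" by simp
  qed
  finally show ?thesis .
qed

text \<open>The group orders come from \<open>prod_sum_unitri\<close>, the polar orders from
  \<open>polar_induced\<close>. The value depends neither on the coefficients nor on the group
  element; the type argument carries the field.\<close>

definition supercharacter_scale :: "'a::{field,finite} itself \<Rightarrow> gtype \<Rightarrow> nat \<Rightarrow> root set \<Rightarrow> complex" where
  "supercharacter_scale _ ty n D =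
     of_nat (card (unitri (msize ty n) :: 'a mat set)) ^ card D /
     (of_nat (card (unitri (msize ty n) :: 'a mat set)) *
      (\<Prod>\<alpha>\<in>D. of_nat (card (polar_group ty n (root_row \<alpha>) (root_col ty n \<alpha>) :: 'a mat set))))"

lemma card_unitri_nz: "of_nat (card (unitri m :: 'a::{field,finite} mat set)) \<noteq> (0 :: complex)"
proof -
  have "(unitri m :: 'a mat set) \<noteq> {}" using one_unitri by blast
  then show ?thesis by simp
qed

lemma card_polar_nz:
  assumes "\<alpha> \<in> roots ty n"
  shows "of_nat (card (polar_group ty n (root_row \<alpha>) (root_col ty n \<alpha>) :: 'a::{field,finite} mat set)) \<noteq> (0 :: complex)"
proof -
  let ?P = "polar_group ty n (root_row \<alpha>) (root_col ty n \<alpha>) :: 'a mat set"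
  have "1\<^sub>m (msize ty n) \<in> ?P"
    by (rule one_polar_group[OF refl]) (use root_bounds[OF assms] in auto)
  moreover have "finite ?P" by (rule finite_subset[OF _ finite_unitri[of "msize ty n"]]) (auto simp: polar_group_def)
  ultimately show ?thesis by (auto simp: card_eq_0_iff)
qed

lemma supercharacter_scale_nz:
  "D \<subseteq> roots ty n \<Longrightarrow> supercharacter_scale TYPE('a::{field,finite}) ty n D \<noteq> 0"
  unfolding supercharacter_scale_def
  using card_unitri_nz[where 'a = 'a] card_polar_nz[where 'a = 'a] finite_subset[OF _ finite_roots]
  by (auto simp: prod_zero_iff)

lemma elementary_character_eq:
  fixes z :: "'a::{field,finite} mat" and \<theta> :: "'a \<Rightarrow> complex"
  assumes two: "(2 :: 'a) \<noteq> 0" and \<theta>: "nontrivial_additive_character \<theta>" and r: "r \<noteq> 0"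
    and z: "z \<in> U_set ty n" and \<alpha>: "\<alpha> \<in> roots ty n"
  shows "elementary_character ty n \<theta> \<alpha> r z =
    (\<Sum>g\<in>unitri (msize ty n). \<theta> (r * column_sign ty n (root_col ty n \<alpha>) *
       (g * staircase_coord ty n z * g\<^sup>T) $$ (root_row \<alpha>, root_col ty n \<alpha>))) /
      of_nat (card (polar_group ty n (root_row \<alpha>) (root_col ty n \<alpha>) :: 'a mat set))"
proof -
  have lin: "elem_linear ty n \<theta> \<alpha> r = (\<lambda>x. \<theta> (r * x $$ (root_row \<alpha>, msize ty n - Suc (root_col ty n \<alpha>))))"
    by (rule ext) (rule elem_linear_eq[OF \<alpha>])
  show ?thesis
    unfolding elementary_character_def lin U_root_eq[OF \<alpha>]
    by (rule polar_induced[OF refl root_bounds(1,2,3)[OF \<alpha>] two \<theta> r z])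
qed

lemma supercharacter_eq:
  fixes z :: "'a::{field,finite} mat" and \<theta> :: "'a \<Rightarrow> complex"
  assumes two: "(2 :: 'a) \<noteq> 0" and \<theta>: "nontrivial_additive_character \<theta>"
    and z: "z \<in> U_set ty n" and P: "(D, \<phi>) \<in> basic_pairs ty n"
  shows "supercharacter ty n \<theta> D \<phi> z = supercharacter_scale TYPE('a) ty n D *
    orbit_sum \<theta> (msize ty n) (pair_matrix ty n (D, \<phi>)) (staircase_coord ty n z)"
proof -
  let ?m = "msize ty n" and ?S = "staircase_coord ty n z"
  let ?N = "of_nat (card (unitri ?m :: 'a mat set)) :: complex"
  let ?p = "\<lambda>\<alpha>. of_nat (card (polar_group ty n (root_row \<alpha>) (root_col ty n \<alpha>) :: 'a mat set)) :: complex"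
  define t where "t \<alpha> g = \<phi> \<alpha> * column_sign ty n (root_col ty n \<alpha>) * (g * ?S * g\<^sup>T) $$ (root_row \<alpha>, root_col ty n \<alpha>)" for \<alpha> g
  have D: "basic ty n D" and \<phi>: "\<And>\<alpha>. \<alpha> \<in> D \<Longrightarrow> \<phi> \<alpha> \<noteq> 0" using P by (auto simp: basic_pairs_def)
  have sub: "D \<subseteq> roots ty n" and disj: "\<And>\<alpha> \<beta>. \<alpha> \<in> D \<Longrightarrow> \<beta> \<in> D \<Longrightarrow> \<alpha> \<noteq> \<beta> \<Longrightarrow>
      {root_row \<alpha>, root_col ty n \<alpha>} \<inter> {root_row \<beta>, root_col ty n \<beta>} = {}"
    using D unfolding basic_iff by blast+
  have Sc: "?S \<in> carrier_mat ?m ?m"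
    using isometry_cayley_staircase[OF two] z
    unfolding staircase_coord_def U_set_eq[OF two] by (blast intro: staircase_carrier)
  have "supercharacter ty n \<theta> D \<phi> z = (\<Prod>\<alpha>\<in>D. (\<Sum>g\<in>unitri ?m. \<theta> (t \<alpha> g)) / ?p \<alpha>)"
    unfolding supercharacter_def t_def
    by (rule prod.cong[OF refl]) (rule elementary_character_eq[OF two \<theta> \<phi> z subsetD[OF sub]])
  also have "\<dots> = (\<Prod>\<alpha>\<in>D. \<Sum>g\<in>unitri ?m. \<theta> (t \<alpha> g)) / (\<Prod>\<alpha>\<in>D. ?p \<alpha>)"
    by (rule prod_dividef)
  also have "(\<Prod>\<alpha>\<in>D. \<Sum>g\<in>unitri ?m. \<theta> (t \<alpha> g)) =
      ?N ^ card D * (\<Sum>g\<in>unitri ?m. \<Prod>\<alpha>\<in>D. \<theta> (t \<alpha> g)) / ?N"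
  proof -
    have "?N * (\<Prod>\<alpha>\<in>D. \<Sum>g\<in>unitri ?m. \<theta> (t \<alpha> g)) = ?N ^ card D * (\<Sum>g\<in>unitri ?m. \<Prod>\<alpha>\<in>D. \<theta> (t \<alpha> g))"
    \<comment> \<open>Entry \<open>(i, k)\<close> of g S g^T depends only on rows i and k of g, and
      distinct roots of a basic set have disjoint index pairs.\<close>
    proof (rule prod_sum_unitri[where R = "\<lambda>\<alpha>. {root_row \<alpha>, root_col ty n \<alpha>}", OF basic_finite[OF D] _ disj])
      fix \<alpha> and g h :: "'a mat"
      assume a: "\<alpha> \<in> D" and u: "g \<in> unitri ?m" "h \<in> unitri ?m"
        and rows: "\<And>i c. i \<in> {root_row \<alpha>, root_col ty n \<alpha>} \<Longrightarrow> i < ?m \<Longrightarrow> c < ?m \<Longrightarrow> g $$ (i, c) = h $$ (i, c)"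
      have b: "root_row \<alpha> < ?m" "root_col ty n \<alpha> < ?m" using root_bounds(4,5) a sub by blast+
      have "(g * ?S * g\<^sup>T) $$ (root_row \<alpha>, root_col ty n \<alpha>) = (h * ?S * h\<^sup>T) $$ (root_row \<alpha>, root_col ty n \<alpha>)"
        unfolding congruence_index[OF unitri_carrier[OF u(1)] Sc b] congruence_index[OF unitri_carrier[OF u(2)] Sc b]
        using rows b by (intro sum.cong refl) simp
      then show "\<theta> (t \<alpha> g) = \<theta> (t \<alpha> h)" by (simp only: t_def)
    qed
    then show ?thesis using card_unitri_nz[of ?m, where 'a = 'a] by (simp add: field_simps)
  qed
  also have "(\<Sum>g\<in>unitri ?m. \<Prod>\<alpha>\<in>D. \<theta> (t \<alpha> g)) = orbit_sum \<theta> ?m (pair_matrix ty n (D, \<phi>)) ?S"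
    unfolding orbit_sum_def upper_pairing_pair_matrix[OF sub] additive_character_sum[OF \<theta>] t_def ..
  finally show ?thesis by (simp add: supercharacter_scale_def)
qed

subsection \<open>Superclasses as congruence orbits\<close>

text \<open>The adjoint with respect to the form, the transpose of \<Omega> being its inverse. It
  converts a factor to the right of \<open>e_pair\<close> into a transposed factor to the right of
  \<open>pair_matrix\<close>, and back.\<close>

definition form_adjoint :: "gtype \<Rightarrow> nat \<Rightarrow> 'a::field mat \<Rightarrow> 'a mat" where
  "form_adjoint ty n X = form_matrix ty n * X\<^sup>T * (form_matrix ty n)\<^sup>T"

lemma form_adjoint_index:
  fixes X :: "'a::field mat"
  assumes X: "X \<in> carrier_mat (msize ty n) (msize ty n)" and xy: "x < msize ty n" "y < msize ty n"
  shows "form_adjoint ty n X $$ (x, y) = - form_sign ty * column_sign ty n (msize ty n - Suc x) * column_sign ty n y *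
    X $$ (msize ty n - Suc y, msize ty n - Suc x)"
proof -
  let ?m = "msize ty n" and ?\<Omega> = "form_matrix ty n :: 'a mat"
  have XT: "X\<^sup>T \<in> carrier_mat ?m ?m" using X by simp
  have c: "?\<Omega> * X\<^sup>T \<in> carrier_mat ?m ?m" by (rule mult_carrier_mat[OF form_matrix_carrier XT])
  have c2: "?\<Omega> * X\<^sup>T * ?\<Omega> \<in> carrier_mat ?m ?m" by (rule mult_carrier_mat[OF c form_matrix_carrier])
  have y: "?m - Suc y < ?m" "?m - Suc x < ?m" using xy by auto
  have "form_adjoint ty n X = - form_sign ty \<cdot>\<^sub>m (?\<Omega> * X\<^sup>T * ?\<Omega>)"
    unfolding form_adjoint_def form_matrix_transpose by (rule mult_smult_distrib[OF c form_matrix_carrier])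
  then have "form_adjoint ty n X $$ (x, y) = - form_sign ty * (?\<Omega> * X\<^sup>T * ?\<Omega>) $$ (x, y)"
    using carrier_matD[OF c2] xy by simp
  also have "(?\<Omega> * X\<^sup>T * ?\<Omega>) $$ (x, y) = (?\<Omega> * X\<^sup>T) $$ (x, ?m - Suc y) * column_sign ty n y"
    by (rule mult_form_matrix_index[OF c xy])
  also have "(?\<Omega> * X\<^sup>T) $$ (x, ?m - Suc y) = column_sign ty n (?m - Suc x) * X\<^sup>T $$ (?m - Suc x, ?m - Suc y)"
    by (rule form_matrix_mult_index[OF XT xy(1) y(1)])
  also have "X\<^sup>T $$ (?m - Suc x, ?m - Suc y) = X $$ (?m - Suc y, ?m - Suc x)" using X y by simp
  finally show ?thesis by (simp only: mult_ac)
qed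

text \<open>Up to signs the adjoint is reflection in the antidiagonal, which preserves upper
  triangularity; on the diagonal the signs cancel.\<close>

lemma form_adjoint_unitri:
  fixes X :: "'a::field mat"
  assumes X: "X \<in> unitri (msize ty n)"
  shows "form_adjoint ty n X \<in> unitri (msize ty n)"
proof -
  let ?m = "msize ty n"
  note ix = form_adjoint_index[OF unitri_carrier[OF X]]
  have XT: "X\<^sup>T \<in> carrier_mat ?m ?m" using unitri_carrier[OF X] by simp
  have "form_adjoint ty n X \<in> carrier_mat ?m ?m"
    unfolding form_adjoint_def
    by (rule mult_carrier_mat[OF mult_carrier_mat[OF form_matrix_carrier XT]]) simp
  moreover have "form_adjoint ty n X $$ (x, y) = 0" if "x < ?m" "y < ?m" "y < x" for x y
    using ix[OF that(1,2)] unitri_lower[OF X, of "?m - Suc x" "?m - Suc y"] that by simp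
  moreover have "form_adjoint ty n X $$ (x, x) = 1" if x: "x < ?m" for x
  proof -
    have "- form_sign ty * column_sign ty n (?m - Suc x) * column_sign ty n x = (1 :: 'a)"
      using x by (auto simp: form_sign_def column_sign_def msize_eq mid_def)
    then show ?thesis using ix[OF x x] unitri_diag[OF X, of "?m - Suc x"] x by simp
  qed
  ultimately show ?thesis unfolding unitri_iff by blast
qed

lemma form_adjoint_mult:
  fixes X :: "'a::field mat"
  assumes X: "X \<in> carrier_mat (msize ty n) (msize ty n)"
  shows "form_adjoint ty n X * form_matrix ty n = form_matrix ty n * X\<^sup>T"
    and "X * form_matrix ty n = form_matrix ty n * (form_adjoint ty n X)\<^sup>T"
proof -
  let ?m = "msize ty n" and ?\<Omega> = "form_matrix ty n :: 'a mat"
  have c: "X\<^sup>T \<in> carrier_mat ?m ?m" "?\<Omega>\<^sup>T \<in> carrier_mat ?m ?m" "?\<Omega> * X\<^sup>T \<in> carrier_mat ?m ?m"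
    "X * ?\<Omega> \<in> carrier_mat ?m ?m"
    using X by (simp, simp, intro mult_carrier_mat[OF form_matrix_carrier], simp, intro mult_carrier_mat[OF X form_matrix_carrier])
  show "form_adjoint ty n X * ?\<Omega> = ?\<Omega> * X\<^sup>T"
    unfolding form_adjoint_def assoc_mult_mat[OF c(3,2) form_matrix_carrier] form_matrix_inverse
    by (rule right_mult_one_mat[OF c(3)])
  have "(form_adjoint ty n X)\<^sup>T = ?\<Omega> * (X * ?\<Omega>\<^sup>T)"
    unfolding form_adjoint_def transpose_mult[OF c(3,2)] transpose_mult[OF form_matrix_carrier c(1)] by simp
  then have "(form_adjoint ty n X)\<^sup>T = (- form_sign ty \<cdot>\<^sub>m ?\<Omega>) * (X * ?\<Omega>)"
    unfolding form_matrix_transpose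
    by (simp only: mult_smult_distrib[OF X form_matrix_carrier] mult_smult_distrib[OF form_matrix_carrier c(4)]
        mult_smult_assoc_mat[OF form_matrix_carrier c(4)])
  then have e: "(form_adjoint ty n X)\<^sup>T = ?\<Omega>\<^sup>T * (X * ?\<Omega>)" by (simp only: form_matrix_transpose)
  show "X * ?\<Omega> = ?\<Omega> * (form_adjoint ty n X)\<^sup>T"
    unfolding e assoc_mult_mat[OF form_matrix_carrier c(2,4), symmetric] form_matrix_inverse
    by (rule left_mult_one_mat[OF c(4), symmetric])
qed

lemma form_sign_cases: "form_sign ty = (1 :: 'a::field) \<or> form_sign ty = (-1 :: 'a)"
  by (simp add: form_sign_def)

text \<open>From orbit to superclass, the adjoint rewrites a congruence as a two-sided
  multiplication and the half sum is absorbed into the right factor. The converse yields only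
  unrelated left and right factors, and the uniqueness of monomial matrices has to repair
  this.\<close>

lemma superclass_iff_orbit:
  fixes z :: "'a::{field,finite} mat"
  assumes two: "(2 :: 'a) \<noteq> 0" and z: "z \<in> U_set ty n" and D: "basic ty n D"
  shows "z \<in> superclass ty n D \<phi> \<longleftrightarrow>
    staircase_coord ty n z \<in> congruence_orbit (msize ty n) (pair_matrix ty n (D, \<phi>))"
proof -
  let ?m = "msize ty n" and ?\<Omega> = "form_matrix ty n :: 'a mat" and ?e = "e_pair ty n D \<phi>"
  let ?S = "staircase_coord ty n z" and ?M = "pair_matrix ty n (D, \<phi>)"
  have ziso: "z \<in> isometries ty n" using z by (simp add: U_set_eq[OF two])
  have zu: "z \<in> unitri ?m" by (rule isometries_unitri[OF ziso])
  have St: "?S \<in> staircase (form_sign ty) ?m"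
    using isometry_cayley_staircase[OF two ziso] by (simp add: staircase_coord_def)
  have M: "?M = ?e * ?\<Omega>" by (simp add: pair_matrix_def)
  have Mm: "?M \<in> monomials (form_sign ty) ?m" by (rule pair_matrix_monomial[OF D])
  note Oc = form_matrix_carrier[of ty n, where 'a = 'a] and ec = e_pair_carrier[of ty n D \<phi>]
  let ?h = "half_sum ?m z" and ?a = "cayley ?m z"
  note hu = half_sum_unitri[OF two zu]
  note ac = cayley_carrier[OF two zu] and hc = unitri_carrier[OF hu] and kc = unitri_carrier[OF uinv(1)[OF hu]]
  show ?thesis
  proof
    assume "?S \<in> congruence_orbit ?m ?M"
    then obtain g where g: "g \<in> unitri ?m" "?S = g * ?M * g\<^sup>T" by (auto simp: congruence_orbit_def)
    note gc = unitri_carrier[OF g(1)]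
    have gT: "g\<^sup>T \<in> carrier_mat ?m ?m" using gc by simp
    let ?d = "form_adjoint ty n g"
    have du: "?d \<in> unitri ?m" by (rule form_adjoint_unitri[OF g(1)])
    note dc = unitri_carrier[OF du]
    have "g * ?M * g\<^sup>T = g * (?e * (?\<Omega> * g\<^sup>T))"
      unfolding M assoc_mult_mat[OF gc mult_carrier_mat[OF ec Oc] gT] assoc_mult_mat[OF ec Oc gT] ..
    also have "\<dots> = (g * ?e * ?d) * ?\<Omega>"
      unfolding form_adjoint_mult(1)[OF gc, symmetric] assoc_mult_mat[OF mult_carrier_mat[OF gc ec] dc Oc]
        assoc_mult_mat[OF gc ec mult_carrier_mat[OF dc Oc]] ..
    finally have "?a * ?\<Omega> = (g * ?e * ?d) * ?\<Omega>" using g(2) by (simp add: staircase_coord_def)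
    then have "?a = g * ?e * ?d"
      by (rule inj_onD[OF mult_form_matrix_inj]) (use ac mult_carrier_mat[OF mult_carrier_mat[OF gc ec] dc] in auto)
    then have "z - 1\<^sub>m ?m = g * ?e * (?d * ?h)"
      unfolding cayley_half_sum[OF two zu, symmetric]
      by (simp only: assoc_mult_mat[OF mult_carrier_mat[OF gc ec] dc hc])
    then show "z \<in> superclass ty n D \<phi>"
      using z g(1) mult_unitri[OF du hu] unfolding superclass_def by blast
  next
    assume "z \<in> superclass ty n D \<phi>"
    then obtain A B where AB: "A \<in> unitri ?m" "B \<in> unitri ?m" "z - 1\<^sub>m ?m = A * ?e * B"
      by (auto simp: superclass_def)
    note Ac = unitri_carrier[OF AB(1)] and Bc = unitri_carrier[OF AB(2)]
    let ?C = "B * uinv ?m ?h"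
    have Cu: "?C \<in> unitri ?m" by (rule mult_unitri[OF AB(2) uinv(1)[OF hu]])
    note Cc = unitri_carrier[OF Cu]
    let ?d = "form_adjoint ty n ?C"
    have du: "?d \<in> unitri ?m" by (rule form_adjoint_unitri[OF Cu])
    have dT: "?d\<^sup>T \<in> carrier_mat ?m ?m" using unitri_carrier[OF du] by simp
    have "?a = A * ?e * ?C"
      unfolding cayley_def AB(3) by (rule assoc_mult_mat[OF mult_carrier_mat[OF Ac ec] Bc kc])
    then have "?S = A * ?e * (?C * ?\<Omega>)"
      unfolding staircase_coord_def by (simp only: assoc_mult_mat[OF mult_carrier_mat[OF Ac ec] Cc Oc])
    also have "\<dots> = A * ?M * ?d\<^sup>T"
      unfolding form_adjoint_mult(2)[OF Cc] M assoc_mult_mat[OF Ac ec mult_carrier_mat[OF Oc dT]]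
        assoc_mult_mat[OF Ac mult_carrier_mat[OF ec Oc] dT] assoc_mult_mat[OF ec Oc dT] ..
    finally have S: "?S = A * ?M * ?d\<^sup>T" .
    \<comment> \<open>Being \<epsilon>-symmetric, \<open>?S\<close> is congruent to some monomial
      matrix; this one lies in the same two-sided orbit as \<open>?M\<close> and therefore equals
      it.\<close>
    obtain M1 where M1: "M1 \<in> monomials (form_sign ty) ?m" "?S \<in> congruence_orbit ?m M1"
      using staircase_in_orbit[OF two form_sign_cases St] by blast
    obtain g where g: "g \<in> unitri ?m" "?S = g * M1 * g\<^sup>T" using M1(2) by (auto simp: congruence_orbit_def)
    let ?k = "uinv ?m g"
    note ku = uinv(1)[OF g(1)]
    note gc = unitri_carrier[OF g(1)] and kkc = unitri_carrier[OF ku]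
    have kT: "?k\<^sup>T \<in> carrier_mat ?m ?m" using kkc by simp
    have M1c: "M1 \<in> carrier_mat ?m ?m" using M1(1) staircase_carrier by (auto simp: monomials_def)
    note Mc = pair_matrix_carrier[of ty n "(D, \<phi>)"]
    have "M1 = ?k * ?S * ?k\<^sup>T"
      unfolding g(2) congruence_mult[OF kkc gc M1c, symmetric] uinv(3)[OF g(1)] using M1c by simp
    also have "\<dots> = (?k * A) * ?M * (?k * ?d)\<^sup>T"
      unfolding S transpose_mult[OF kkc unitri_carrier[OF du]]
        assoc_mult_mat[OF kkc mult_carrier_mat[OF mult_carrier_mat[OF Ac Mc] dT] kT]
        assoc_mult_mat[OF mult_carrier_mat[OF Ac Mc] dT kT]
        assoc_mult_mat[OF Ac Mc mult_carrier_mat[OF dT kT]]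
        assoc_mult_mat[OF mult_carrier_mat[OF kkc Ac] Mc mult_carrier_mat[OF dT kT]]
        assoc_mult_mat[OF kkc Ac mult_carrier_mat[OF Mc mult_carrier_mat[OF dT kT]]] ..
    finally have "(?k * A) * ?M * (?k * ?d)\<^sup>T = M1" by simp
    then have "?M = M1"
      using monomial_two_sided_unique[OF mult_unitri[OF ku AB(1)] mult_unitri[OF ku du] form_sign_nz[of ty]]
        Mm M1(1) by (auto simp: monomials_def dest: staircase_eps)
    then show "?S \<in> congruence_orbit ?m ?M" using M1(2) by simp
  qed
qed

lemma card_superclass:
  assumes two: "(2 :: 'a::{field,finite}) \<noteq> 0" and D: "basic ty n D"
  shows "card (superclass ty n D \<phi> :: 'a mat set) =
    card (congruence_orbit (msize ty n) (pair_matrix ty n (D, \<phi>)))"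
proof -
  let ?O = "congruence_orbit (msize ty n) (pair_matrix ty n (D, \<phi>))"
  note bij = staircase_coord_bij[OF two, of ty n]
  have sub: "superclass ty n D \<phi> \<subseteq> U_set ty n" by (auto simp: superclass_def)
  have OS: "?O \<subseteq> staircase (form_sign ty) (msize ty n)"
    using congruence_orbit_subset pair_matrix_monomial[OF D] unfolding monomials_def by blast
  have "staircase_coord ty n ` superclass ty n D \<phi> = ?O"
  proof (intro equalityI subsetI)
    fix S assume "S \<in> staircase_coord ty n ` superclass ty n D \<phi>"
    then show "S \<in> ?O" using superclass_iff_orbit[OF two _ D] sub by blast
  next
    fix S assume S: "S \<in> ?O"
    then obtain z where z: "z \<in> U_set ty n" "S = staircase_coord ty n z"
      using OS bij unfolding bij_betw_def by blast
    then show "S \<in> staircase_coord ty n ` superclass ty n D \<phi>"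
      using S superclass_iff_orbit[OF two z(1) D] by blast
  qed
  moreover have "inj_on (staircase_coord ty n) (superclass ty n D \<phi>)"
    using inj_on_subset[OF bij_betw_imp_inj_on[OF bij] sub] .
  ultimately show ?thesis by (metis card_image)
qed

subsection \<open>The representatives\<close>

text \<open>Links the two descriptions of a representative: superclasses are defined through z - 1,
  \<open>z_rep\<close> through \<open>a_mat\<close>. The two matrices lie in one two-sided
  orbit.\<close>

lemma U_mat_minus_one:
  fixes x :: "'a::{field,finite} mat"
  assumes d: "(x, v, w) \<in> U_data ty n" and two: "(2 :: 'a) \<noteq> 0"
  shows "\<exists>g\<in>unitri (msize ty n). \<exists>h\<in>unitri (msize ty n).
    U_mat ty n (x, v, w) - 1\<^sub>m (msize ty n) = g * a_mat ty n (U_mat ty n (x, v, w)) * h"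
proof -
  let ?r = "mid ty" and ?J = "antidiag n :: 'a mat" and ?y = "uinv n x"
  have x: "x \<in> unitri n" and v: "v \<in> carrier_mat n ?r" and w: "w \<in> carrier_mat n n"
    using U_data_carrier[OF d] by auto
  have y: "?y \<in> unitri n" by (rule uinv(1)[OF x])
  note xc = unitri_carrier[OF x] and yc = unitri_carrier[OF y] and Jc = antidiag_carrier[of n, where 'a = 'a]
  define Y where "Y = ?J * ?y\<^sup>T * ?J"
  define E where "E = - (v\<^sup>T * ?J)"
  define F where "F = - (?J * (x - 1\<^sub>m n)\<^sup>T * ?J)"
  define w' where "w' = w + (1 / 2) \<cdot>\<^sub>m (v * v\<^sup>T * ?J)"
  define B where "B = (1 / 2) \<cdot>\<^sub>m (x * v)"
  have vT: "v\<^sup>T \<in> carrier_mat ?r n" and yT: "?y\<^sup>T \<in> carrier_mat n n" and xT: "x\<^sup>T \<in> carrier_mat n n"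
    using v yc xc by simp_all
  have vJ: "v\<^sup>T * ?J \<in> carrier_mat ?r n" by (rule mult_carrier_mat[OF vT Jc])
  have Yu: "Y \<in> unitri n" unfolding Y_def by (rule antidual_unitri[OF y])
  note Yc = unitri_carrier[OF Yu]
  have Ec: "E \<in> carrier_mat ?r n" unfolding E_def using vJ by simp
  have x1: "x - 1\<^sub>m n \<in> carrier_mat n n" by (rule minus_carrier_mat) simp
  have x1T: "(x - 1\<^sub>m n)\<^sup>T \<in> carrier_mat n n" using x1 by simp
  have Fc: "F \<in> carrier_mat n n"
    unfolding F_def using mult_carrier_mat[OF mult_carrier_mat[OF Jc x1T] Jc] by simp
  have vv: "v * v\<^sup>T * ?J \<in> carrier_mat n n" by (rule mult_carrier_mat[OF mult_carrier_mat[OF v vT] Jc])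
  have w'c: "w' \<in> carrier_mat n n" unfolding w'_def using w vv by simp
  have xv: "x * v \<in> carrier_mat n ?r" by (rule mult_carrier_mat[OF xc v])
  have xw: "x * w \<in> carrier_mat n n" by (rule mult_carrier_mat[OF xc w])
  have Bc: "B \<in> carrier_mat n ?r" unfolding B_def using xv by simp
  let ?z = "U_mat ty n (x, v, w)"
  have z: "?z = block3 x (x * v) (x * w) (1\<^sub>m ?r) E Y" unfolding U_mat_eq[OF x] E_def Y_def ..
  have a: "a_mat ty n ?z = block3 (x - 1\<^sub>m n) v w' (0\<^sub>m ?r ?r) E F"
    unfolding a_mat_U_mat[OF d] E_def F_def w'_def ..
  \<comment> \<open>The diagonal blocks of \<open>g\<close> turn \<open>v\<close> into x v and
    restore the lower right block. The block \<open>B\<close>, half of x v, meets \<open>E\<close>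
    and cancels the quadratic correction in \<open>w'\<close>; \<open>h\<close> undoes the left
    factor \<open>x\<close> in the upper left block.\<close>
  define g where "g = block3 x B (0\<^sub>m n n) (1\<^sub>m ?r) (0\<^sub>m ?r n) Y"
  define h where "h = block3 ?y (0\<^sub>m n ?r) (0\<^sub>m n n) (1\<^sub>m ?r) (0\<^sub>m ?r n) (1\<^sub>m n)"
  have gu: "g \<in> unitri (msize ty n)" unfolding g_def msize_eq by (rule block3_unitri) (use x Bc Yu in simp_all)
  have hu: "h \<in> unitri (msize ty n)" unfolding h_def msize_eq by (rule block3_unitri) (use y in simp_all)
  have x1y: "(x - 1\<^sub>m n) * ?y \<in> carrier_mat n n" by (rule mult_carrier_mat[OF x1 yc])
  have ah: "a_mat ty n ?z * h = block3 ((x - 1\<^sub>m n) * ?y) v w' (0\<^sub>m ?r ?r) E F"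
    unfolding a h_def
    by (subst block3_mult[where n = n and r = ?r and k = n])
      (use x1 v w'c Ec Fc yc in simp_all)
  have gah: "g * (a_mat ty n ?z * h) = block3 (x * ((x - 1\<^sub>m n) * ?y)) (x * v) (x * w' + B * E) (0\<^sub>m ?r ?r) E (Y * F)"
    unfolding ah g_def
    by (subst block3_mult[where n = n and r = ?r and k = n])
      (use x1y v w'c Ec Fc xc Bc Yc xv mult_carrier_mat[OF xc w'c] mult_carrier_mat[OF Bc Ec] in simp_all)
  have e1: "x * ((x - 1\<^sub>m n) * ?y) = x - 1\<^sub>m n"
  proof -
    have "(x - 1\<^sub>m n) * ?y = 1\<^sub>m n - ?y"
      using minus_mult_distrib_mat[OF xc one_carrier_mat yc] uinv(2)[OF x] yc by simp
    then show ?thesis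
      using mult_minus_distrib_mat[OF xc one_carrier_mat yc] uinv(2)[OF x] xc by simp
  qed
  have e2: "x * w' + B * E = x * w"
  proof -
    have xvv: "x * (v * v\<^sup>T * ?J) = x * v * (v\<^sup>T * ?J)"
      unfolding assoc_mult_mat[OF v vT Jc] assoc_mult_mat[OF xc v vJ] ..
    have c: "x * v * (v\<^sup>T * ?J) \<in> carrier_mat n n" by (rule mult_carrier_mat[OF xv vJ])
    have "x * w' = x * w + (1 / 2) \<cdot>\<^sub>m (x * v * (v\<^sup>T * ?J))"
      unfolding w'_def mult_add_distrib_mat[OF xc w smult_carrier_mat[OF vv]] mult_smult_distrib[OF xc vv] xvv ..
    moreover have "B * E = - ((1 / 2) \<cdot>\<^sub>m (x * v * (v\<^sup>T * ?J)))"
      unfolding B_def E_def using mult_smult_assoc_mat[OF xv uminus_carrier_mat[OF vJ], of "1 / 2"] uminus_mult_right_mat[of "x * v" "v\<^sup>T * ?J"] xv vJ c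
      by (intro eq_matI) auto
    ultimately show ?thesis using xw c by (intro eq_matI) (auto simp del: index_mult_mat(1))
  qed
  have e3: "Y * F = Y - 1\<^sub>m n"
  proof -
    have xyT: "?y\<^sup>T * x\<^sup>T = 1\<^sub>m n" using transpose_mult[OF xc yc] uinv(2)[OF x] by simp
    have JyT: "?J * ?y\<^sup>T \<in> carrier_mat n n" by (rule mult_carrier_mat[OF Jc yT])
    have tr: "(x - 1\<^sub>m n)\<^sup>T = x\<^sup>T - 1\<^sub>m n" using xc by (intro eq_matI) auto
    have inner: "?y\<^sup>T * (x - 1\<^sub>m n)\<^sup>T = 1\<^sub>m n - ?y\<^sup>T"
      unfolding tr mult_minus_distrib_mat[OF yT xT one_carrier_mat] xyT using yT by simp
    have "Y * (?J * (x - 1\<^sub>m n)\<^sup>T * ?J) = ?J * (?y\<^sup>T * (x - 1\<^sub>m n)\<^sup>T) * ?J"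
    proof -
      have JxJ: "?J * (x - 1\<^sub>m n)\<^sup>T \<in> carrier_mat n n" by (rule mult_carrier_mat[OF Jc x1T])
      have "Y * (?J * (x - 1\<^sub>m n)\<^sup>T * ?J) = Y * (?J * (x - 1\<^sub>m n)\<^sup>T) * ?J"
        by (rule assoc_mult_mat[OF Yc JxJ Jc, symmetric])
      also have "Y * (?J * (x - 1\<^sub>m n)\<^sup>T) = (Y * ?J) * (x - 1\<^sub>m n)\<^sup>T"
        by (rule assoc_mult_mat[OF Yc Jc x1T, symmetric])
      also have "Y * ?J = ?J * ?y\<^sup>T"
        unfolding Y_def assoc_mult_mat[OF JyT Jc Jc] antidiag_square by (rule right_mult_one_mat[OF JyT])
      also have "?J * ?y\<^sup>T * (x - 1\<^sub>m n)\<^sup>T = ?J * (?y\<^sup>T * (x - 1\<^sub>m n)\<^sup>T)"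
        by (rule assoc_mult_mat[OF Jc yT x1T])
      finally show ?thesis .
    qed
    also have "\<dots> = 1\<^sub>m n - Y"
      unfolding inner mult_minus_distrib_mat[OF Jc one_carrier_mat yT] right_mult_one_mat[OF Jc]
        minus_mult_distrib_mat[OF Jc JyT Jc] antidiag_square Y_def ..
    finally have k: "Y * (?J * (x - 1\<^sub>m n)\<^sup>T * ?J) = 1\<^sub>m n - Y" .
    have X: "?J * (x - 1\<^sub>m n)\<^sup>T * ?J \<in> carrier_mat n n" by (rule mult_carrier_mat[OF mult_carrier_mat[OF Jc x1T] Jc])
    have "Y * F = - (Y * (?J * (x - 1\<^sub>m n)\<^sup>T * ?J))"
      unfolding F_def using uminus_mult_right_mat[of Y "?J * (x - 1\<^sub>m n)\<^sup>T * ?J"] Yc X by simp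
    then show ?thesis unfolding k using Yc by (intro eq_matI) auto
  qed
  have zc: "?z \<in> carrier_mat (n + ?r + n) (n + ?r + n)"
    using unitri_carrier[OF U_mat_unitri[OF d]] by (simp only: msize_eq)
  have Y1: "Y - 1\<^sub>m n \<in> carrier_mat n n" by (rule minus_carrier_mat) simp
  have "?z - 1\<^sub>m (msize ty n) = block3 (x - 1\<^sub>m n) (x * v) (x * w) (0\<^sub>m ?r ?r) E (Y - 1\<^sub>m n)"
  proof -
    note c1 = xc xv xw one_carrier_mat[of ?r] Ec Yc and c2 = x1 xv xw zero_carrier_mat[of ?r ?r] Ec Y1
    show ?thesis
      unfolding z msize_eq
      by (rule block3_eqI[of _ n ?r n], rule minus_carrier_mat[OF one_carrier_mat], rule block3_carrier[OF c2])
        (use block3_carrier[OF c1] xc Yc in \<open>simp_all add: block3_index[OF c1] block3_index[OF c2] del: index_mult_mat(1)\<close>)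
  qed
  also have "\<dots> = g * (a_mat ty n ?z * h)" unfolding gah e1 e2 e3 ..
  also have "\<dots> = g * a_mat ty n ?z * h"
  proof -
    have "a_mat ty n ?z \<in> carrier_mat (n + ?r + n) (n + ?r + n)"
      unfolding a by (rule block3_carrier[OF x1 v w'c zero_carrier_mat Ec Fc])
    then show ?thesis
      using assoc_mult_mat[of g "n + ?r + n" "n + ?r + n" _ "n + ?r + n" h "n + ?r + n"]
        unitri_carrier[OF gu] unitri_carrier[OF hu] by (simp add: msize_eq)
  qed
  finally show ?thesis using gu hu by blast
qed

lemma z_rep_in_superclass:
  assumes two: "(2 :: 'a::{field,finite}) \<noteq> 0" and D: "basic ty n D"
  shows "z_rep ty n D \<phi> \<in> (superclass ty n D \<phi> :: 'a mat set)"
proof -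
  let ?e = "e_pair ty n D \<phi> :: 'a mat" and ?z = "z_rep ty n D \<phi> :: 'a mat"
  have "pair_matrix ty n (D, \<phi>) \<in> staircase (form_sign ty :: 'a) (msize ty n)"
    using pair_matrix_monomial[OF D] by (auto simp: monomials_def)
  then have "?e \<in> lie_matrices ty n" by (simp add: lie_matrices_def pair_matrix_def)
  then obtain z where z: "z \<in> U_set ty n" "a_mat ty n z = ?e"
    using lie_matrices_in_a_mat_image[OF two] by (metis imageE)
  have "\<exists>!z. z \<in> U_set ty n \<and> a_mat ty n z = ?e"
    using z inj_onD[OF a_mat_inj[OF two]] by metis
  then have zr: "?z \<in> U_set ty n" "a_mat ty n ?z = ?e"
    unfolding z_rep_def by (metis (mono_tags, lifting) theI')+
  obtain x v w where d: "(x, v, w) \<in> U_data ty n" "?z = U_mat ty n (x, v, w)"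
    using zr(1) unfolding U_set_def by auto
  show ?thesis
    using U_mat_minus_one[OF d(1) two] zr unfolding d(2)[symmetric] superclass_def by auto
qed

theorem theorem6p4:
  fixes ty :: gtype and n p e :: nat
    and \<theta> :: "'a::{field, finite} \<Rightarrow> complex"
    and D' D'' :: "root set" and \<phi>' \<phi>'' :: "root \<Rightarrow> 'a"
  assumes "prime p" and "odd p" and "e \<ge> 1" and "card (UNIV :: 'a set) = p ^ e"
    and "n \<ge> 1"
    and "nontrivial_additive_character \<theta>"
    and "(D', \<phi>') \<in> basic_pairs ty n"
    and "(D'', \<phi>'') \<in> basic_pairs ty n"
  shows "(\<Sum>(D, \<phi>)\<in>basic_pairs ty n.
            1 / frobenius_product (U_group ty n)
                  (supercharacter ty n \<theta> D \<phi>) (supercharacter ty n \<theta> D \<phi>)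
            * supercharacter ty n \<theta> D \<phi> (z_rep ty n D' \<phi>')
            * cnj (supercharacter ty n \<theta> D \<phi> (z_rep ty n D'' \<phi>'')))
         = of_bool (D' = D'') * of_bool (\<phi>' = \<phi>'')
           * (of_nat (order (U_group ty n :: 'a mat monoid))
              / of_nat (card (superclass ty n D' \<phi>')))"
proof -
  let ?m = "msize ty n" and ?\<epsilon> = "form_sign ty :: 'a" and ?U = "U_set ty n :: 'a mat set"
  let ?St = "staircase ?\<epsilon> ?m" and ?\<Theta> = "staircase_coord ty n :: 'a mat \<Rightarrow> 'a mat"
  let ?pm = "pair_matrix ty n :: root set \<times> (root \<Rightarrow> 'a) \<Rightarrow> 'a mat"
  note \<theta> = assms(6)
  have two: "(2 :: 'a) \<noteq> 0" by (rule two_neq_zero_if_odd_card) (simp add: assms(2,4))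
  define X where "X M S = orbit_sum \<theta> ?m M S" for M S
  define nrm where "nrm M = (\<Sum>S\<in>?St. X M S * cnj (X M S))" for M
  define c where "c D = supercharacter_scale TYPE('a) ty n D" for D
  define N' where "N' = ?pm (D', \<phi>')"
  define N'' where "N'' = ?pm (D'', \<phi>'')"
  have basic: "basic ty n D" if "(D, \<phi>) \<in> basic_pairs ty n" for D and \<phi> :: "root \<Rightarrow> 'a"
    using that by (auto simp: basic_pairs_def)
  have mono: "?pm P \<in> monomials ?\<epsilon> ?m" if "P \<in> basic_pairs ty n" for P
    using that pair_matrix_monomial[OF basic[of "fst P" "snd P"], of "snd P"] by simp
  have bij: "bij_betw ?pm (basic_pairs ty n) (monomials ?\<epsilon> ?m)"
    by (rule bij_betwI[where g = "matrix_pair ty n"])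
      (use mono matrix_pair_basic matrix_pair_pair_matrix pair_matrix_matrix_pair[OF two] in auto)
  note bij\<Theta> = staircase_coord_bij[OF two, of ty n]
  \<comment> \<open>Orbit sums are constant on orbits, so the coordinate of \<open>z_rep\<close> may
    be replaced by the monomial matrix of its superclass.\<close>
  have rep: "X M (?\<Theta> (z_rep ty n D \<phi>)) = X M (?pm (D, \<phi>))" "z_rep ty n D \<phi> \<in> ?U"
    if P: "(D, \<phi>) \<in> basic_pairs ty n" for M D \<phi>
  proof -
    have zK: "z_rep ty n D \<phi> \<in> (superclass ty n D \<phi> :: 'a mat set)"
      by (rule z_rep_in_superclass[OF two basic[OF P]])
    then show zU: "z_rep ty n D \<phi> \<in> ?U" by (simp add: superclass_def)
    have "?\<Theta> (z_rep ty n D \<phi>) \<in> congruence_orbit ?m (?pm (D, \<phi>))"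
      using zK superclass_iff_orbit[OF two zU basic[OF P]] by blast
    then show "X M (?\<Theta> (z_rep ty n D \<phi>)) = X M (?pm (D, \<phi>))"
      unfolding X_def congruence_orbit_def using orbit_sum_congruence[OF _ pair_matrix_carrier] by auto
  qed
  have sc: "supercharacter ty n \<theta> D \<phi> z = c D * X (?pm (D, \<phi>)) (?\<Theta> z)"
    if "(D, \<phi>) \<in> basic_pairs ty n" "z \<in> ?U" for D \<phi> z
    unfolding c_def X_def by (rule supercharacter_eq[OF two \<theta> that(2,1)])
  have c0: "c D \<noteq> 0" if "(D, \<phi>) \<in> basic_pairs ty n" for D and \<phi> :: "root \<Rightarrow> 'a"
    unfolding c_def using basic[OF that] by (intro supercharacter_scale_nz) (simp add: basic_def)
  \<comment> \<open>The scale enters the norm as \<open>c D * cnj (c D)\<close>, the same factor as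
    in the product of the two character values, so it cancels and only the order of the group
    remains.\<close>
  have frob: "frobenius_product (U_group ty n) (supercharacter ty n \<theta> D \<phi>) (supercharacter ty n \<theta> D \<phi>) =
      c D * cnj (c D) * nrm (?pm (D, \<phi>)) / of_nat (card ?U)" if P: "(D, \<phi>) \<in> basic_pairs ty n" for D \<phi>
  proof -
    have "(\<Sum>g\<in>?U. supercharacter ty n \<theta> D \<phi> g * cnj (supercharacter ty n \<theta> D \<phi> g)) =
        (\<Sum>g\<in>?U. c D * cnj (c D) * (X (?pm (D, \<phi>)) (?\<Theta> g) * cnj (X (?pm (D, \<phi>)) (?\<Theta> g))))"
      by (intro sum.cong refl) (simp add: sc[OF P] mult_ac)
    also have "\<dots> = c D * cnj (c D) * nrm (?pm (D, \<phi>))"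
      unfolding sum_distrib_left[symmetric] nrm_def sum.reindex_bij_betw[OF bij\<Theta>, symmetric] ..
    finally show ?thesis by (simp add: frobenius_product_def Coset.order_def)
  qed
  have "(\<Sum>(D, \<phi>)\<in>basic_pairs ty n.
            1 / frobenius_product (U_group ty n)
                  (supercharacter ty n \<theta> D \<phi>) (supercharacter ty n \<theta> D \<phi>)
            * supercharacter ty n \<theta> D \<phi> (z_rep ty n D' \<phi>')
            * cnj (supercharacter ty n \<theta> D \<phi> (z_rep ty n D'' \<phi>''))) =
      (\<Sum>P\<in>basic_pairs ty n. of_nat (card ?U) * (X (?pm P) N' * cnj (X (?pm P) N'') / nrm (?pm P)))"
  proof (rule sum.cong[OF refl], clarify)
    fix D and \<phi> :: "root \<Rightarrow> 'a" assume P: "(D, \<phi>) \<in> basic_pairs ty n"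
    show "1 / frobenius_product (U_group ty n)
                  (supercharacter ty n \<theta> D \<phi>) (supercharacter ty n \<theta> D \<phi>)
            * supercharacter ty n \<theta> D \<phi> (z_rep ty n D' \<phi>')
            * cnj (supercharacter ty n \<theta> D \<phi> (z_rep ty n D'' \<phi>'')) =
        of_nat (card ?U) * (X (?pm (D, \<phi>)) N' * cnj (X (?pm (D, \<phi>)) N'') / nrm (?pm (D, \<phi>)))"
      unfolding frob[OF P] sc[OF P rep(2)[OF assms(7)]] sc[OF P rep(2)[OF assms(8)]]
        rep(1)[OF assms(7)] rep(1)[OF assms(8)] N'_def[symmetric] N''_def[symmetric]
      using c0[OF P] by simp
  qed
  also have "\<dots> = of_nat (card ?U) * (\<Sum>M\<in>monomials ?\<epsilon> ?m. X M N' * cnj (X M N'') / nrm M)"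
    unfolding sum_distrib_left[symmetric] sum.reindex_bij_betw[OF bij, symmetric] ..
  also have "(\<Sum>M\<in>monomials ?\<epsilon> ?m. X M N' * cnj (X M N'') / nrm M) =
      of_bool (N' = N'') / of_nat (card (congruence_orbit ?m N'))"
    unfolding X_def nrm_def
    by (rule orbit_sum_column_orthogonality[OF two form_sign_cases \<theta>]) (use mono assms(7,8) in \<open>simp_all add: N'_def N''_def\<close>)
  also have "of_bool (N' = N'') = (of_bool (D' = D'') * of_bool (\<phi>' = \<phi>'') :: complex)"
    using inj_onD[OF bij_betw_imp_inj_on[OF bij] _ assms(7,8)] unfolding N'_def N''_def by auto
  also have "card (congruence_orbit ?m N') = card (superclass ty n D' \<phi>')"
    unfolding N'_def by (rule card_superclass[OF two basic[OF assms(7)], symmetric])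
  finally show ?thesis by (simp add: Coset.order_def)
qed

end
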